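(* There is a deterministic algorithm that, given an $n$-vertex directed graph $W$ with maximum vertex degree at most $O(\log n)$, returns one of the following: (1) a cut $(A,B)$ in $W$ with $|E_W(A,B)|\le n/100$ and $|A|,|B|\ge n/10$; or (2) a directed graph $W'$ with $V(W')\subseteq V(W)$, $|V(W')|\ge n/4$ and maximum vertex degree at most $18$, such that $W'$ is an $\alpha_0$-expander, together with a subset $F\subseteq E(W')$ of at most $\frac{\alpha_0 n}{1000}$ edges, and an embedding $\mathcal P$ of $W'\setminus F$ into $W$ via paths of length at most $\tilde d=O(\log^2 n)$ that cause congestion at most $\eta=O(\log^2 n)$. The running time of the algorithm is $\widetilde O(n^2)$.
   Context: A cut in a directed graph is an ordered pair $(A,B)$ of disjoint nonempty vertex sets with union $V$; $E_W(A,B)$ denotes the edges from $A$ to $B$, and the sparsity of the cut is $|E_W(A,B)|/\min\{|A|,|B|\}$. A directed graph is a $\phi$-expander if every cut has sparsity at least $\phi$. Here $\alpha_0>0$ is a fixed absolute constant: the expansion of an explicit family of directed graphs, constructible in $O(n)$ time for every $n>1$, that are $\alpha_0$-expanders on $n$ vertices with at most $9$ incoming and $9$ outgoing edges per vertex. The degree of a vertex counts both incoming and outgoing edges. An embedding of a graph $W'$ with $V(W')\subseteq V(W)$ into $W$ is a collection of paths $\{P(e)\}_{e\in E(W')}$ with $P(e)$ a path in $W$ from the tail to the head of $e$; its congestion is the maximum over edges of $W$ of the number of paths containing it. $\widetilde O(\cdot)$ hides polylogarithmic factors in $n$. *)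

theory Defs
  imports
    "HOL-Library.Landau_Symbols"
    "Graph_Theory.Arc_Walk"
begin

section \<open>Directed graphs\<close>

text \<open>
  A directed graph is a finite digraph of the library: parallel arcs are allowed.
  A loop contributes 2 to the degree of its vertex and never crosses a cut.
\<close>

definition degree :: "('a, 'b) pre_digraph \<Rightarrow> 'a \<Rightarrow> nat" where
  "degree G v = in_degree G v + out_degree G v"

definition is_cut :: "('a, 'b) pre_digraph \<Rightarrow> 'a set \<Rightarrow> 'a set \<Rightarrow> bool" where
  "is_cut G A B \<longleftrightarrow> A \<noteq> {} \<and> B \<noteq> {} \<and> A \<inter> B = {} \<and> A \<union> B = verts G"

definition arcs_between :: "('a, 'b) pre_digraph \<Rightarrow> 'a set \<Rightarrow> 'a set \<Rightarrow> 'b set" where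
  "arcs_between G A B = {e \<in> arcs G. tail G e \<in> A \<and> head G e \<in> B}"

definition sparsity :: "('a, 'b) pre_digraph \<Rightarrow> 'a set \<Rightarrow> 'a set \<Rightarrow> real" where
  "sparsity G A B = real (card (arcs_between G A B)) / real (min (card A) (card B))"

definition is_expander :: "real \<Rightarrow> ('a, 'b) pre_digraph \<Rightarrow> bool" where
  "is_expander \<phi> G \<longleftrightarrow> (\<forall>A B. is_cut G A B \<longrightarrow> sparsity G A B \<ge> \<phi>)"

text \<open>
  Embedding of \<open>H\<close> into \<open>G\<close>; a path is given by its list of arcs in \<open>G\<close>, so that its
  length is the length of the list (a loop of \<open>H\<close> may be embedded by the empty path).
\<close>

definition is_embedding ::
  "('a, 'c) pre_digraph \<Rightarrow> ('a, 'b) pre_digraph \<Rightarrow> ('c \<Rightarrow> 'b list) \<Rightarrow> bool" where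
  "is_embedding H G P \<longleftrightarrow> verts H \<subseteq> verts G \<and>
     (\<forall>e \<in> arcs H. pre_digraph.apath G (tail H e) (P e) (head H e))"

text \<open>The \<open>insert 0\<close> only matters when \<open>G\<close> has no arcs.\<close>

definition congestion ::
  "('a, 'c) pre_digraph \<Rightarrow> ('a, 'b) pre_digraph \<Rightarrow> ('c \<Rightarrow> 'b list) \<Rightarrow> nat" where
  "congestion H G P =
     Max (insert 0 ((\<lambda>a. card {e \<in> arcs H. a \<in> set (P e)}) ` arcs G))"

definition remove_arcs :: "('a, 'b) pre_digraph \<Rightarrow> 'b set \<Rightarrow> ('a, 'b) pre_digraph" where
  "remove_arcs G F = G\<lparr>arcs := arcs G - F\<rparr>"


section \<open>Asymptotics\<close>

text \<open>\<open>soft_O f\<close> is O-tilde of \<open>f\<close>: a factor polylogarithmic in \<open>n\<close> is hidden.\<close>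

definition soft_O :: "(nat \<Rightarrow> real) \<Rightarrow> (nat \<Rightarrow> real) set" where
  "soft_O f = (\<Union>k. O(\<lambda>n. f n * ln (real n) ^ k))"


section \<open>Model of computation\<close>

text \<open>
  Deterministic algorithms are programs for a word RAM, written in a structured language. The
  memory consists of arrays, named by natural numbers, of machine words. Every command takes
  one time step. As a program is a fixed finite object, a command performs a number of word
  operations that is bounded by a constant depending on the program only.

  Words are natural numbers less than a bound \<open>B\<close>, which plays the role of 2 to the word
  length; a computation in which some address, value, or intermediate result reaches \<open>B\<close>
  gets stuck.
\<close>

type_synonym memory = "nat \<Rightarrow> nat \<Rightarrow> nat"

datatype expr =
    Const nat
  | Read nat expr
  | Add expr expr
  | Sub expr expr
  | Mul expr expr
  | Div expr expr

primrec val :: "memory \<Rightarrow> expr \<Rightarrow> nat" where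
  "val s (Const c) = c"
| "val s (Read a i) = s a (val s i)"
| "val s (Add e f) = val s e + val s f"
| "val s (Sub e f) = val s e - val s f"
| "val s (Mul e f) = val s e * val s f"
| "val s (Div e f) = val s e div val s f"

primrec fits :: "nat \<Rightarrow> memory \<Rightarrow> expr \<Rightarrow> bool" where
  "fits B s (Const c) \<longleftrightarrow> c < B"
| "fits B s (Read a i) \<longleftrightarrow> fits B s i \<and> val s (Read a i) < B"
| "fits B s (Add e f) \<longleftrightarrow> fits B s e \<and> fits B s f \<and> val s (Add e f) < B"
| "fits B s (Sub e f) \<longleftrightarrow> fits B s e \<and> fits B s f \<and> val s (Sub e f) < B"
| "fits B s (Mul e f) \<longleftrightarrow> fits B s e \<and> fits B s f \<and> val s (Mul e f) < B"
| "fits B s (Div e f) \<longleftrightarrow> fits B s e \<and> fits B s f \<and> val s (Div e f) < B"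

datatype program =
    Skip
  | Write nat expr expr
  | Seq program program
  | If expr program program
  | While expr program

text \<open>
  \<open>run B p s t s'\<close>: started in memory \<open>s\<close>, program \<open>p\<close> terminates in memory \<open>s'\<close> after \<open>t\<close>
  steps. A condition is true if its value is nonzero.
\<close>

inductive run :: "nat \<Rightarrow> program \<Rightarrow> memory \<Rightarrow> nat \<Rightarrow> memory \<Rightarrow> bool" for B where
  run_Skip: "run B Skip s 1 s"
| run_Write: "fits B s i \<Longrightarrow> fits B s e \<Longrightarrow>
    run B (Write a i e) s 1 (s(a := (s a)(val s i := val s e)))"
| run_Seq: "run B p s t s' \<Longrightarrow> run B q s' u s'' \<Longrightarrow> run B (Seq p q) s (t + u) s''"
| run_IfTrue: "fits B s b \<Longrightarrow> val s b \<noteq> 0 \<Longrightarrow> run B p s t s' \<Longrightarrow>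
    run B (If b p q) s (1 + t) s'"
| run_IfFalse: "fits B s b \<Longrightarrow> val s b = 0 \<Longrightarrow> run B q s t s' \<Longrightarrow>
    run B (If b p q) s (1 + t) s'"
| run_WhileFalse: "fits B s b \<Longrightarrow> val s b = 0 \<Longrightarrow> run B (While b p) s 1 s"
| run_WhileTrue: "fits B s b \<Longrightarrow> val s b \<noteq> 0 \<Longrightarrow> run B p s t s' \<Longrightarrow>
    run B (While b p) s' u s'' \<Longrightarrow> run B (While b p) s (1 + t + u) s''"

lemma run_deterministic:
  "run B p s t s' \<Longrightarrow> run C p s u s'' \<Longrightarrow> t = u \<and> s' = s''"
proof (induction arbitrary: u s'' rule: run.induct)
  case (run_Seq p s t s' q u s'')
  from run_Seq.prems show ?case
    by (cases rule: run.cases) (use run_Seq.IH in blast)+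
next
  case (run_WhileTrue s b p t s' u s'')
  from run_WhileTrue.prems show ?case
    by (cases rule: run.cases) (use run_WhileTrue in blast)+
qed (erule run.cases; fastforce)+

text \<open>
  The input is placed in array 0, all other memory cells being 0; the output is read off
  from array 1. The encodings of outputs used below determine their own length.
\<close>

definition input_memory :: "nat list \<Rightarrow> memory" where
  "input_memory xs = (\<lambda>a i. if a = 0 \<and> i < length xs then xs ! i else 0)"

definition outputs_within :: "program \<Rightarrow> nat \<Rightarrow> nat list \<Rightarrow> real \<Rightarrow> nat list \<Rightarrow> bool" where
  "outputs_within p B xs T ys \<longleftrightarrow>
     (\<exists>t s. run B p (input_memory xs) t s \<and> real t \<le> T \<and> (\<forall>i < length ys. s 1 i = ys ! i))"

text \<open>
  A word length of \<open>O(log n)\<close> bits amounts to a polynomial bound on the words.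
\<close>

definition word_bound :: "nat \<Rightarrow> nat \<Rightarrow> nat" where
  "word_bound k n = n ^ k + k"


section \<open>Encodings\<close>

definition enc_list :: "nat list \<Rightarrow> nat list" where
  "enc_list xs = length xs # xs"

definition arcs_numbered :: "(nat, nat) pre_digraph \<Rightarrow> bool" where
  "arcs_numbered G \<longleftrightarrow> arcs G = {..<card (arcs G)}"

text \<open>
  Encoding of a digraph with numbered arcs as its list \<open>vs\<close> of vertices followed by the list
  of the end points of arcs \<open>0, 1, \<dots>\<close>
\<close>

definition enc_digraph :: "nat list \<Rightarrow> (nat, nat) pre_digraph \<Rightarrow> nat list" where
  "enc_digraph vs G = enc_list vs @
     card (arcs G) # concat (map (\<lambda>e. [tail G e, head G e]) [0..<card (arcs G)])"

definition enc_cut :: "nat list \<Rightarrow> nat list \<Rightarrow> nat list" where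
  "enc_cut as bs = 1 # enc_list as @ enc_list bs"

text \<open>One path is output per arc of \<open>W'\<close>; those of the arcs in \<open>fs\<close> carry no meaning.\<close>

definition enc_expander ::
  "nat list \<Rightarrow> (nat, nat) pre_digraph \<Rightarrow> nat list \<Rightarrow> (nat \<Rightarrow> nat list) \<Rightarrow> nat list" where
  "enc_expander vs W' fs P = 2 # enc_digraph vs W' @ enc_list fs @
     concat (map (\<lambda>e. enc_list (P e)) [0..<card (arcs W')])"


section \<open>Explicit expanders\<close>

text \<open>
  There is an explicit family of \<open>\<alpha>\<close>-expanders of in- and out-degree at most 9, with one
  member on \<open>n\<close> vertices for every \<open>n > 1\<close>, that is constructible in \<open>O(n)\<close> time.
\<close>

definition explicit_expanders :: "real \<Rightarrow> bool" where
  "explicit_expanders \<alpha> \<longleftrightarrow>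
     (\<exists>(H :: nat \<Rightarrow> (nat, nat) pre_digraph) p k T.
        T \<in> O(\<lambda>n. real n) \<and>
        (\<forall>n > 1.
           fin_digraph (H n) \<and> verts (H n) = {..<n} \<and> arcs_numbered (H n) \<and>
           is_expander \<alpha> (H n) \<and>
           (\<forall>v \<in> verts (H n). in_degree (H n) v \<le> 9 \<and> out_degree (H n) v \<le> 9) \<and>
           outputs_within p (word_bound k n) [n] (T n) (enc_digraph [0..<n] (H n))))"

end

(*
  Fix an explicit expander H on m vertices, m about n / 4, and host its vertices injectively by
  vertices of W. Route the arcs of H one after the other: from the host of the tail, grow the
  levels of a breadth-first search in the vertices left and the arcs not yet saturated (used by
  fewer than eta paths). If the head is reached, route along the search tree. Otherwise, unless
  some level is a sparse cut, every level multiplies the ratio of reached to unreached vertices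
  by 1 + 1/O(D), where D = O(log n) bounds the degrees; as that ratio lies between 1/n and n, a
  sparse cut or the head turns up within d = O(D log n) = O(log^2 n) levels. Given a sparse cut,
  remove its smaller side, replace the removed hosts by fresh vertices and reroute the arcs at
  these hosts.

  At most r + 18 n paths of length at most d are routed altogether (r the number of arcs of H),
  so for eta = 5400 d at most n / 200 arcs are ever saturated. The removed pieces, ordered with
  the out-sparse ones before and the in-sparse ones after the vertices left, have few forward
  arcs; hence once n / 5 vertices are removed, one of the two kinds forms the balanced sparse
  cut. If this never happens, all of H gets embedded, and F is empty.
*)

theory Submission
  imports Defs "HOL-Library.Log_Nat"
begin

section \<open>Verification of programs\<close>

text \<open>The obstacle is that paths get discarded while the cuts already made must remain valid.
  The use counters of the arcs are therefore never lowered, not even when a path is given up. The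
  set of unsaturated arcs only shrinks, so a cut that was sparse in them stays sparse, and the
  counters still bound the final congestion. Fresh hosts never run out: a cut is made only while
  fewer than \<open>n / 5\<close> vertices are removed and takes at most half of the vertices left,
  so at most \<open>3 * n / 5\<close> are ever removed, and the other \<open>2 * n / 5\<close> are
  at least \<open>m\<close>. For the running time, a search may scan all arcs once per level: this
  costs about \<open>d * E\<close>, which is \<open>n\<close> up to polylogarithmic factors. Each
  search either routes an arc or removes vertices, and a removed vertex undoes at most 18 routed
  arcs, so O(n) searches suffice. The machine has no other subtlety than overflow, which is why
  every program carries bounds on all intermediate values.\<close>

inductive_cases run_SkipE: "run B Skip s t s'"
inductive_cases run_WriteE: "run B (Write a i e) s t s'"
inductive_cases run_SeqE: "run B (Seq p q) s t s'"
inductive_cases run_IfE: "run B (If b p q) s t s'"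

text \<open>Since \<open>run\<close> is deterministic, the existential form is already total
  correctness: termination, absence of overflow and the exact number of steps are claimed
  together.\<close>

definition wp :: "nat \<Rightarrow> program \<Rightarrow> memory \<Rightarrow> (nat \<Rightarrow> memory \<Rightarrow> bool) \<Rightarrow> bool" where
  "wp B p s Q \<longleftrightarrow> (\<exists>t s'. run B p s t s' \<and> Q t s')"

lemma wp_Skip [simp]: "wp B Skip s Q \<longleftrightarrow> Q 1 s"
  unfolding wp_def by (metis run_SkipE run_Skip)

lemma wp_Write [simp]:
  "wp B (Write a i e) s Q \<longleftrightarrow>
     fits B s i \<and> fits B s e \<and> Q 1 (s(a := (s a)(val s i := val s e)))"
  unfolding wp_def by (metis run_WriteE run_Write)

lemma wp_Seq [simp]: "wp B (Seq p q) s Q \<longleftrightarrow> wp B p s (\<lambda>t s'. wp B q s' (\<lambda>u. Q (t + u)))"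
  unfolding wp_def by (auto elim!: run_SeqE intro: run_Seq)

lemma wp_If [simp]:
  "wp B (If b p q) s Q \<longleftrightarrow>
     fits B s b \<and> (if val s b \<noteq> 0 then wp B p s (\<lambda>t. Q (1 + t)) else wp B q s (\<lambda>t. Q (1 + t)))"
  unfolding wp_def by (auto elim!: run_IfE) (use run_IfTrue run_IfFalse in fastforce)+

lemma wp_mono: "wp B p s Q \<Longrightarrow> (\<And>t s'. Q t s' \<Longrightarrow> R t s') \<Longrightarrow> wp B p s R"
  unfolding wp_def by blast

primrec writes :: "program \<Rightarrow> nat set" where
  "writes Skip = {}"
| "writes (Write a i e) = {a}"
| "writes (Seq p q) = writes p \<union> writes q"
| "writes (If b p q) = writes p \<union> writes q"
| "writes (While b p) = writes p"

lemma run_frame: "run B p s t s' \<Longrightarrow> a \<notin> writes p \<Longrightarrow> s' a = s a"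
  by (induction rule: run.induct) auto

lemma wp_frame:
  assumes "wp B p s Q"
  shows "wp B p s (\<lambda>t s'. Q t s' \<and> (\<forall>a. a \<notin> writes p \<longrightarrow> s' a = s a))"
  using assms run_frame unfolding wp_def by blast

text \<open>Invariants below speak only about the arrays that a program changes; everything about
  the other arrays is recovered from \<open>writes\<close> through this rule.\<close>

lemma wp_use:
  assumes "wp B p s Q"
    and "\<And>t s'. Q t s' \<Longrightarrow> (\<And>a. a \<notin> writes p \<Longrightarrow> s' a = s a) \<Longrightarrow> R t s'"
  shows "wp B p s R"
  using wp_mono[OF wp_frame[OF assms(1)]] assms(2) by blast

text \<open>The potential \<open>\<Phi>\<close> bounds the remaining time, so one induction yields
  both termination and cost. A round pays for its body and one test of the condition; the extra
  \<open>Suc\<close> in the conclusion is the final, failing test. The premises provide the frame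
  relative to the memory at loop entry.\<close>

lemma wp_While:
  assumes "I s0" and b: "\<And>s. I s \<Longrightarrow> (\<And>a. a \<notin> writes p \<Longrightarrow> s a = s0 a) \<Longrightarrow> fits B s b"
    and step: "\<And>s. I s \<Longrightarrow> (\<And>a. a \<notin> writes p \<Longrightarrow> s a = s0 a) \<Longrightarrow> val s b \<noteq> 0 \<Longrightarrow>
      wp B p s (\<lambda>t s'. I s' \<and> Suc t + \<Phi> s' \<le> \<Phi> s)"
  shows "wp B (While b p) s0 (\<lambda>t s. I s \<and> val s b = 0 \<and> t \<le> Suc (\<Phi> s0))"
proof -
  define J where "J s \<longleftrightarrow> I s \<and> (\<forall>a. a \<notin> writes p \<longrightarrow> s a = s0 a)" for s
  have "wp B (While b p) s (\<lambda>t s'. I s' \<and> val s' b = 0 \<and> t \<le> Suc (\<Phi> s))" if "J s" for s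
    using that
  proof (induction "\<Phi> s" arbitrary: s rule: less_induct)
    case less
    show ?case
    proof (cases "val s b = 0")
      case True
      then have "run B (While b p) s 1 s"
        using b less.prems by (intro run_WhileFalse) (auto simp: J_def)
      then show ?thesis
        using less.prems True unfolding wp_def J_def by force
    next
      case False
      have "wp B p s (\<lambda>t s'. I s' \<and> Suc t + \<Phi> s' \<le> \<Phi> s)"
        using step[of s] less.prems False by (auto simp: J_def)
      from wp_frame[OF this] obtain t s' where r: "run B p s t s'" "I s'" "Suc t + \<Phi> s' \<le> \<Phi> s"
        and "\<forall>a. a \<notin> writes p \<longrightarrow> s' a = s a"
        unfolding wp_def by blast
      then have "J s'" using less.prems by (auto simp: J_def)
      with less.hyps[of s'] r(3) obtain u s'' where
        r': "run B (While b p) s' u s''" "I s''" "val s'' b = 0" "u \<le> Suc (\<Phi> s')"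
        unfolding wp_def by auto
      have "run B (While b p) s (1 + t + u) s''"
        using b less.prems False r(1) r'(1) by (intro run_WhileTrue) (auto simp: J_def)
      then show ?thesis
        using r(3) r' unfolding wp_def by (intro exI conjI) (assumption | simp)+
    qed
  qed
  then show ?thesis using assms(1) by (auto simp: J_def)
qed

abbreviation V :: "nat \<Rightarrow> expr" where "V x \<equiv> Read x (Const 0)"

abbreviation Assign :: "nat \<Rightarrow> expr \<Rightarrow> program" where "Assign x e \<equiv> Write x (Const 0) e"

text \<open>There is no comparison in the language. With truncated subtraction the sum of the two
  differences vanishes exactly when the values agree.\<close>

definition Eq :: "expr \<Rightarrow> expr \<Rightarrow> expr" where
  "Eq e f = Sub (Const 1) (Add (Sub e f) (Sub f e))"

lemma val_Eq [simp]: "val s (Eq e f) = (if val s e = val s f then 1 else 0)"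
  by (auto simp: Eq_def)

lemma fits_val: "fits B s e \<Longrightarrow> val s e < B"
  by (cases e) auto

lemma fits_Eq [simp]: "1 < B \<Longrightarrow> fits B s (Eq e f) \<longleftrightarrow> fits B s e \<and> fits B s f"
  using fits_val[of B s e] fits_val[of B s f] by (auto simp: Eq_def)

definition For :: "nat \<Rightarrow> expr \<Rightarrow> program \<Rightarrow> program" where
  "For x N p = Seq (Assign x (Const 0))
     (While (Sub N (V x)) (Seq p (Assign x (Add (V x) (Const 1)))))"

lemma writes_For [simp]: "writes (For x N p) = insert x (writes p)"
  by (auto simp: For_def)

text \<open>Each round pays 2 for the increment and the test; the outer 2 is the initialization and
  the last test. The expression \<open>N\<close> is evaluated anew in every round, hence the premise
  \<open>bound\<close>. The invariant is required after the increment, so it may itself refer to the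
  counter.\<close>

lemma wp_For:
  assumes init: "I 0 (s0(x := (s0 x)(0 := 0)))"
    and bound: "\<And>k s. k \<le> m \<Longrightarrow> I k s \<Longrightarrow> s x 0 = k \<Longrightarrow>
      (\<And>a. a \<notin> insert x (writes p) \<Longrightarrow> s a = s0 a) \<Longrightarrow> fits B s N \<and> val s N = m"
    and step: "\<And>k s. k < m \<Longrightarrow> I k s \<Longrightarrow> s x 0 = k \<Longrightarrow>
      (\<And>a. a \<notin> insert x (writes p) \<Longrightarrow> s a = s0 a) \<Longrightarrow>
      wp B p s (\<lambda>t s'. t \<le> c \<and> s' x 0 = k \<and> I (Suc k) (s'(x := (s' x)(0 := Suc k))))"
    and m: "m < B" "1 < B"
  shows "wp B (For x N p) s0 (\<lambda>t s. t \<le> 2 + m * (c + 2) \<and> I m s \<and> s x 0 = m)"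
proof -
  define s1 where "s1 = s0(x := (s0 x)(0 := 0))"
  let ?J = "\<lambda>s. s x 0 \<le> m \<and> I (s x 0) s"
  let ?p = "Seq p (Assign x (Add (V x) (Const 1)))"
  have frame: "s a = s0 a" if "\<And>a. a \<notin> writes ?p \<Longrightarrow> s a = s1 a" "a \<notin> insert x (writes p)" for s a
    using that by (auto simp: s1_def)
  have *: "fits B s N \<and> val s N = m" if "?J s" "\<And>a. a \<notin> writes ?p \<Longrightarrow> s a = s1 a" for s
    using bound[of "s x 0" s] frame[OF that(2)] that(1) by blast
  have "wp B (While (Sub N (V x)) ?p) s1
     (\<lambda>t s. ?J s \<and> val s (Sub N (V x)) = 0 \<and> t \<le> Suc ((m - s1 x 0) * (c + 2)))"
  proof (rule wp_While)
    show "?J s1" using init by (simp add: s1_def)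
  next
    fix s assume "?J s" "\<And>a. a \<notin> writes ?p \<Longrightarrow> s a = s1 a"
    with * show "fits B s (Sub N (V x))" using m by fastforce
  next
    fix s assume J: "?J s" and fr: "\<And>a. a \<notin> writes ?p \<Longrightarrow> s a = s1 a"
      and v: "val s (Sub N (V x)) \<noteq> 0"
    have lt: "s x 0 < m" using *[OF J fr] v by simp
    have "wp B p s (\<lambda>t s'. t \<le> c \<and> s' x 0 = s x 0 \<and> I (Suc (s x 0)) (s'(x := (s' x)(0 := Suc (s x 0)))))"
      using J by (intro step lt frame[OF fr]) auto
    then show "wp B ?p s (\<lambda>t s'. ?J s' \<and> Suc t + (m - s' x 0) * (c + 2) \<le> (m - s x 0) * (c + 2))"
    proof (simp only: wp_Seq, rule wp_mono, goal_cases)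
      case (1 t s')
      obtain d where "m = Suc (s x 0 + d)" using less_imp_Suc_add[OF lt] by blast
      with 1 m show ?case by (simp add: algebra_simps)
    qed
  qed
  then have "wp B (While (Sub N (V x)) ?p) s1 (\<lambda>t s. Suc t \<le> 2 + m * (c + 2) \<and> I m s \<and> s x 0 = m)"
  proof (rule wp_use, goal_cases)
    case (1 t s)
    have "val s N = m" by (rule conjunct2[OF *]) (use 1 in auto)
    with 1 have "s x 0 = m" by auto
    with 1 show ?case by (auto simp: s1_def)
  qed
  then show ?thesis
    using m by (simp add: For_def s1_def)
qed

subsection \<open>Subroutines\<close>

primrec shift_expr :: "nat \<Rightarrow> expr \<Rightarrow> expr" where
  "shift_expr k (Const c) = Const c"
| "shift_expr k (Read a i) = Read (a + k) (shift_expr k i)"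
| "shift_expr k (Add e f) = Add (shift_expr k e) (shift_expr k f)"
| "shift_expr k (Sub e f) = Sub (shift_expr k e) (shift_expr k f)"
| "shift_expr k (Mul e f) = Mul (shift_expr k e) (shift_expr k f)"
| "shift_expr k (Div e f) = Div (shift_expr k e) (shift_expr k f)"

primrec shift :: "nat \<Rightarrow> program \<Rightarrow> program" where
  "shift k Skip = Skip"
| "shift k (Write a i e) = Write (a + k) (shift_expr k i) (shift_expr k e)"
| "shift k (Seq p q) = Seq (shift k p) (shift k q)"
| "shift k (If b p q) = If (shift_expr k b) (shift k p) (shift k q)"
| "shift k (While b p) = While (shift_expr k b) (shift k p)"

lemma val_shift [simp]: "val s (shift_expr k e) = val (\<lambda>a. s (a + k)) e"
  by (induction e) auto

lemma fits_shift [simp]: "fits B s (shift_expr k e) = fits B (\<lambda>a. s (a + k)) e"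
  by (induction e) auto

lemma writes_shift: "a \<in> writes (shift k p) \<Longrightarrow> k \<le> a"
  by (induction p) auto

text \<open>The arrays from \<open>k\<close> on look to the shifted program like a memory of their
  own, and it touches no other arrays. This turns a program verified for a whole memory into a
  subroutine.\<close>

lemma run_shift:
  "run B p s t s' \<Longrightarrow> (\<lambda>a. S (a + k)) = s \<Longrightarrow>
     \<exists>S'. run B (shift k p) S t S' \<and> (\<lambda>a. S' (a + k)) = s'"
proof (induction arbitrary: S rule: run.induct)
  case (run_Skip s)
  then show ?case using run.run_Skip by auto
next
  case (run_Write s i e a)
  let ?S' = "S(a + k := (S (a + k))(val s i := val s e))"
  have "run B (Write (a + k) (shift_expr k i) (shift_expr k e)) S 1 ?S'"
    using run_Write run.run_Write[of B S "shift_expr k i" "shift_expr k e" "a + k"] by auto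
  then have "run B (shift k (Write a i e)) S 1 ?S'" by simp
  moreover have "(\<lambda>b. ?S' (b + k)) = s(a := (s a)(val s i := val s e))"
    using run_Write by auto
  ultimately show ?case by blast
next
  case (run_Seq p s t s' q u s'')
  from run_Seq.IH(1)[OF run_Seq.prems] obtain S' where
    1: "run B (shift k p) S t S'" "(\<lambda>a. S' (a + k)) = s'" by blast
  from run_Seq.IH(2)[OF 1(2)] 1(1) show ?case by (auto intro: run.run_Seq)
next
  case (run_IfTrue s b p t s' q)
  from run_IfTrue.IH[OF run_IfTrue.prems] run_IfTrue.hyps run_IfTrue.prems show ?case
    using run.run_IfTrue[of B S "shift_expr k b"] by fastforce
next
  case (run_IfFalse s b q t s' p)
  from run_IfFalse.IH[OF run_IfFalse.prems] run_IfFalse.hyps run_IfFalse.prems show ?case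
    using run.run_IfFalse[of B S "shift_expr k b"] by fastforce
next
  case (run_WhileFalse s b p)
  then show ?case using run.run_WhileFalse[of B S "shift_expr k b"] by fastforce
next
  case (run_WhileTrue s b p t s' u s'')
  from run_WhileTrue.IH(1)[OF run_WhileTrue.prems] obtain S' where
    1: "run B (shift k p) S t S'" "(\<lambda>a. S' (a + k)) = s'" by blast
  from run_WhileTrue.IH(2)[OF 1(2)] obtain S'' where
    2: "run B (While (shift_expr k b) (shift k p)) S' u S''" "(\<lambda>a. S'' (a + k)) = s''" by auto
  have "run B (While (shift_expr k b) (shift k p)) S (1 + t + u) S''"
    using run_WhileTrue.hyps(1,2) run_WhileTrue.prems 1 2 by (intro run.run_WhileTrue) auto
  with 2(2) show ?case by auto
qed

lemma fits_mono: "fits B s e \<Longrightarrow> B \<le> C \<Longrightarrow> fits C s e"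
  by (induction e) auto

text \<open>Needed because the construction of the expander is only known to run with the word bound
  belonging to \<open>m\<close>, whereas here it runs with the larger one belonging to
  \<open>n\<close>.\<close>

lemma run_mono: "run B p s t s' \<Longrightarrow> B \<le> C \<Longrightarrow> run C p s t s'"
proof (induction rule: run.induct)
  case (run_WhileTrue s b p t s' u s'')
  then show ?case by (intro run.run_WhileTrue) (auto intro: fits_mono)
qed (use run.intros fits_mono in force)+

section \<open>Level growth\<close>

text \<open>With \<open>b\<close> reached and \<open>c\<close> unreached vertices, a level that is not a sparse cut multiplies
  the ratio \<open>b / c\<close> by at least \<open>1 + 1 / Q\<close>, whichever of the two sides is smaller.\<close>

lemma ratio_growth:
  fixes x b c w Q N :: real
  assumes "x * c \<le> N * b" "b > 0" "0 \<le> w" "w \<le> c" "1 \<le> Q" "0 \<le> N" "0 \<le> x"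
    and w: "b \<le> Q * w \<or> c \<le> Q * w"
  shows "x * (1 + 1 / Q) * (c - w) \<le> N * (b + w)"
proof -
  have "(1 + 1 / Q) * (c - w) * b \<le> (b + w) * c"
    using w
  proof
    assume "b \<le> Q * w"
    then have "b / Q \<le> w" using assms by (simp add: field_simps)
    then have "b * (1 + 1 / Q) \<le> b + w" by (simp add: field_simps)
    then have "b * (1 + 1 / Q) * (c - w) \<le> (b + w) * c"
      using assms by (intro mult_mono) auto
    then show ?thesis by (simp add: mult_ac)
  next
    assume "c \<le> Q * w"
    then have "c / Q \<le> w" using assms by (simp add: field_simps)
    then have "c - w \<le> c * (1 - 1 / Q)" by (simp add: field_simps)
    then have "(1 + 1 / Q) * (c - w) \<le> (1 + 1 / Q) * (c * (1 - 1 / Q))"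
      using assms by (intro mult_left_mono) auto
    also have "\<dots> = c - c / Q / Q" using assms by (simp add: field_simps)
    also have "\<dots> \<le> c" using assms by simp
    finally have "(1 + 1 / Q) * (c - w) * b \<le> c * b"
      using assms by (intro mult_right_mono) auto
    also have "\<dots> \<le> (b + w) * c" using assms by (simp add: algebra_simps)
    finally show ?thesis .
  qed
  then have "x * ((1 + 1 / Q) * (c - w) * b) \<le> x * ((b + w) * c)"
    using assms by (intro mult_left_mono)
  also have "\<dots> = x * c * (b + w)" by simp
  also have "\<dots> \<le> N * b * (b + w)"
    using assms by (intro mult_right_mono) auto
  finally have "x * (1 + 1 / Q) * (c - w) * b \<le> N * (b + w) * b" by (simp add: mult_ac)
  then show ?thesis using assms by simp
qed

text \<open>By Bernoulli \<open>Q\<close> factors at least double, so \<open>2 * Q * l\<close>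
  factors give at least \<open>2 ^ l\<close> squared. The square of \<open>n\<close> is the whole
  range that a ratio between 1/n and n can pass through.\<close>

lemma power_level_bound:
  fixes n Q l :: nat
  assumes "n < 2 ^ l" "1 \<le> Q"
  shows "real n * real n < (1 + 1 / real Q) ^ (2 * Q * l)"
proof -
  have "1 + real Q * (1 / real Q) \<le> (1 + 1 / real Q) ^ Q"
    by (rule Bernoulli_inequality) (rule order_trans[of _ 0], simp_all)
  then have "2 \<le> (1 + 1 / real Q) ^ Q" using assms by simp
  then have "2 ^ l \<le> ((1 + 1 / real Q) ^ Q) ^ l" by (intro power_mono) auto
  moreover have "real n < 2 ^ l" using assms(1) by (metis of_nat_less_iff of_nat_numeral of_nat_power)
  ultimately have "real n < ((1 + 1 / real Q) ^ Q) ^ l" by linarith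
  then have "real n * real n < ((1 + 1 / real Q) ^ Q) ^ l * ((1 + 1 / real Q) ^ Q) ^ l"
    by (intro mult_strict_mono') auto
  also have "\<dots> = (1 + 1 / real Q) ^ (2 * Q * l)"
    by (simp add: mult_2 add_mult_distrib power_add flip: power_mult)
  finally show ?thesis .
qed

section \<open>Routing an expander\<close>

type_synonym arr = "nat \<Rightarrow> nat"

text \<open>
  \<open>ht\<close> and \<open>hh\<close> list the \<open>r\<close> arcs of a graph on \<open>{..<m}\<close> whose vertex \<open>h\<close> is hosted by the
  vertex \<open>f h\<close> of \<open>W\<close>.
\<close>

locale router =
  fixes W :: "(nat, nat) pre_digraph" and n E D l m r :: nat and ht hh :: arr
  assumes W: "fin_digraph W" "verts W = {..<n}" "arcs W = {..<E}"
    and n: "5 \<le> n" and m: "m = (n + 3) div 4"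
    and D: "1 \<le> D" "\<And>v. v < n \<Longrightarrow> card {a. a < E \<and> head W a = v} \<le> D"
    and l: "n < 2 ^ l"
    and ends: "\<And>e. e < r \<Longrightarrow> ht e < m" "\<And>e. e < r \<Longrightarrow> hh e < m" "\<And>e. e < r \<Longrightarrow> ht e \<noteq> hh e"
    and deg: "\<And>h. h < m \<Longrightarrow> card {e. e < r \<and> (ht e = h \<or> hh e = h)} \<le> 18"
    and r: "r \<le> 9 * m"
begin

sublocale fin_digraph W by (rule W)

lemma ends_W: "a < E \<Longrightarrow> tail W a < n" "a < E \<Longrightarrow> head W a < n"
  using tail_in_verts[of a] head_in_verts[of a] W by auto

text \<open>This is the exponent \<open>2 * Q * l\<close> of \<open>power_level_bound\<close> for
  \<open>Q = 200 * D\<close>: failing to be 1/200-sparse means many cut arcs, and in-degree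
  \<open>D\<close> turns them into new vertices at the loss of a factor \<open>D\<close>.\<close>

definition d :: nat where "d = 400 * D * l"

definition \<eta> :: nat where "\<eta> = 5400 * d"

lemma l_pos: "0 < l"
  using l n by (cases l) auto

lemma d_pos: "0 < d"
  using D l_pos by (simp add: d_def)

section \<open>Breadth-first search and the number of its levels\<close>

definition left :: "arr \<Rightarrow> nat set" where
  "left side = {v. v < n \<and> side v = 0}"

text \<open>Levels are numbered from 1, as 0 marks a vertex not reached. Levels up to
  \<open>i\<close> are assigned and those below \<open>i\<close> fully expanded. The last conjunct
  says that the ratio of reached to unreached vertices, at least 1/n at level 1, has grown by
  \<open>i - 1\<close> factors; it is multiplied out because the number of unreached vertices may
  become 0.\<close>

definition bfs :: "arr \<Rightarrow> arr \<Rightarrow> nat \<Rightarrow> nat \<Rightarrow> arr \<Rightarrow> arr \<Rightarrow> nat \<Rightarrow> bool" where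
  "bfs side cnt s i lev par b \<longleftrightarrow>
     1 \<le> i \<and> s < n \<and> (\<forall>v<n. lev v = 1 \<longleftrightarrow> v = s) \<and>
     (\<forall>v<n. lev v \<noteq> 0 \<longrightarrow> side v = 0 \<and> lev v \<le> i) \<and>
     (\<forall>v<n. \<forall>k. lev v = Suc (Suc k) \<longrightarrow>
        par v < E \<and> cnt (par v) < \<eta> \<and> head W (par v) = v \<and> lev (tail W (par v)) = Suc k) \<and>
     (\<forall>a<E. lev (tail W a) \<noteq> 0 \<longrightarrow> lev (tail W a) < i \<longrightarrow> side (head W a) = 0 \<longrightarrow>
        cnt a < \<eta> \<longrightarrow> lev (head W a) \<noteq> 0) \<and>
     b = card {v. v < n \<and> lev v \<noteq> 0} \<and>
     (1 + 1 / real (200 * D)) ^ (i - 1) * (real (card (left side)) - real b) \<le> real n * real b"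

text \<open>A set of arcs rather than of vertices: sparsity counts the arcs, while their heads are
  the next level.\<close>

definition frontier :: "arr \<Rightarrow> arr \<Rightarrow> nat \<Rightarrow> arr \<Rightarrow> nat set" where
  "frontier side cnt i lev =
     {a. a < E \<and> lev (tail W a) = i \<and> side (head W a) = 0 \<and> cnt a < \<eta> \<and> lev (head W a) = 0}"

lemma finite_frontier [simp]: "finite (frontier side cnt i lev)"
  by (simp add: frontier_def)

lemma reached_subset: "bfs side cnt s i lev par b \<Longrightarrow> {v. v < n \<and> lev v \<noteq> 0} \<subseteq> left side"
  by (auto simp: bfs_def left_def)

lemma finite_left [simp]: "finite (left side)"
  by (simp add: left_def)

lemma card_left: "card (left side) \<le> n"
  using card_mono[of "{..<n}" "left side"] by (auto simp: left_def)

text \<open>At most \<open>D\<close> arcs enter each new vertex, so many cut arcs force many new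
  vertices.\<close>

lemma card_frontier_le: "card (frontier side cnt i lev) \<le> D * card (head W ` frontier side cnt i lev)"
proof -
  let ?C = "frontier side cnt i lev"
  have "?C = (\<Union>v\<in>head W ` ?C. {a \<in> ?C. head W a = v})" by auto
  then have "card ?C \<le> (\<Sum>v\<in>head W ` ?C. card {a \<in> ?C. head W a = v})"
    using card_UN_le[of "head W ` ?C" "\<lambda>v. {a \<in> ?C. head W a = v}"] by simp
  also have "\<dots> \<le> (\<Sum>v\<in>head W ` ?C. D)"
  proof (rule sum_mono)
    fix v assume v: "v \<in> head W ` ?C"
    have "card {a \<in> ?C. head W a = v} \<le> card {a. a < E \<and> head W a = v}"
      by (intro card_mono) (auto simp: frontier_def)
    also have "\<dots> \<le> D" using v ends_W by (intro D) (auto simp: frontier_def)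
    finally show "card {a \<in> ?C. head W a = v} \<le> D" .
  qed
  finally show ?thesis by (simp add: mult.commute)
qed

lemma bfs_start:
  assumes "s < n" "side s = 0" "\<And>v. v < n \<Longrightarrow> lev v = (if v = s then 1 else 0)"
  shows "bfs side cnt s 1 lev par 1"
proof -
  have "{v. v < n \<and> lev v \<noteq> 0} = {s}" using assms by (auto split: if_splits)
  moreover have "real (card (left side)) - 1 \<le> real n" using card_left[of side] by linarith
  ultimately show ?thesis
    using assms by (auto simp: bfs_def split: if_splits)
qed

lemma bfs_step:
  assumes bfs: "bfs side cnt s i lev par b"
    and lev': "\<And>v. v < n \<Longrightarrow> lev' v = (if v \<in> head W ` frontier side cnt i lev then Suc i else lev v)"
    and par': "\<And>v. v < n \<Longrightarrow> v \<in> head W ` frontier side cnt i lev \<Longrightarrow>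
      par' v \<in> frontier side cnt i lev \<and> head W (par' v) = v"
    and par'': "\<And>v. v < n \<Longrightarrow> v \<notin> head W ` frontier side cnt i lev \<Longrightarrow> par' v = par v"
    and ns: "\<not> (200 * card (frontier side cnt i lev) \<le> b \<and>
       200 * card (frontier side cnt i lev) \<le> card (left side) - b)"
  shows "bfs side cnt s (Suc i) lev' par' (b + card (head W ` frontier side cnt i lev))"
proof -
  let ?C = "frontier side cnt i lev"
  let ?w = "card (head W ` ?C)"
  let ?B = "{v. v < n \<and> lev v \<noteq> 0}"
  have i: "1 \<le> i" and s: "s < n" and lev1: "\<And>v. v < n \<Longrightarrow> lev v = 1 \<longleftrightarrow> v = s"
    and side: "\<And>v. v < n \<Longrightarrow> lev v \<noteq> 0 \<Longrightarrow> side v = 0 \<and> lev v \<le> i"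
    and chain: "\<And>v k. v < n \<Longrightarrow> lev v = Suc (Suc k) \<Longrightarrow>
        par v < E \<and> cnt (par v) < \<eta> \<and> head W (par v) = v \<and> lev (tail W (par v)) = Suc k"
    and closed: "\<And>a. a < E \<Longrightarrow> lev (tail W a) \<noteq> 0 \<Longrightarrow> lev (tail W a) < i \<Longrightarrow> side (head W a) = 0 \<Longrightarrow>
        cnt a < \<eta> \<Longrightarrow> lev (head W a) \<noteq> 0"
    and b: "b = card ?B"
    and gr: "(1 + 1 / real (200 * D)) ^ (i - 1) * (real (card (left side)) - real b) \<le> real n * real b"
    using bfs unfolding bfs_def by auto
  have C: "a < E" "lev (tail W a) = i" "side (head W a) = 0" "cnt a < \<eta>" "lev (head W a) = 0"
    if "a \<in> ?C" for a using that by (auto simp: frontier_def)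
  have CB: "head W ` ?C \<inter> ?B = {}" using C by auto
  have CU: "head W ` ?C \<subseteq> left side" using C ends_W by (auto simp: left_def)
  have lev'_old: "lev' v = lev v" if "v < n" "lev v \<noteq> 0" for v
    using that lev' CB by auto
  have B': "{v. v < n \<and> lev' v \<noteq> 0} = ?B \<union> head W ` ?C"
    using lev' C ends_W by auto
  have b': "b + ?w = card {v. v < n \<and> lev' v \<noteq> 0}"
    unfolding B' b using CB by (subst card_Un_disjoint) auto
  have "?B \<union> head W ` ?C \<subseteq> left side" using CU reached_subset[OF bfs] by blast
  then have le: "b + ?w \<le> card (left side)"
    unfolding b' B' by (intro card_mono) auto
  have "s \<in> ?B" using s lev1[of s] by auto
  then have "b > 0" unfolding b by (auto simp: card_gt_0_iff)
  \<comment> \<open>Sparsity fails against one of the two sides; with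
    \<open>card_frontier_le\<close> that is one of the two alternatives in
    \<open>ratio_growth\<close> for \<open>Q = 200 * D\<close>.\<close>
  have w: "b \<le> 200 * D * ?w \<or> card (left side) - b \<le> 200 * D * ?w"
    using ns card_frontier_le[of side cnt i lev] by auto
  have "(1 + 1 / real (200 * D)) ^ (i - 1) * (1 + 1 / real (200 * D)) *
      (real (card (left side)) - real b - real ?w) \<le> real n * (real b + real ?w)"
  proof (rule ratio_growth[OF gr])
    show "real b \<le> real (200 * D) * real ?w \<or>
       real (card (left side)) - real b \<le> real (200 * D) * real ?w"
      using w le by (simp only: flip: of_nat_mult of_nat_diff) linarith
  qed (use \<open>b > 0\<close> le D in auto)
  moreover have "(1 + 1 / real (200 * D)) ^ (i - 1) * (1 + 1 / real (200 * D)) =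
      (1 + 1 / real (200 * D)) ^ (Suc i - 1)"
    using i by (metis power_Suc2 Suc_diff_le diff_Suc_1 One_nat_def)
  ultimately have gr': "(1 + 1 / real (200 * D)) ^ (Suc i - 1) *
      (real (card (left side)) - real (b + ?w)) \<le> real n * real (b + ?w)"
    by (simp add: diff_diff_eq)
  have "par' v < E \<and> cnt (par' v) < \<eta> \<and> head W (par' v) = v \<and> lev' (tail W (par' v)) = Suc k"
    if v: "v < n" "lev' v = Suc (Suc k)" for v k
  proof (cases "v \<in> head W ` ?C")
    case True
    then have "i = Suc k" using lev' v by auto
    then show ?thesis using par'[OF v(1) True] C[of "par' v"] lev'_old[of "tail W (par' v)"] ends_W by auto
  next
    case False
    then show ?thesis using par''[OF v(1) False] chain[of v k] v lev'[OF v(1)]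
        lev'_old[of "tail W (par v)"] ends_W by auto
  qed
  moreover have "lev' (head W a) \<noteq> 0"
    if a: "a < E" "lev' (tail W a) \<noteq> 0" "lev' (tail W a) < Suc i" "side (head W a) = 0" "cnt a < \<eta>" for a
  proof -
    have t: "lev' (tail W a) = lev (tail W a)" using lev'[of "tail W a"] a ends_W by auto
    show ?thesis
    proof (cases "lev (head W a) = 0")
      case True
      then have "lev (tail W a) = i" using closed[of a] a t by fastforce
      then have "a \<in> ?C" using True a by (auto simp: frontier_def)
      then show ?thesis using lev' ends_W a by auto
    next
      case False
      then show ?thesis using lev'_old ends_W a by auto
    qed
  qed
  moreover have "side v = 0 \<and> lev' v \<le> Suc i" if "v < n" "lev' v \<noteq> 0" for v
    using that lev'[of v] side[of v] CU by (auto simp: left_def split: if_splits)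
  moreover have "lev' v = 1 \<longleftrightarrow> v = s" if "v < n" for v
    using lev'[of v] that lev1[of v] i CB s by auto
  ultimately show ?thesis
    unfolding bfs_def using s b' gr' by auto
qed

text \<open>The unreached vertex \<open>t\<close> keeps the number of unreached vertices at least 1,
  so the accumulated power is at most \<open>n * b\<close>, hence at most the square of
  \<open>n\<close>; \<open>d\<close> factors would exceed it.\<close>

lemma bfs_bound:
  assumes bfs: "bfs side cnt s i lev par b" and t: "t < n" "side t = 0" "lev t = 0"
  shows "i \<le> d"
proof (rule ccontr)
  assume "\<not> i \<le> d"
  let ?q = "1 + 1 / real (200 * D)"
  let ?B = "{v. v < n \<and> lev v \<noteq> 0}"
  have gr: "?q ^ (i - 1) * (real (card (left side)) - real b) \<le> real n * real b" and b: "b = card ?B"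
    using bfs by (auto simp: bfs_def)
  have "insert t ?B \<subseteq> left side" using t reached_subset[OF bfs] by (auto simp: left_def)
  then have "card (insert t ?B) \<le> card (left side)" by (intro card_mono) auto
  then have le: "b + 1 \<le> card (left side)" using t b by simp
  then have "?q ^ (i - 1) * 1 \<le> ?q ^ (i - 1) * (real (card (left side)) - real b)"
    by (intro mult_left_mono) auto
  also note gr
  also have "real n * real b \<le> real n * real n"
    using le card_left[of side] by (intro mult_left_mono) auto
  also have "\<dots> < ?q ^ (2 * (200 * D) * l)"
    using power_level_bound[OF l, of "200 * D"] D by auto
  finally have "?q ^ (i - 1) < ?q ^ (2 * (200 * D) * l)" by simp
  then have "i - 1 < 2 * (200 * D) * l"
    using D by (subst (asm) power_strict_increasing_iff) auto
  then show False using \<open>\<not> i \<le> d\<close> by (simp add: d_def)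
qed

text \<open>All levels below \<open>i\<close> are expanded, so an unsaturated arc that leaves the
  reached set must start in level \<open>i\<close>. Counting the frontier therefore measures the
  whole cut.\<close>

lemma bfs_cut:
  assumes "bfs side cnt s i lev par b"
  shows "{a. a < E \<and> cnt a < \<eta> \<and> lev (tail W a) \<noteq> 0 \<and> lev (head W a) = 0 \<and> side (head W a) = 0}
     = frontier side cnt i lev"
proof -
  have "lev (tail W a) = i" if "a < E" "cnt a < \<eta>" "lev (tail W a) \<noteq> 0" "lev (head W a) = 0" "side (head W a) = 0" for a
  proof -
    have "lev (tail W a) \<le> i" using assms that ends_W unfolding bfs_def by auto
    moreover have "\<not> lev (tail W a) < i" using assms that unfolding bfs_def by blast
    ultimately show ?thesis by simp
  qed
  moreover have "i \<noteq> 0" using assms by (simp add: bfs_def)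
  ultimately show ?thesis unfolding frontier_def by blast
qed

primrec trace :: "arr \<Rightarrow> nat \<Rightarrow> nat \<Rightarrow> nat list" where
  "trace par 0 v = []"
| "trace par (Suc k) v = trace par k (tail W (par v)) @ [par v]"

lemma length_trace [simp]: "length (trace par k v) = k"
  by (induction k arbitrary: v) auto

text \<open>The levels along the walk are part of the induction because they prove it simple: they
  are 1, 2, ..., k + 1, so no vertex repeats.\<close>

lemma trace_awalk:
  assumes bfs: "bfs side cnt s i lev par b"
  shows "v < n \<Longrightarrow> lev v = Suc k \<Longrightarrow> awalk s (trace par k v) v \<and>
    map lev (awalk_verts s (trace par k v)) = [1..<k + 2] \<and> (\<forall>a\<in>set (trace par k v). a < E \<and> cnt a < \<eta>)"
proof (induction k arbitrary: v)
  case 0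
  then have "v = s" using bfs by (auto simp: bfs_def)
  then show ?case using 0 W by (auto simp: awalk_Nil_iff)
next
  case (Suc k)
  let ?a = "par v" and ?u = "tail W (par v)"
  have a: "?a < E" "cnt ?a < \<eta>" "head W ?a = v" "lev ?u = Suc k"
    using bfs Suc.prems unfolding bfs_def by auto
  from Suc.IH[OF ends_W(1)[OF a(1)] a(4)]
  have IH: "awalk s (trace par k ?u) ?u" "map lev (awalk_verts s (trace par k ?u)) = [1..<k + 2]"
    "\<forall>a\<in>set (trace par k ?u). a < E \<and> cnt a < \<eta>" by auto
  have aw: "awalk ?u [?a] v" using a W Suc.prems ends_W by (auto simp: awalk_simps)
  have w: "awalk s (trace par k ?u @ [?a]) v" using IH(1) aw by (rule awalk_appendI)
  have "awalk_verts s (trace par k ?u @ [?a]) = awalk_verts s (trace par k ?u) @ [v]"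
    using awalk_verts_append[OF w] IH(1) a(3) by (simp add: awlast_of_awalk)
  then have "map lev (awalk_verts s (trace par (Suc k) v)) = [1..<Suc k + 2]"
    using IH(2) Suc.prems(2) by simp
  then show ?case using w IH(3) a by simp
qed

lemma trace_apath:
  assumes bfs: "bfs side cnt s i lev par b" and v: "v < n" "lev v = Suc k"
  shows "apath s (trace par k v) v" "\<forall>a\<in>set (trace par k v). a < E \<and> cnt a < \<eta>"
    "distinct (trace par k v)" "k < n"
proof -
  have "distinct (map lev (awalk_verts s (trace par k v)))"
    using trace_awalk[OF bfs v] by (simp only: distinct_upt)
  then have "distinct (awalk_verts s (trace par k v))" by (simp only: distinct_map)
  then show p: "apath s (trace par k v) v"
    using trace_awalk[OF bfs v] by (simp add: apath_def)
  show "\<forall>a\<in>set (trace par k v). a < E \<and> cnt a < \<eta>" using trace_awalk[OF bfs v] by auto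
  show "distinct (trace par k v)"
    using p by (auto simp: apath_def intro: distinct_verts_imp_distinct)
  show "k < n" using length_apath_less[OF p] W by simp
qed

end

section \<open>The invariant of the routing process and its preservation\<close>

context router
begin

text \<open>Length 0 marks an arc without a path. This is unambiguous: the two ends of an arc are
  distinct and have distinct hosts, so a genuine path is never empty.\<close>

definition unrouted :: "arr \<Rightarrow> nat" where
  "unrouted plen = card {e. e < r \<and> plen e = 0}"

text \<open>Paths are rows of width \<open>n\<close> in one array; a simple path has fewer than
  \<open>n\<close> arcs, so rows do not overlap.\<close>

definition path_of :: "arr \<Rightarrow> arr \<Rightarrow> nat \<Rightarrow> nat list" where
  "path_of path plen e = map (\<lambda>j. path (e * n + j)) [0..<plen e]"

text \<open>Removed vertices have \<open>side\<close> 1 or 2; the pieces are ordered so that those with \<open>side\<close> 1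
  precede all vertices left, and those with \<open>side\<close> 2 follow them. A crossing arc goes forward.\<close>

definition crossing :: "arr \<Rightarrow> nat \<Rightarrow> bool" where
  "crossing side a \<longleftrightarrow> side (tail W a) = 1 \<and> side (head W a) \<noteq> 1 \<or>
     side (tail W a) \<noteq> 2 \<and> side (head W a) = 2"

text \<open>Fresh hosts are taken in increasing order, and \<open>q\<close> is the next candidate.
  That every vertex left below \<open>q\<close> is a host means that no usable vertex has been
  skipped, so a single pointer replaces a search for idle vertices.\<close>

definition hosted :: "arr \<Rightarrow> nat \<Rightarrow> arr \<Rightarrow> bool" where
  "hosted f q side \<longleftrightarrow> inj_on f {..<m} \<and> (\<forall>h<m. f h < q) \<and> q \<le> n \<and>
     (\<forall>v<q. side v = 0 \<longrightarrow> v \<in> f ` {..<m})"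

text \<open>The bound \<open>3 * n\<close> comes from removing the smaller side while
  \<open>5 * rem < n\<close>: afterwards at most \<open>(n + rem) / 2\<close> vertices are removed.
  Only unsaturated arcs are counted, since a search sees no others; the saturated ones are accounted
  for in \<open>final_cut\<close>.\<close>

definition split_ok :: "arr \<Rightarrow> nat \<Rightarrow> arr \<Rightarrow> bool" where
  "split_ok side rem cnt \<longleftrightarrow> rem = card {v. v < n \<and> side v \<noteq> 0} \<and> (\<forall>v<n. side v \<le> 2) \<and>
     5 * rem \<le> 3 * n \<and> 200 * card {a. a < E \<and> cnt a < \<eta> \<and> crossing side a} \<le> rem"

text \<open>Only an inequality holds between the number of current paths and \<open>cnt\<close>,
  because \<open>cnt\<close> also remembers the discarded paths.\<close>

definition paths_ok ::
  "arr \<Rightarrow> arr \<Rightarrow> arr \<Rightarrow> arr \<Rightarrow> bool" where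
  "paths_ok f plen path cnt \<longleftrightarrow>
     (\<forall>e<r. plen e \<noteq> 0 \<longrightarrow> apath (f (ht e)) (path_of path plen e) (f (hh e)) \<and> plen e \<le> d) \<and>
     (\<forall>a<E. card {e. e < r \<and> plen e \<noteq> 0 \<and> a \<in> set (path_of path plen e)} \<le> cnt a \<and> cnt a \<le> \<eta>)"

text \<open>In the bound on \<open>sum cnt {..<E}\<close>, an arc that has to be routed again is charged to the removed
  host of one of its ends: a removed vertex hosts at most one vertex, which has degree at most 18.\<close>

definition inv :: "arr \<Rightarrow> nat \<Rightarrow> arr \<Rightarrow> nat \<Rightarrow> arr \<Rightarrow> arr \<Rightarrow>
    arr \<Rightarrow> nat \<Rightarrow> bool" where
  "inv f q side rem plen path cnt e \<longleftrightarrow>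
     split_ok side rem cnt \<and> hosted f q side \<and> (\<forall>h<m. side (f h) = 0) \<and>
     paths_ok f plen path cnt \<and>
     sum cnt {..<E} + d * unrouted plen \<le> d * (r + 18 * rem) \<and>
     e \<le> r \<and> (\<forall>e'<e. plen e' \<noteq> 0)"

text \<open>\<open>n <= 4 * m\<close> is the size demanded of the result;
  \<open>5 * m <= 2 * n\<close> guarantees a host for every vertex after \<open>3 * n / 5\<close>
  vertices have been removed.\<close>

lemma m_bounds: "2 \<le> m" "m \<le> n" "5 * m \<le> 2 * n" "n \<le> 4 * m"
  using n m by linarith+

lemma card_left_eq: "split_ok side rem cnt \<Longrightarrow> card (left side) = n - rem" "split_ok side rem cnt \<Longrightarrow> rem \<le> n"
proof -
  assume s: "split_ok side rem cnt"
  have "{..<n} = left side \<union> {v. v < n \<and> side v \<noteq> 0}" by (auto simp: left_def)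
  then have "n = card (left side \<union> {v. v < n \<and> side v \<noteq> 0})" by (metis card_lessThan)
  also have "\<dots> = card (left side) + rem"
    using s by (subst card_Un_disjoint) (auto simp: left_def split_ok_def)
  finally show "card (left side) = n - rem" "rem \<le> n" by auto
qed

lemma inv_init:
  assumes "\<And>h. h < m \<Longrightarrow> f h = h"
  shows "inv f m (\<lambda>_. 0) 0 (\<lambda>_. 0) path (\<lambda>_. 0) 0"
proof -
  have "f ` {..<m} = {..<m}" using assms by force
  moreover have "inj_on f {..<m}" using assms by (auto simp: inj_on_def)
  ultimately show ?thesis
    using assms m_bounds
    by (auto simp: inv_def split_ok_def hosted_def paths_ok_def unrouted_def crossing_def)
qed

lemma length_path_of [simp]: "length (path_of path plen e) = plen e"
  by (simp add: path_of_def)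

lemma paths_short: "paths_ok f plen path cnt \<Longrightarrow> e < r \<Longrightarrow> plen e < n"
  using length_apath_less[of "f (ht e)" "path_of path plen e" "f (hh e)"] n W
  by (cases "plen e = 0") (auto simp: paths_ok_def)

text \<open>A new path raises the sum of the counters by at most \<open>d\<close>, exactly what one
  unrouted arc less releases on the same side of the bound.\<close>

lemma inv_route:
  assumes inv: "inv f q side rem plen path cnt e" and e: "e < r" "plen e = 0"
    and p: "apath (f (ht e)) p (f (hh e))" "\<forall>a\<in>set p. a < E \<and> cnt a < \<eta>" "distinct p" "length p \<le> d"
    and plen': "plen' = plen(e := length p)"
    and path': "\<And>j. j < length p \<Longrightarrow> path' (e * n + j) = p ! j"
      "\<And>e' j. e' < r \<Longrightarrow> e' \<noteq> e \<Longrightarrow> j < n \<Longrightarrow> path' (e' * n + j) = path (e' * n + j)"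
    and cnt': "\<And>a. a < E \<Longrightarrow> cnt' a = cnt a + (if a \<in> set p then 1 else 0)"
  shows "inv f q side rem plen' path' cnt' (Suc e)" "unrouted plen = Suc (unrouted plen')" "length p \<noteq> 0"
proof -
  have po: "paths_ok f plen path cnt" and so: "split_ok side rem cnt" and h: "hosted f q side"
    using inv by (auto simp: inv_def)
  have "f (ht e) \<noteq> f (hh e)"
    using h ends[OF e(1)] unfolding hosted_def inj_on_def by blast
  then show len: "length p \<noteq> 0" using p(1) by (auto simp: apath_Nil_iff)
  have pe: "path_of path' plen' e = p"
    using path'(1) plen' by (auto simp: path_of_def intro!: nth_equalityI)
  have pe': "path_of path' plen' e' = path_of path plen e'" if "e' < r" "e' \<noteq> e" for e'
    using path'(2)[OF that] paths_short[OF po that(1)] that plen' by (auto simp: path_of_def)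
  have "{e'. e' < r \<and> plen e' = 0} = insert e {e'. e' < r \<and> plen' e' = 0}"
    using plen' len e by auto
  moreover have "e \<notin> {e'. e' < r \<and> plen' e' = 0}" using plen' len by auto
  ultimately show un: "unrouted plen = Suc (unrouted plen')"
    unfolding unrouted_def by simp
  have "paths_ok f plen' path' cnt'"
    unfolding paths_ok_def
  proof (intro conjI allI impI)
    fix e' assume "e' < r" "plen' e' \<noteq> 0"
    then show "apath (f (ht e')) (path_of path' plen' e') (f (hh e'))" "plen' e' \<le> d"
      using p pe pe' plen' po by (cases "e' = e"; auto simp: paths_ok_def)+
  next
    fix a assume a: "a < E"
    let ?S = "{e'. e' < r \<and> plen e' \<noteq> 0 \<and> a \<in> set (path_of path plen e')}"
    let ?S' = "{e'. e' < r \<and> plen' e' \<noteq> 0 \<and> a \<in> set (path_of path' plen' e')}"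
    have "?S' \<subseteq> ?S \<union> (if a \<in> set p then {e} else {})"
      using pe pe' plen' by (auto split: if_splits)
    then have "card ?S' \<le> card (?S \<union> (if a \<in> set p then {e} else {}))"
      by (intro card_mono) auto
    also have "\<dots> \<le> card ?S + (if a \<in> set p then 1 else 0)"
      by (rule order_trans[OF card_Un_le]) auto
    also have "\<dots> \<le> cnt' a" using po a cnt'[OF a] by (auto simp: paths_ok_def)
    finally show "card ?S' \<le> cnt' a" .
    show "cnt' a \<le> \<eta>" using po a cnt'[OF a] p(2) by (auto simp: paths_ok_def)
  qed
  moreover have "split_ok side rem cnt'"
  proof -
    have "card {a. a < E \<and> cnt' a < \<eta> \<and> crossing side a} \<le> card {a. a < E \<and> cnt a < \<eta> \<and> crossing side a}"
      using cnt' by (intro card_mono) auto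
    then show ?thesis using so unfolding split_ok_def by auto
  qed
  moreover have "sum cnt' {..<E} + d * unrouted plen' \<le> d * (r + 18 * rem)"
  proof -
    have "sum cnt' {..<E} = sum cnt {..<E} + (\<Sum>a<E. if a \<in> set p then 1 else 0)"
      using cnt' by (simp add: sum.distrib)
    also have "(\<Sum>a<E. if a \<in> set p then 1 else 0) = card (set p)"
      using p(2) by (subst sum.If_cases) (auto intro!: arg_cong[where f = card])
    also have "\<dots> \<le> d" using p(3,4) by (simp add: distinct_card)
    finally have "sum cnt' {..<E} \<le> sum cnt {..<E} + d" by simp
    moreover have "d * unrouted plen = d * unrouted plen' + d" using un by simp
    ultimately show ?thesis using inv unfolding inv_def by linarith
  qed
  moreover have "\<forall>e'<Suc e. plen' e' \<noteq> 0" using inv plen' len by (auto simp: inv_def less_Suc_eq)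
  ultimately show "inv f q side rem plen' path' cnt' (Suc e)"
    using inv e by (auto simp: inv_def)
qed

text \<open>If \<open>q\<close> were \<open>n\<close>, all vertices left would be hosts of the
  \<open>m - 1\<close> vertices other than \<open>i\<close>; but at least \<open>2 * n / 5\<close>,
  hence at least \<open>m\<close>, vertices are left. The new host \<open>q\<close> may itself be
  removed, in which case the step applies again.\<close>

lemma rehost_step:
  assumes h: "hosted f q side" and so: "split_ok side rem cnt" and i: "i < m" "side (f i) \<noteq> 0"
  shows "q < n" "hosted (f(i := q)) (Suc q) side"
proof -
  show q: "q < n"
  proof (rule ccontr)
    assume "\<not> q < n"
    then have "q = n" using h by (auto simp: hosted_def)
    have "left side \<subseteq> f ` ({..<m} - {i})"
    proof
      fix v assume "v \<in> left side"
      then have "v < q" "side v = 0" using \<open>q = n\<close> by (auto simp: left_def)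
      with h obtain j where "j < m" "v = f j" by (auto simp: hosted_def)
      then show "v \<in> f ` ({..<m} - {i})" using \<open>side v = 0\<close> i by auto
    qed
    then have "card (left side) \<le> card (f ` ({..<m} - {i}))" by (intro card_mono) auto
    also have "\<dots> \<le> card ({..<m} - {i})" by (intro card_image_le) auto
    also have "\<dots> = m - 1" using i by simp
    finally show False
      using card_left_eq[OF so] so i m_bounds by (auto simp: split_ok_def)
  qed
  have "v \<in> (f(i := q)) ` {..<m}" if v: "v < Suc q" "side v = 0" for v
  proof (cases "v = q")
    case True
    then show ?thesis using i by force
  next
    case False
    then have "v \<in> f ` {..<m}" using h v by (auto simp: hosted_def)
    then obtain j where "j < m" "v = f j" by auto
    moreover have "j \<noteq> i" using v i calculation by auto
    ultimately show ?thesis by force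
  qed
  moreover have "inj_on (f(i := q)) {..<m}"
    using h by (auto simp: hosted_def inj_on_def)
  ultimately show "hosted (f(i := q)) (Suc q) side"
    using h q by (auto simp: hosted_def less_Suc_eq)
qed

text \<open>A small reached side becomes side 1, a small unreached side becomes side 2; in both
  cases the new forward arcs lie in the frontier, so they number at most 1/200 of the vertices
  removed now. Both sides are nonempty because of \<open>s\<close> and \<open>t\<close>, which makes
  the removal strict. The last claim is stated for arbitrary new hosts, so that it does not depend
  on how the program finds them; the scan over the arcs restarts at 0.\<close>

lemma inv_cut:
  assumes inv: "inv f q side rem plen path cnt e" and rem: "5 * rem < n"
    and bfs: "bfs side cnt s i lev par b" and t: "t < n" "side t = 0" "lev t = 0"
    and sparse: "200 * card (frontier side cnt i lev) \<le> b"
      "200 * card (frontier side cnt i lev) \<le> n - rem - b"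
    and xy: "b \<le> n - rem - b \<and> x = 1 \<and> y = 0 \<and> rem' = rem + b \<or>
       n - rem - b < b \<and> x = 0 \<and> y = 2 \<and> rem' = rem + (n - rem - b)"
    and side': "\<And>v. v < n \<Longrightarrow> side' v = (if side v \<noteq> 0 then side v else if lev v \<noteq> 0 then x else y)"
  shows "split_ok side' rem' cnt" "rem < rem'" "hosted f q side'"
    and inv_rehost: "\<And>f' q' plen'. hosted f' q' side' \<Longrightarrow> \<forall>h<m. side' (f' h) = 0 \<Longrightarrow>
      \<forall>h<m. side' (f h) = 0 \<longrightarrow> f' h = f h \<Longrightarrow>
      \<forall>e<r. plen' e = (if side' (f (ht e)) + side' (f (hh e)) \<noteq> 0 then 0 else plen e) \<Longrightarrow>
      inv f' q' side' rem' plen' path cnt 0 \<and> unrouted plen' \<le> unrouted plen + 18 * (rem' - rem)"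
proof -
  have so: "split_ok side rem cnt" and h: "hosted f q side" and fs: "\<And>h. h < m \<Longrightarrow> side (f h) = 0"
    and po: "paths_ok f plen path cnt"
    using inv by (auto simp: inv_def)
  note L = card_left_eq[OF so]
  let ?B = "{v. v < n \<and> lev v \<noteq> 0}"
  let ?R = "{v. v < n \<and> side v = 0 \<and> side' v \<noteq> 0}"
  let ?S = "{v. v < n \<and> side v \<noteq> 0}"
  have s: "s \<in> ?B" and b: "b = card ?B" using bfs by (auto simp: bfs_def)
  have BL: "?B \<subseteq> left side" by (rule reached_subset[OF bfs])
  have b0: "0 < b" using s unfolding b by (auto simp: card_gt_0_iff)
  have Bc: "card (left side - ?B) = n - rem - b"
    using BL L b by (subst card_Diff_subset) auto
  have "t \<in> left side - ?B" using t by (auto simp: left_def)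
  then have c0: "0 < n - rem - b" unfolding Bc[symmetric] by (auto simp: card_gt_0_iff)
  have cardR: "card ?R = rem' - rem"
  proof -
    have R: "?R = (if x = 1 then ?B else left side - ?B)"
      using xy side' BL by (auto simp: left_def split: if_splits)
    show ?thesis
    proof (cases "x = 1")
      case True
      then have "?R = ?B" unfolding R by (rule if_P)
      then have "card ?R = b" unfolding b by simp
      then show ?thesis using xy True by linarith
    next
      case False
      then have "?R = left side - ?B" unfolding R by (rule if_not_P)
      then have "card ?R = n - rem - b" unfolding Bc[symmetric] by simp
      then show ?thesis using xy False by linarith
    qed
  qed
  show less: "rem < rem'" using xy b0 c0 by auto
  have S': "{v. v < n \<and> side' v \<noteq> 0} = ?S \<union> ?R" using side' by (auto split: if_splits)
  have rem': "rem' = card {v. v < n \<and> side' v \<noteq> 0}"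
  proof -
    have "card (?S \<union> ?R) = card ?S + card ?R" by (intro card_Un_disjoint) auto
    moreover have "card ?S = rem" using so by (simp add: split_ok_def)
    ultimately show ?thesis unfolding S' using cardR less by linarith
  qed
  have left': "side v = 0" if "v < n" "side' v = 0" for v
    using that side' by (auto split: if_splits)
  have fr: "200 * card (frontier side cnt i lev) \<le> rem' - rem"
    using xy sparse by auto
  have sub: "{a. a < E \<and> cnt a < \<eta> \<and> crossing side' a} \<subseteq>
     {a. a < E \<and> cnt a < \<eta> \<and> crossing side a} \<union> frontier side cnt i lev"
  proof
    fix a assume "a \<in> {a. a < E \<and> cnt a < \<eta> \<and> crossing side' a}"
    then have a: "a < E" "cnt a < \<eta>" "crossing side' a" by auto
    show "a \<in> {a. a < E \<and> cnt a < \<eta> \<and> crossing side a} \<union> frontier side cnt i lev"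
    proof (cases "crossing side a")
      case False
      have L1: "side v = 0" if "v < n" "lev v \<noteq> 0" for v
        using BL that by (auto simp: left_def)
      have L2: "side v \<in> {0, 1, 2}" if "v < n" for v
        using so that by (fastforce simp: split_ok_def)
      \<comment> \<open>An arc with an end removed earlier keeps its status: it was crossing
        already, or it enters side 1 or leaves side 2 and never crosses. So both ends were left, and
        a newly crossing arc goes from a reached to an unreached vertex.\<close>
      have "lev (tail W a) \<noteq> 0 \<and> lev (head W a) = 0 \<and> side (head W a) = 0"
        using a False xy side'[OF ends_W(1)[OF a(1)]] side'[OF ends_W(2)[OF a(1)]]
          L1[OF ends_W(1)[OF a(1)]] L1[OF ends_W(2)[OF a(1)]]
          L2[OF ends_W(1)[OF a(1)]] L2[OF ends_W(2)[OF a(1)]]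
        unfolding crossing_def by (auto split: if_splits)
      then show ?thesis using bfs_cut[OF bfs] a by auto
    qed (use a in auto)
  qed
  have "card {a. a < E \<and> cnt a < \<eta> \<and> crossing side' a} \<le>
     card ({a. a < E \<and> cnt a < \<eta> \<and> crossing side a} \<union> frontier side cnt i lev)"
    using sub by (intro card_mono) auto
  also have "\<dots> \<le> card {a. a < E \<and> cnt a < \<eta> \<and> crossing side a} + card (frontier side cnt i lev)"
    by (rule card_Un_le)
  finally have "200 * card {a. a < E \<and> cnt a < \<eta> \<and> crossing side' a} \<le> rem'"
    using fr so less unfolding split_ok_def by linarith
  moreover have "5 * rem' \<le> 3 * n" using xy rem by linarith
  moreover have "\<forall>v<n. side' v \<le> 2" using side' xy so by (auto simp: split_ok_def)
  ultimately show so': "split_ok side' rem' cnt" using rem' by (simp add: split_ok_def)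
  show "hosted f q side'"
    using h left' unfolding hosted_def by (meson order_less_le_trans)
  show "inv f' q' side' rem' plen' path cnt 0 \<and> unrouted plen' \<le> unrouted plen + 18 * (rem' - rem)"
    if h': "hosted f' q' side'" and fs': "\<forall>h<m. side' (f' h) = 0"
      and same: "\<forall>h<m. side' (f h) = 0 \<longrightarrow> f' h = f h"
      and plen': "\<forall>e<r. plen' e = (if side' (f (ht e)) + side' (f (hh e)) \<noteq> 0 then 0 else plen e)"
    for f' q' plen'
  proof -
    have keep: "plen' e = plen e \<and> f' (ht e) = f (ht e) \<and> f' (hh e) = f (hh e)"
      if "e < r" "plen' e \<noteq> 0" for e
      using that plen' same ends[of e] by (auto split: if_splits)
    then have keep': "path_of path plen' e = path_of path plen e" if "e < r" "plen' e \<noteq> 0" for e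
      using that by (simp add: path_of_def)
    have "paths_ok f' plen' path cnt"
      unfolding paths_ok_def
    proof (intro conjI allI impI)
      fix e' assume "e' < r" "plen' e' \<noteq> 0"
      then show "apath (f' (ht e')) (path_of path plen' e') (f' (hh e'))" "plen' e' \<le> d"
        using keep[of e'] keep'[of e'] po by (auto simp: paths_ok_def)
    next
      fix a assume a: "a < E"
      have "card {e'. e' < r \<and> plen' e' \<noteq> 0 \<and> a \<in> set (path_of path plen' e')} \<le>
          card {e'. e' < r \<and> plen e' \<noteq> 0 \<and> a \<in> set (path_of path plen e')}"
        using keep keep' by (intro card_mono) auto
      also have "\<dots> \<le> cnt a" using po a by (auto simp: paths_ok_def)
      finally show "card {e'. e' < r \<and> plen' e' \<noteq> 0 \<and> a \<in> set (path_of path plen' e')} \<le> cnt a" .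
      show "cnt a \<le> \<eta>" using po a by (auto simp: paths_ok_def)
    qed
    moreover have un: "unrouted plen' \<le> unrouted plen + 18 * (rem' - rem)"
    proof -
      let ?H = "{h. h < m \<and> side' (f h) \<noteq> 0}"
      have "{e. e < r \<and> plen' e = 0} \<subseteq> {e. e < r \<and> plen e = 0} \<union> (\<Union>h\<in>?H. {e. e < r \<and> (ht e = h \<or> hh e = h)})"
      proof
        fix e assume "e \<in> {e. e < r \<and> plen' e = 0}"
        then show "e \<in> {e. e < r \<and> plen e = 0} \<union> (\<Union>h\<in>?H. {e. e < r \<and> (ht e = h \<or> hh e = h)})"
          using plen'[rule_format, of e] ends[of e] by (auto split: if_splits)
      qed
      then have "unrouted plen' \<le> card ({e. e < r \<and> plen e = 0} \<union> (\<Union>h\<in>?H. {e. e < r \<and> (ht e = h \<or> hh e = h)}))"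
        unfolding unrouted_def by (intro card_mono) auto
      also have "\<dots> \<le> unrouted plen + card (\<Union>h\<in>?H. {e. e < r \<and> (ht e = h \<or> hh e = h)})"
        unfolding unrouted_def by (rule card_Un_le)
      also have "card (\<Union>h\<in>?H. {e. e < r \<and> (ht e = h \<or> hh e = h)}) \<le> (\<Sum>h\<in>?H. 18)"
        by (rule order_trans[OF card_UN_le sum_mono]) (auto intro: deg)
      also have "(\<Sum>h\<in>?H. 18) = 18 * card (f ` ?H)"
        using h by (subst card_image) (auto simp: hosted_def inj_on_def)
      \<comment> \<open>Before the cut all hosts were left, so the hosts lost now are among the
        newly removed vertices, which pay for them.\<close>
      also have "f ` ?H \<subseteq> ?R" using fs h by (force simp: hosted_def)
      then have "card (f ` ?H) \<le> card ?R" by (intro card_mono) auto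
      finally show ?thesis using cardR by simp
    qed
    moreover have "sum cnt {..<E} + d * unrouted plen' \<le> d * (r + 18 * rem')"
    proof -
      have "d * unrouted plen' \<le> d * (unrouted plen + 18 * (rem' - rem))"
        using un by (rule mult_le_mono2)
      also have "\<dots> = d * unrouted plen + d * (18 * (rem' - rem))" by (rule add_mult_distrib2)
      finally have "sum cnt {..<E} + d * unrouted plen' \<le>
          d * (r + 18 * rem) + d * (18 * (rem' - rem))" using inv unfolding inv_def by linarith
      also have "\<dots> = d * (r + 18 * rem + 18 * (rem' - rem))" by (rule add_mult_distrib2[symmetric])
      also have "r + 18 * rem + 18 * (rem' - rem) = r + 18 * rem'" using less by simp
      finally show ?thesis .
    qed
    ultimately show ?thesis using so' h' fs' by (auto simp: inv_def)
  qed
qed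

text \<open>Both choices of \<open>A\<close> are initial segments of the order on the pieces, so all
  arcs out of \<open>A\<close> are crossing or saturated, at most \<open>n / 200\<close> of each.
  The more numerous kind of removed vertices has at least \<open>rem / 2\<close>, hence
  \<open>n / 10\<close>, members; the other part of the cut contains the \<open>2 * n / 5\<close>
  vertices left.\<close>

lemma final_cut:
  assumes inv: "inv f q side rem plen path cnt e" and rem: "n \<le> 5 * rem"
    and A: "A = (if rem \<le> 2 * card {v. v < n \<and> side v = 1} then {v. v < n \<and> side v = 1}
       else {v. v < n \<and> side v \<noteq> 2})"
  shows "is_cut W A ({..<n} - A)" "100 * card (arcs_between W A ({..<n} - A)) \<le> n"
    "n \<le> 10 * card A" "n \<le> 10 * card ({..<n} - A)"
proof -
  have so: "split_ok side rem cnt" and po: "paths_ok f plen path cnt"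
    and sum: "sum cnt {..<E} + d * unrouted plen \<le> d * (r + 18 * rem)"
    using inv by (auto simp: inv_def)
  note L = card_left_eq[OF so]
  let ?O = "{v. v < n \<and> side v = 1}" and ?I = "{v. v < n \<and> side v = 2}"
  have "{v. v < n \<and> side v \<noteq> 0} = ?O \<union> ?I"
    using so by (force simp: split_ok_def)
  then have rem_eq: "rem = card ?O + card ?I"
    using so by (simp add: split_ok_def card_Un_disjoint[symmetric] disjoint_iff)
  have comp: "{..<n} - A = (if rem \<le> 2 * card ?O then {..<n} - ?O else ?I)"
    using A by auto
  have "left side \<subseteq> {..<n} - ?O" by (auto simp: left_def)
  from card_mono[OF _ this] have cO: "n \<le> 10 * card ({..<n} - ?O)" using L so n by (auto simp: split_ok_def)
  have "left side \<subseteq> {v. v < n \<and> side v \<noteq> 2}" by (auto simp: left_def)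
  from card_mono[OF _ this] have cI: "n \<le> 10 * card {v. v < n \<and> side v \<noteq> 2}" using L so n by (auto simp: split_ok_def)
  show cA: "n \<le> 10 * card A" using A cI rem rem_eq by auto
  show cB: "n \<le> 10 * card ({..<n} - A)" unfolding comp using cO rem rem_eq by auto
  have "card A \<noteq> 0" "card ({..<n} - A) \<noteq> 0" using cA cB n by linarith+
  then have "A \<noteq> {}" "{..<n} - A \<noteq> {}" by (metis card.empty)+
  then show "is_cut W A ({..<n} - A)" using W A by (auto simp: is_cut_def split: if_splits)
  let ?dead = "{a. a < E \<and> \<not> cnt a < \<eta>}" and ?X = "{a. a < E \<and> cnt a < \<eta> \<and> crossing side a}"
  have "card ?dead * \<eta> = (\<Sum>a\<in>?dead. \<eta>)" by simp
  also have "\<dots> \<le> (\<Sum>a\<in>?dead. cnt a)" by (intro sum_mono) auto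
  also have "\<dots> \<le> sum cnt {..<E}" by (intro sum_mono2) auto
  also have "\<dots> \<le> d * (r + 18 * rem)" using sum by simp
  \<comment> \<open>27 = 9 + 18: at most \<open>9 * n\<close> arcs of the expander and 18 reroutings
    per removed vertex. With 5400 = 200 * 27 the saturated arcs number at most
    \<open>n / 200\<close>.\<close>
  also have "\<dots> \<le> d * (27 * n)" using r m_bounds L by (intro mult_le_mono2) linarith
  finally have "200 * card ?dead \<le> n" using d_pos by (simp add: \<eta>_def)
  moreover have "arcs_between W A ({..<n} - A) \<subseteq> ?X \<union> ?dead"
    using A W ends_W by (auto simp: arcs_between_def crossing_def split: if_splits)
  then have "card (arcs_between W A ({..<n} - A)) \<le> card (?X \<union> ?dead)" by (intro card_mono) auto
  then have "card (arcs_between W A ({..<n} - A)) \<le> card ?X + card ?dead"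
    using card_Un_le[of ?X ?dead] by linarith
  moreover have "200 * card ?X \<le> rem" using so by (simp add: split_ok_def)
  ultimately show "100 * card (arcs_between W A ({..<n} - A)) \<le> n" using L by linarith
qed

end

section \<open>The program\<close>

text \<open>Arrays 0 and 1 hold input and output; scalars are arrays used at index 0 only.\<close>

abbreviation (input) "vN \<equiv> (2::nat)"
abbreviation (input) "vE \<equiv> (3::nat)"
abbreviation (input) "vM \<equiv> (4::nat)"
abbreviation (input) "vR \<equiv> (5::nat)"
abbreviation (input) "vEta \<equiv> (6::nat)"
abbreviation (input) "aHT \<equiv> (7::nat)"
abbreviation (input) "aHH \<equiv> (8::nat)"
abbreviation (input) "aF \<equiv> (9::nat)"
abbreviation (input) "vQ \<equiv> (10::nat)"
abbreviation (input) "aSide \<equiv> (11::nat)"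
abbreviation (input) "vRem \<equiv> (12::nat)"
abbreviation (input) "aLen \<equiv> (13::nat)"
abbreviation (input) "aPath \<equiv> (14::nat)"
abbreviation (input) "aCnt \<equiv> (15::nat)"
abbreviation (input) "vCur \<equiv> (16::nat)"
abbreviation (input) "aLev \<equiv> (17::nat)"
abbreviation (input) "aPar \<equiv> (18::nat)"
abbreviation (input) "vLvl \<equiv> (19::nat)"
abbreviation (input) "vB \<equiv> (20::nat)"
abbreviation (input) "vFl \<equiv> (21::nat)"
abbreviation (input) "vCut \<equiv> (22::nat)"
abbreviation (input) "vNew \<equiv> (23::nat)"
abbreviation (input) "vA \<equiv> (24::nat)"
abbreviation (input) "vX \<equiv> (25::nat)"
abbreviation (input) "vY \<equiv> (26::nat)"
abbreviation (input) "vSrc \<equiv> (27::nat)"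
abbreviation (input) "vDst \<equiv> (28::nat)"
abbreviation (input) "vJ \<equiv> (29::nat)"
abbreviation (input) "vPos \<equiv> (31::nat)"
abbreviation (input) "aTl \<equiv> (32::nat)"
abbreviation (input) "aHd \<equiv> (33::nat)"

text \<open>One pass over all arcs, without a queue. A vertex reached in this pass gets its new
  level at once, so a further arc into it is recognized by that level: it still counts as a cut arc
  in \<open>vCut\<close>, but not as a new vertex in \<open>vNew\<close>.\<close>

definition sweep :: program where
  "sweep =
     Seq (Assign vCut (Const 0)) (Seq (Assign vNew (Const 0))
     (For vA (V vE)
       (If (Eq (Read aLev (Read aTl (V vA))) (V vLvl))
         (If (Read aSide (Read aHd (V vA))) Skip
           (If (Sub (V vEta) (Read aCnt (V vA)))
             (If (Read aLev (Read aHd (V vA)))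
               (If (Eq (Read aLev (Read aHd (V vA))) (Add (V vLvl) (Const 1)))
                 (Assign vCut (Add (V vCut) (Const 1))) Skip)
               (Seq (Assign vCut (Add (V vCut) (Const 1)))
               (Seq (Assign vNew (Add (V vNew) (Const 1)))
               (Seq (Write aPar (Read aHd (V vA)) (V vA))
                    (Write aLev (Read aHd (V vA)) (Add (V vLvl) (Const 1)))))))
             Skip))
         Skip)))"

text \<open>Values of \<open>vFl\<close>: 0 while searching, 1 for a sparse cut, 2 when the
  destination has been reached.\<close>

definition advance :: program where
  "advance =
     Seq (Assign vB (Add (V vB) (V vNew))) (Seq (Assign vLvl (Add (V vLvl) (Const 1)))
     (If (Read aLev (V vDst)) (Assign vFl (Const 2)) Skip))"

definition search_loop :: program where
  "search_loop =
     While (Sub (Const 1) (V vFl))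
       (Seq sweep
         (If (Sub (Mul (Const 200) (V vCut)) (V vB)) advance
           (If (Sub (Mul (Const 200) (V vCut)) (Sub (Sub (V vN) (V vRem)) (V vB))) advance
             (Assign vFl (Const 1)))))"

definition search :: program where
  "search =
     Seq (For vA (V vN) (Write aLev (V vA) (Const 0)))
     (Seq (Write aLev (V vSrc) (Const 1))
     (Seq (Assign vLvl (Const 1)) (Seq (Assign vB (Const 1)) (Seq (Assign vFl (Const 0)) search_loop))))"

context router
begin

definition static :: "memory \<Rightarrow> bool" where
  "static s \<longleftrightarrow> s vN 0 = n \<and> s vE 0 = E \<and> s vM 0 = m \<and> s vR 0 = r \<and> s vEta 0 = \<eta> \<and>
     (\<forall>a<E. s aTl a = tail W a \<and> s aHd a = head W a) \<and> (\<forall>e<r. s aHT e = ht e \<and> s aHH e = hh e)"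

lemma static_cong:
  "static s \<Longrightarrow> s' vN = s vN \<Longrightarrow> s' vE = s vE \<Longrightarrow> s' vM = s vM \<Longrightarrow> s' vR = s vR \<Longrightarrow>
     s' vEta = s vEta \<Longrightarrow> s' aHT = s aHT \<Longrightarrow> s' aHH = s aHH \<Longrightarrow> s' aTl = s aTl \<Longrightarrow> s' aHd = s aHd \<Longrightarrow> static s'"
  by (simp add: static_def)

end

text \<open>The product covers the path table, the length of the output and the product used as main
  loop condition; the linear term covers multiples such as \<open>200 * vCut\<close>, and
  \<open>\<eta>\<close> the counters and levels.\<close>

locale router_machine = router +
  fixes B :: nat
  assumes B: "20 * (n + 10) * (r + 10) + 1000 * (n + E + r + 10) + \<eta> < B"
begin

lemma B_bounds: "1000 * (n + E + r + 10) + \<eta> < B" "Suc 0 < B"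
  using B by auto

lemma d_le: "d \<le> \<eta>"
  by (simp add: \<eta>_def)

lemma wp_sweep:
  assumes st: "static s0" and side: "\<And>v. v < n \<Longrightarrow> s0 aSide v \<le> 2"
    and cnt: "\<And>a. a < E \<Longrightarrow> s0 aCnt a \<le> \<eta>"
    and lev: "\<And>v. v < n \<Longrightarrow> s0 aLev v \<le> i" and i: "1 \<le> i" "s0 vLvl 0 = i" "i + 2 < B"
    and C: "C = frontier (s0 aSide) (s0 aCnt) i (s0 aLev)"
  shows "wp B sweep s0 (\<lambda>t s. t \<le> 14 * E + 4 \<and> s vCut 0 = card C \<and> s vNew 0 = card (head W ` C) \<and>
     (\<forall>v<n. s aLev v = (if v \<in> head W ` C then Suc i else s0 aLev v)) \<and>
     (\<forall>v<n. v \<in> head W ` C \<longrightarrow> s aPar v \<in> C \<and> head W (s aPar v) = v) \<and>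
     (\<forall>v<n. v \<notin> head W ` C \<longrightarrow> s aPar v = s0 aPar v))"
proof -
  let ?C = "\<lambda>k. {a \<in> C. a < k}"
  define I where "I k s \<longleftrightarrow> s vCut 0 = card (?C k) \<and> s vNew 0 = card (head W ` ?C k) \<and>
     (\<forall>v<n. s aLev v = (if v \<in> head W ` ?C k then Suc i else s0 aLev v)) \<and>
     (\<forall>v<n. v \<in> head W ` ?C k \<longrightarrow> s aPar v \<in> ?C k \<and> head W (s aPar v) = v) \<and>
     (\<forall>v<n. v \<notin> head W ` ?C k \<longrightarrow> s aPar v = s0 aPar v)" for k s
  have finC: "finite C" using C by simp
  have CE: "?C E = C" using C by (auto simp: frontier_def)
  note BB = B_bounds
  show ?thesis
    unfolding sweep_def
    apply (simp only: wp_Seq wp_Write)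
    apply (intro conjI)
    subgoal using BB by simp
    subgoal using BB by simp
    subgoal using BB by simp
    subgoal using BB by simp
    apply (rule wp_use[OF wp_For[where I = I and m = E and c = 12]])
    subgoal by (simp add: I_def)
    subgoal using st BB by (simp add: static_def)
    subgoal premises pre for k s
    proof -
      have fr: "s a = s0 a" if "a \<notin> {vCut, vNew, vA, aLev, aPar}" for a
        using pre(4)[of a] that by simp
      have st': "static s" by (rule static_cong[OF st]) (simp_all add: fr)
      note k = pre(1) and I = pre(2)[unfolded I_def] and vA = pre(3)
      have h: "head W k < n" and t: "tail W k < n" using ends_W[OF k] by auto
      have v: "s aTl k = tail W k" "s aHd k = head W k" "s vEta 0 = \<eta>" "s aSide = s0 aSide" "s aCnt = s0 aCnt"
        "s vLvl 0 = i"
        using st' k i by (auto simp: static_def fr)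
      have L: "s aLev v = (if v \<in> head W ` ?C k then Suc i else s0 aLev v)" if "v < n" for v
        using I that by blast
      have lev0: "s0 aLev v = 0" if "v \<in> head W ` C" for v using that C by (auto simp: frontier_def)
      \<comment> \<open>A level changes during the pass only from 0 to \<open>Suc i\<close>, so
        comparing with \<open>i\<close> gives the same answer as at the start.\<close>
      have lt: "s aLev (tail W k) = i \<longleftrightarrow> s0 aLev (tail W k) = i"
        using L[OF t] lev0[of "tail W k"] i by auto
      have "card (?C k) \<le> card {..<k}" by (intro card_mono) auto
      then have c1: "card (?C k) \<le> k" by simp
      have c2: "card (head W ` ?C k) \<le> k" using card_image_le[of "?C k" "head W"] c1 finC by auto
      have levB: "s aLev v < B" if "v < n" for v
        using L[OF that] lev[OF that] i by auto
      have b: "k < B" "tail W k < B" "head W k < B" "s0 aCnt k < B" "\<eta> < B" "s0 aSide (head W k) < B"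
        "s aLev (tail W k) < B" "s aLev (head W k) < B" "Suc i < B" "Suc 0 < B" "i < B"
        "s vCut 0 < B" "Suc (s vCut 0) < B" "s vNew 0 < B" "Suc (s vNew 0) < B" "0 < B"
        using BB k h t c1 c2 I i cnt[OF k] side[OF h] levB[OF t] levB[OF h] by auto
      show ?thesis
      proof (cases "k \<in> C")
        case True
        then have C1: "?C (Suc k) = insert k (?C k)" by auto
        have kC: "k \<notin> ?C k" by simp
        have card1: "card (?C (Suc k)) = Suc (card (?C k))"
          unfolding C1 using finC by simp
        have p: "s0 aLev (tail W k) = i" "s0 aSide (head W k) = 0" "s0 aCnt k < \<eta>" "s0 aLev (head W k) = 0"
          using True C by (auto simp: frontier_def)
        show ?thesis
        proof (cases "head W k \<in> head W ` ?C k")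
          case True
          then have H1: "head W ` ?C (Suc k) = head W ` ?C k" unfolding C1 by auto
          have "s aLev (head W k) = Suc i" using L[OF h] True by simp
          then show ?thesis
            using p b lt i v vA I card1 H1 C1 unfolding I_def by simp
        next
          case False
          then have H1: "head W ` ?C (Suc k) = insert (head W k) (head W ` ?C k)" unfolding C1 by auto
          have H2: "card (head W ` ?C (Suc k)) = Suc (card (head W ` ?C k))"
            unfolding H1 using False finC by simp
          have "s aLev (head W k) = 0" using L[OF h] False p by simp
          then show ?thesis
            using p b lt i v vA I card1 H1 H2 C1 False unfolding I_def by simp
        qed
      next
        case False
        then have C1: "?C (Suc k) = ?C k" by (auto simp: less_Suc_eq)
        have I': "I (Suc k) (s(vA := (s vA)(0 := Suc k)))"
          using I unfolding I_def C1 by simp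
        \<comment> \<open>No level exceeded \<open>i\<close> before the pass, so a level
          \<open>Suc i\<close> met later certifies that the head was reached in this very
          pass.\<close>
        have ne: "s0 aLev (head W k) \<noteq> Suc i" using lev[OF h] by simp
        have eq: "s aLev (head W k) = s0 aLev (head W k)" if "s0 aLev (head W k) \<noteq> 0"
          using that L[OF h] lev0[of "head W k"] by auto
        have "\<not> (s0 aLev (tail W k) = i \<and> s0 aSide (head W k) = 0 \<and> s0 aCnt k < \<eta> \<and>
            s0 aLev (head W k) = 0)"
          using False k by (auto simp: C frontier_def)
        then consider "s0 aLev (tail W k) \<noteq> i" | "s0 aLev (tail W k) = i" "s0 aSide (head W k) \<noteq> 0"
          | "s0 aLev (tail W k) = i" "s0 aSide (head W k) = 0" "\<not> s0 aCnt k < \<eta>"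
          | "s0 aLev (tail W k) = i" "s0 aSide (head W k) = 0" "s0 aCnt k < \<eta>" "s0 aLev (head W k) \<noteq> 0"
          by metis
        then show ?thesis
        proof cases
          case 1
          then show ?thesis using b lt v vA I' by simp
        next
          case 2
          then show ?thesis using b lt v vA I' by simp
        next
          case 3
          then show ?thesis using b lt v vA I' by simp
        next
          case 4
          then show ?thesis using b lt v vA I' ne eq by simp
        qed
      qed
    qed
    subgoal using BB by simp
    subgoal using BB by simp
    subgoal unfolding I_def CE by auto
    done
qed

text \<open>The sweep that revealed the cut has already written level \<open>vLvl + 1\<close> into
  memory. The search tree before that sweep is therefore quantified existentially, and its reached
  vertices are those of positive level at most \<open>vLvl\<close>.\<close>

definition cut_found :: "nat \<Rightarrow> nat \<Rightarrow> memory \<Rightarrow> bool" where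
  "cut_found src dst s \<longleftrightarrow> s vLvl 0 \<le> d \<and> (\<forall>v<n. s aLev v \<le> Suc (s vLvl 0)) \<and>
     (\<exists>lev par. bfs (s aSide) (s aCnt) src (s vLvl 0) lev par (s vB 0) \<and> lev dst = 0 \<and>
       200 * card (frontier (s aSide) (s aCnt) (s vLvl 0) lev) \<le> s vB 0 \<and>
       200 * card (frontier (s aSide) (s aCnt) (s vLvl 0) lev) \<le> n - s vRem 0 - s vB 0 \<and>
       (\<forall>v<n. lev v \<noteq> 0 \<longleftrightarrow> s aLev v \<noteq> 0 \<and> s aLev v \<le> s vLvl 0))"

text \<open>The source has level 1, so the path has length \<open>vLvl - 1\<close>, at most
  \<open>d\<close>.\<close>

definition path_found :: "nat \<Rightarrow> nat \<Rightarrow> memory \<Rightarrow> bool" where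
  "path_found src dst s \<longleftrightarrow> s vLvl 0 \<le> Suc d \<and> 2 \<le> s vLvl 0 \<and> s aLev dst = s vLvl 0 \<and>
     bfs (s aSide) (s aCnt) src (s vLvl 0) (s aLev) (s aPar) (s vB 0)"

definition search_cost :: nat where
  "search_cost = 3 * n + 10 + d * (14 * E + 20)"

lemma wp_search:
  assumes st: "static s0" and so: "split_ok (s0 aSide) (s0 vRem 0) (s0 aCnt)"
    and cnt: "\<And>a. a < E \<Longrightarrow> s0 aCnt a \<le> \<eta>"
    and src: "s0 vSrc 0 = src" "src < n" "s0 aSide src = 0"
    and dst: "s0 vDst 0 = dst" "dst < n" "s0 aSide dst = 0" "dst \<noteq> src"
  shows "wp B search s0 (\<lambda>t s. t \<le> search_cost \<and>
     (s vFl 0 = 1 \<and> cut_found src dst s \<or> s vFl 0 = 2 \<and> path_found src dst s))"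
proof -
  note BB = B_bounds d_le
  have rem: "s0 vRem 0 \<le> n" using card_left_eq[OF so] by simp
  have side: "s0 aSide v \<le> 2" if "v < n" for v using so that by (auto simp: split_ok_def)
  define J where "J s \<longleftrightarrow>
      s vFl 0 = 0 \<and> s aLev dst = 0 \<and> bfs (s aSide) (s aCnt) src (s vLvl 0) (s aLev) (s aPar) (s vB 0) \<or>
      s vFl 0 = 1 \<and> cut_found src dst s \<or> s vFl 0 = 2 \<and> path_found src dst s" for s
  define \<Phi> where "\<Phi> s = (if s vFl 0 = 0 then (Suc d - s vLvl 0) * (14 * E + 20) else 0)" for s :: memory
  show ?thesis
    unfolding search_def
    apply (subst wp_Seq)
    apply (rule wp_use[OF wp_For[where I = "\<lambda>k s. \<forall>v<k. s aLev v = 0" and m = n and c = 1]])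
    subgoal by simp
    subgoal using st BB by (simp add: static_def)
    subgoal premises pre for k s
      using pre BB by (simp add: less_Suc_eq)
    subgoal using BB by simp
    subgoal using BB by simp
    subgoal premises pre for t1 s1
    proof -
      have fr: "s1 a = s0 a" if "a \<notin> {vA, aLev}" for a using pre(2)[of a] that by simp
      define s2 where "s2 = s1(aLev := (s1 aLev)(src := 1), vLvl := (s1 vLvl)(0 := 1),
         vB := (s1 vB)(0 := 1), vFl := (s1 vFl)(0 := 0))"
      have fr2: "s2 a = s0 a" if "a \<notin> {vA, aLev, vLvl, vB, vFl}" for a
        using that fr[of a] by (simp add: s2_def)
      have "bfs (s2 aSide) (s2 aCnt) src 1 (s2 aLev) (s2 aPar) 1"
        by (rule bfs_start) (use pre src in \<open>auto simp: s2_def fr\<close>)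
      then have J2: "J s2" using pre dst by (auto simp: J_def s2_def)
      have loop: "wp B search_loop s2
         (\<lambda>t s. J s \<and> val s (Sub (Const 1) (V vFl)) = 0 \<and> t \<le> Suc (\<Phi> s2))"
        unfolding search_loop_def
      proof (rule wp_While, goal_cases)
        case 1
        show ?case by (rule J2)
      next
        case (2 s)
        then show ?case using BB by (auto simp: J_def)
      next
        case (3 s)
        have fr3: "s a = s0 a" if "a \<notin> {vA, aLev, vLvl, vB, vFl, vCut, vNew, aPar}" for a
          using that fr2[of a] 3(2)[of a] by (simp add: sweep_def advance_def)
        define i where "i = s vLvl 0"
        define b where "b = s vB 0"
        define C where "C = frontier (s aSide) (s aCnt) i (s aLev)"
        have Fl: "s vFl 0 = 0" and lev0: "s aLev dst = 0"
          and bfs: "bfs (s0 aSide) (s0 aCnt) src i (s aLev) (s aPar) b"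
          using 3(1,3) by (auto simp: J_def i_def b_def fr3)
        have i: "1 \<le> i" using bfs by (simp add: bfs_def)
        \<comment> \<open>The destination is the unreached vertex to which \<open>bfs_bound\<close>
          applies; this is what limits the number of rounds.\<close>
        have id: "i \<le> d" using bfs_bound[OF bfs] dst lev0 by auto
        have st': "static s" by (rule static_cong[OF st]) (simp_all add: fr3)
        have C0: "C = frontier (s0 aSide) (s0 aCnt) i (s aLev)" by (simp add: C_def fr3)
        have levi: "s aLev v \<le> i" if "v < n" for v using bfs that by (auto simp: bfs_def)
        have bn: "b \<le> n" using card_mono[OF _ reached_subset[OF bfs]] bfs card_left[of "s0 aSide"]
          by (auto simp: bfs_def)
        have CE: "card C \<le> E" using card_mono[of "{..<E}" C] by (auto simp: C_def frontier_def)
        have CE': "card (head W ` C) \<le> E"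
          using card_image_le[of C "head W"] CE by (simp add: C_def)
        show ?case
        proof (subst wp_Seq, rule wp_use[OF wp_sweep[where i = i and C = C]], goal_cases)
          case (9 t' s')
          have fr4: "s' a = s a" if "a \<notin> {vA, aLev, vCut, vNew, aPar}" for a
            using that 9(2)[of a] by (simp add: sweep_def)
          have fr5: "s' a = s0 a" if "a \<notin> {vA, aLev, vLvl, vB, vFl, vCut, vNew, aPar}" for a
            using that fr4[of a] fr3[of a] by simp
          have vals: "s' vLvl 0 = i" "s' vB 0 = b" "s' vFl 0 = 0" "s' vN 0 = n" "s' vRem 0 = s0 vRem 0"
            "s' vDst 0 = dst" "s' vCut 0 = card C" "s' vNew 0 = card (head W ` C)"
            using 9(1) st dst Fl by (simp_all add: fr4 fr5 i_def b_def static_def) (simp_all add: fr3 static_def)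
          have lev': "s' aLev v = (if v \<in> head W ` C then Suc i else s aLev v)" if "v < n" for v
            using 9(1) that by blast
          have levB: "s' aLev v \<le> Suc i" if "v < n" for v using lev'[OF that] levi[OF that] by auto
          have ns: "bfs (s0 aSide) (s0 aCnt) src (Suc i) (s' aLev) (s' aPar) (b + card (head W ` C))"
            if "\<not> (200 * card C \<le> b \<and> 200 * card C \<le> n - s0 vRem 0 - b)"
            unfolding C0 by (rule bfs_step[OF bfs]) (use 9(1) that card_left_eq[OF so] in \<open>auto simp: C0\<close>)
          have t': "t' \<le> 14 * E + 4" using 9(1) by blast
          have \<Phi>: "\<Phi> s = Suc (d - i) * (14 * E + 20)" using Fl id by (simp add: \<Phi>_def Suc_diff_le flip: i_def)
          have adv: "wp B advance s' (\<lambda>t'' s''. t'' \<le> 4 \<and> J s'' \<and> (14 * E + 20) + \<Phi> s'' \<le> \<Phi> s)"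
            if "\<not> (200 * card C \<le> b \<and> 200 * card C \<le> n - s0 vRem 0 - b)"
          proof (cases "s' aLev dst = 0")
            case True
            then show ?thesis
              using ns[OF that] BB bn CE' id dst vals \<Phi>
              by (simp add: advance_def J_def fr5 \<Phi>_def)
          next
            case False
            then have "s' aLev dst = Suc i" using lev'[OF dst(2)] lev0 by (auto split: if_splits)
            then show ?thesis
              using ns[OF that] BB bn CE' id i dst vals \<Phi>
              by (simp add: advance_def J_def fr5 \<Phi>_def path_found_def)
          qed
          have adv': "wp B advance s' (\<lambda>t'' s''. J s'' \<and> Suc (t' + Suc t'') + \<Phi> s'' \<le> \<Phi> s)"
             "wp B advance s' (\<lambda>t'' s''. J s'' \<and> Suc (t' + Suc (Suc t'')) + \<Phi> s'' \<le> \<Phi> s)"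
            if "\<not> (200 * card C \<le> b \<and> 200 * card C \<le> n - s0 vRem 0 - b)"
            by (rule wp_mono[OF adv[OF that]]; use t' in linarith)+
          have cut: "J (s'(vFl := (s' vFl)(0 := Suc 0)))"
            if "200 * card C \<le> b" "200 * card C \<le> n - s0 vRem 0 - b"
          proof -
            have "(s aLev v \<noteq> 0) = (s' aLev v \<noteq> 0 \<and> s' aLev v \<le> i)" if v: "v < n" for v
            proof (cases "v \<in> head W ` C")
              case True
              then show ?thesis using lev'[OF v] by (auto simp: C_def frontier_def)
            next
              case False
              then show ?thesis using lev'[OF v] levi[OF v] by auto
            qed
            then have "bfs (s0 aSide) (s0 aCnt) src i (s aLev) (s aPar) b \<and> s aLev dst = 0 \<and>
                200 * card (frontier (s0 aSide) (s0 aCnt) i (s aLev)) \<le> b \<and>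
                200 * card (frontier (s0 aSide) (s0 aCnt) i (s aLev)) \<le> n - s0 vRem 0 - b \<and>
                (\<forall>v<n. s aLev v \<noteq> 0 \<longleftrightarrow> s' aLev v \<noteq> 0 \<and> s' aLev v \<le> i)"
              using that bfs lev0 C0 by simp
            then have "cut_found src dst (s'(vFl := (s' vFl)(0 := Suc 0)))"
              unfolding cut_found_def using vals id levB by (simp add: fr5) blast
            then show ?thesis by (simp add: J_def)
          qed
          have nb: "200 * card C - x < B" "n - x < B" for x using BB CE by (auto intro!: less_imp_diff_less)
          show ?case
            using adv' cut BB bn CE rem vals t' \<Phi>
            by (simp add: \<Phi>_def nb)
        qed (use st' side cnt levi i id BB in \<open>simp_all add: fr3 i_def[symmetric] C_def\<close>)
      qed
      have \<Phi>2: "\<Phi> s2 = d * (14 * E + 20)" by (simp add: \<Phi>_def s2_def)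
      have srcV: "s1 vSrc 0 = src" using src by (simp add: fr)
      show ?thesis
        apply (simp add: srcV)
        using BB src pre(1) apply simp
        unfolding s2_def[symmetric, simplified]
        apply (rule wp_mono[OF loop])
        using \<Phi>2 pre(1) apply (auto simp: J_def search_cost_def)
        done
    qed
    done
qed

end

section \<open>Recording a path, carving off a cut, and the main loop\<close>

definition route_loop :: program where
  "route_loop =
     While (V vJ)
       (Seq (Assign vJ (Sub (V vJ) (Const 1)))
       (Seq (Write aPath (Add (Mul (V vCur) (V vN)) (V vJ)) (Read aPar (V vX)))
       (Seq (Write aCnt (Read aPar (V vX)) (Add (Read aCnt (Read aPar (V vX))) (Const 1)))
            (Assign vX (Read aTl (Read aPar (V vX)))))))"

definition route :: program where
  "route =
     Seq (Write aLen (V vCur) (Sub (V vLvl) (Const 1)))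
     (Seq (Assign vX (V vDst)) (Seq (Assign vJ (Sub (V vLvl) (Const 1)))
     (Seq route_loop (Assign vCur (Add (V vCur) (Const 1))))))"

text \<open>After a replacement \<open>vJ\<close> stays put, since the fresh vertex can be a removed
  one and has to be tested as well. Every round advances \<open>vJ\<close> or \<open>vQ\<close>, so
  there are at most \<open>m + n\<close> rounds.\<close>

definition rehost_loop :: program where
  "rehost_loop =
     While (Sub (V vM) (V vJ))
       (If (Read aSide (Read aF (V vJ)))
         (Seq (Write aF (V vJ) (V vQ)) (Assign vQ (Add (V vQ) (Const 1))))
         (Assign vJ (Add (V vJ) (Const 1))))"

text \<open>The first condition is nonzero exactly if the reached side is at most as large as the
  unreached one. Vertices of level \<open>vLvl + 1\<close> count as unreached. The discarded paths
  are marked before the hosts change, because the old hosts tell which paths are lost.\<close>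

definition carve :: program where
  "carve =
     Seq (If (Sub (Add (Sub (V vN) (V vRem)) (Const 1)) (Mul (Const 2) (V vB)))
       (Seq (Assign vX (Const 1)) (Seq (Assign vY (Const 0)) (Assign vRem (Add (V vRem) (V vB)))))
       (Seq (Assign vX (Const 0)) (Seq (Assign vY (Const 2)) (Assign vRem (Sub (V vN) (V vB))))))
     (Seq (For vA (V vN)
       (If (Read aSide (V vA)) Skip
         (If (Read aLev (V vA))
           (If (Sub (Add (V vLvl) (Const 1)) (Read aLev (V vA)))
             (Write aSide (V vA) (V vX)) (Write aSide (V vA) (V vY)))
           (Write aSide (V vA) (V vY)))))
     (Seq (For vA (V vR)
       (If (Add (Read aSide (Read aF (Read aHT (V vA)))) (Read aSide (Read aF (Read aHH (V vA)))))
         (Write aLen (V vA) (Const 0)) Skip))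
     (Seq (Assign vJ (Const 0)) (Seq rehost_loop (Assign vCur (Const 0))))))"

definition main_body :: program where
  "main_body =
     If (Read aLen (V vCur)) (Assign vCur (Add (V vCur) (Const 1)))
       (Seq (Assign vSrc (Read aF (Read aHT (V vCur))))
       (Seq (Assign vDst (Read aF (Read aHH (V vCur))))
       (Seq search (If (Sub (Const 2) (V vFl)) carve route))))"

text \<open>The product serves as a conjunction: arcs remain to be routed, and fewer than
  \<open>n / 5\<close> vertices are removed.\<close>

definition main_loop :: program where
  "main_loop = While (Mul (Sub (V vR) (V vCur)) (Sub (V vN) (Mul (Const 5) (V vRem)))) main_body"

lemma writes_programs:
  "writes search = {vA, aLev, vLvl, vB, vFl, vCut, vNew, aPar}"
  "writes route_loop = {vJ, aPath, aCnt, vX}"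
  "writes route = {aLen, vX, vJ, aPath, aCnt, vCur}"
  "writes rehost_loop = {aF, vQ, vJ}"
  "writes carve = {vX, vY, vRem, vA, aSide, aLen, vJ, aF, vQ, vCur}"
  by (auto simp: search_def search_loop_def sweep_def advance_def route_def route_loop_def
      rehost_loop_def carve_def)

context router_machine
begin

lemma address_bound: "e < r \<Longrightarrow> j < n \<Longrightarrow> e * n + j < B" "e < r \<Longrightarrow> e * n < B"
proof -
  assume e: "e < r"
  then have "Suc e * n \<le> r * n" by (intro mult_le_mono1) simp
  moreover have "r * n \<le> (n + 10) * (r + 10)" by (simp add: algebra_simps)
  moreover have "20 * (n + 10) * (r + 10) = 20 * ((n + 10) * (r + 10))" by (rule mult.assoc)
  ultimately have *: "e * n + n < B" using B unfolding mult_Suc by linarith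
  then show "e * n < B" by simp
  assume "j < n"
  then show "e * n + j < B" using * by simp
qed

lemma wp_route:
  assumes st: "static s0" and pf: "path_found src dst s0" and dst: "dst < n" "s0 vDst 0 = dst"
    and cur: "s0 vCur 0 = cur" "cur < r" and cnt: "\<And>a. a < E \<Longrightarrow> s0 aCnt a \<le> \<eta>"
    and p: "p = trace (s0 aPar) (s0 vLvl 0 - 1) dst"
  shows "wp B route s0 (\<lambda>t s. t \<le> 5 * d + 10 \<and> s aLen = (s0 aLen)(cur := length p) \<and>
     (\<forall>j<length p. s aPath (cur * n + j) = p ! j) \<and>
     (\<forall>x. x \<notin> {cur * n..<cur * n + length p} \<longrightarrow> s aPath x = s0 aPath x) \<and>
     (\<forall>a<E. s aCnt a = s0 aCnt a + (if a \<in> set p then 1 else 0)) \<and> s vCur 0 = Suc cur)"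
proof -
  note BB = B_bounds d_le
  define k where "k = s0 vLvl 0 - 1"
  let ?par = "s0 aPar" and ?lev = "s0 aLev"
  have k: "s0 vLvl 0 = Suc k" "k \<le> d" "?lev dst = Suc k"
    using pf by (auto simp: k_def path_found_def)
  have bfs: "bfs (s0 aSide) (s0 aCnt) src (Suc k) ?lev ?par (s0 vB 0)"
    using pf k by (simp add: path_found_def)
  have p: "p = trace ?par k dst" using p k by simp
  have lp: "length p = k" by (simp add: p)
  have dp: "distinct p" and kn: "k < n" using trace_apath[OF bfs dst(1) k(3)] by (auto simp: p)
  have pE: "a < E" if "a \<in> set p" for a using trace_apath[OF bfs dst(1) k(3)] that by (auto simp: p)
  \<comment> \<open>Parent pointers deliver the path backwards: entries from index \<open>vJ\<close>
    on are stored, and the prefix still missing is the trace of the current vertex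
    \<open>vX\<close>. The counters are right because the arcs of \<open>p\<close> are
    distinct.\<close>
  define I where "I s \<longleftrightarrow> s vJ 0 \<le> k \<and> s vX 0 < n \<and> ?lev (s vX 0) = Suc (s vJ 0) \<and>
     trace ?par (s vJ 0) (s vX 0) = take (s vJ 0) p \<and>
     (\<forall>j<k. s vJ 0 \<le> j \<longrightarrow> s aPath (cur * n + j) = p ! j) \<and>
     (\<forall>x. x \<notin> {cur * n..<cur * n + k} \<longrightarrow> s aPath x = s0 aPath x) \<and>
     (\<forall>a<E. s aCnt a = s0 aCnt a + (if a \<in> set (drop (s vJ 0) p) then 1 else 0))" for s :: memory
  define s1 where "s1 = s0(aLen := (s0 aLen)(cur := k), vX := (s0 vX)(0 := dst), vJ := (s0 vJ)(0 := k))"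
  have I1: "I s1"
    using dst k by (auto simp: I_def s1_def p)
  have loop: "wp B route_loop s1 (\<lambda>t s. I s \<and> val s (V vJ) = 0 \<and> t \<le> Suc (5 * s1 vJ 0))"
    unfolding route_loop_def
  proof (rule wp_While[where \<Phi> = "\<lambda>s. 5 * s vJ 0"], goal_cases)
    case 1
    show ?case by (rule I1)
  next
    case (2 s)
    then show ?case using kn BB by (auto simp: I_def)
  next
    case (3 s)
    have fr: "s a = s0 a" if "a \<notin> {aLen, vX, vJ, aPath, aCnt}" for a
      using 3(2)[of a] that by (simp add: s1_def)
    obtain j where j: "s vJ 0 = Suc j" using 3(3) by (auto simp: gr0_conv_Suc)
    define x where "x = s vX 0"
    define a where "a = ?par x"
    have x: "x < n" "?lev x = Suc (Suc j)" and jk: "Suc j \<le> k" using 3(1) j by (auto simp: I_def x_def)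
    then have a: "a < E" "?lev (tail W a) = Suc j"
      using bfs by (auto simp: bfs_def a_def)
    have tr: "trace ?par (Suc j) x = take (Suc j) p" using 3(1) j by (simp add: I_def x_def)
    then have pj: "p ! j = a" and tr': "trace ?par j (tail W a) = take j p"
      using jk lp by (auto simp: a_def take_Suc_conv_app_nth)
    have dr: "drop j p = a # drop (Suc j) p" using pj jk lp by (metis Cons_nth_drop_Suc Suc_le_eq)
    have nin: "a \<notin> set (drop (Suc j) p)" using dp dr by (metis distinct.simps(2) distinct_drop)
    have cnta: "s aCnt a = s0 aCnt a"
      using 3(1) a nin j by (auto simp: I_def)
    have v: "s vCur 0 = cur" "s vN 0 = n" "s aPar x = a" "s aTl a = tail W a" "s aPar = ?par"
      using cur st a by (simp_all add: fr a_def static_def)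
    have J: "\<forall>j'<k. j \<le> j' \<longrightarrow> j' \<noteq> j \<longrightarrow> s aPath (cur * n + j') = p ! j'"
      "\<forall>y. y \<notin> {cur * n..<cur * n + k} \<longrightarrow> s aPath y = s0 aPath y"
      "\<forall>b<E. s aCnt b = s0 aCnt b + (if b \<in> set (drop (Suc j) p) then 1 else 0)"
      using 3(1) j by (auto simp: I_def)
    have bd: "cur * n + j < B" "cur * n < B" "cur < B" "j < B" "a < B" "n < B" "Suc j < B" "Suc (s0 aCnt a) < B"
      "s0 aCnt a < B" "x < B" "tail W a < B" "0 < B" "Suc 0 < B"
      using address_bound(1)[OF cur(2), of j] address_bound(2)[OF cur(2)] cur a x jk kn BB cnt[OF a(1)] ends_W(1)[OF a(1)] by auto
    have x': "s vX 0 = x" by (simp add: x_def)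
    show ?case
      using bd v x' j cnta ends_W(1)[OF a(1)] a
      apply simp
      unfolding I_def
      using J tr' pj dr nin jk cnta a by simp
  qed
  have "wp B (Seq route_loop (Assign vCur (Add (V vCur) (Const 1)))) s1
     (\<lambda>t s. t \<le> 5 * d + 2 \<and> s aLen = (s0 aLen)(cur := length p) \<and>
     (\<forall>j<length p. s aPath (cur * n + j) = p ! j) \<and>
     (\<forall>x. x \<notin> {cur * n..<cur * n + length p} \<longrightarrow> s aPath x = s0 aPath x) \<and>
     (\<forall>a<E. s aCnt a = s0 aCnt a + (if a \<in> set p then 1 else 0)) \<and> s vCur 0 = Suc cur)"
    apply (subst wp_Seq)
    apply (rule wp_use[OF loop])
    subgoal premises pre for t s
    proof -
      have "s vCur 0 = cur" "s aLen = (s0 aLen)(cur := k)"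
        using pre(2)[of vCur] pre(2)[of aLen] cur by (simp_all add: writes_programs s1_def)
      moreover have "t \<le> Suc (5 * k)" using pre(1) by (simp add: s1_def)
      ultimately show ?thesis
        using pre(1) cur BB lp k by (auto simp: I_def)
    qed
    done
  then show ?thesis
    unfolding route_def
    using st cur dst k BB kn address_bound(2)[OF cur(2)]
    apply (simp only: wp_Seq[of B "Assign x y" for x y] wp_Seq[of B "Write x y z" for x y z] wp_Write s1_def)
    apply (simp add: static_def del: wp_Seq)
    apply (erule wp_mono)
    apply simp
    done
qed

lemma wp_rehost:
  assumes st: "static s0" and h: "hosted (s0 aF) (s0 vQ 0) side" and side: "side = s0 aSide"
    and so: "split_ok side rem cnt" and J: "s0 vJ 0 = 0"
  shows "wp B rehost_loop s0 (\<lambda>t s. t \<le> 8 * n + 1 \<and> hosted (s aF) (s vQ 0) side \<and>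
     (\<forall>h<m. side (s aF h) = 0) \<and> (\<forall>h<m. side (s0 aF h) = 0 \<longrightarrow> s aF h = s0 aF h))"
proof -
  note BB = B_bounds m_bounds
  define I where "I s \<longleftrightarrow> hosted (s aF) (s vQ 0) side \<and> s vJ 0 \<le> m \<and>
     (\<forall>h<s vJ 0. side (s aF h) = 0) \<and> (\<forall>h<m. side (s0 aF h) = 0 \<longrightarrow> s aF h = s0 aF h)" for s :: memory
  have loop: "wp B rehost_loop s0 (\<lambda>t s. I s \<and> val s (Sub (V vM) (V vJ)) = 0 \<and>
      t \<le> Suc (4 * ((m - s0 vJ 0) + (n - s0 vQ 0))))"
    unfolding rehost_loop_def
  proof (rule wp_While[where \<Phi> = "\<lambda>s. 4 * ((m - s vJ 0) + (n - s vQ 0))"], goal_cases)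
    case 1
    show ?case using h J by (simp add: I_def)
  next
    case (2 s)
    then show ?case using BB st by (auto simp: I_def static_def)
  next
    case (3 s)
    have fr: "s a = s0 a" if "a \<notin> {aF, vQ, vJ}" for a
      using 3(2)[of a] that by simp
    have vM: "s vM 0 = m" "s aSide = side" using st by (simp_all add: static_def fr side)
    define j where "j = s vJ 0"
    have j: "j < m" "s vJ 0 = j" using 3(3) vM by (auto simp: j_def)
    have hs: "hosted (s aF) (s vQ 0) side" using 3(1) by (simp add: I_def)
    have q: "s vQ 0 \<le> n" "s aF j < s vQ 0" using hs j by (auto simp: hosted_def)
    have s2: "side (s aF j) \<le> 2" using so q by (auto simp: split_ok_def)
    show ?case
    proof (cases "side (s aF j) = 0")
      case True
      then show ?thesis
        using 3(1) j q BB vM s2 by (auto simp: I_def less_Suc_eq)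
    next
      case False
      note R = rehost_step[OF hs so j(1) False]
      have ne: "side (s0 aF j) \<noteq> 0" using 3(1) False j(1) by (auto simp: I_def)
      have "I (s(aF := (s aF)(j := s vQ 0), vQ := (s vQ)(0 := Suc (s vQ 0))))"
        using 3(1) R(2) j ne by (auto simp: I_def)
      then show ?thesis
        using False R(1) j q BB vM s2 by simp
    qed
  qed
  show ?thesis
  proof (rule wp_use[OF loop], goal_cases)
    case (1 t s)
    have "s vM 0 = m" using 1(2)[of vM] st by (simp add: writes_programs static_def)
    then show ?case using 1(1) BB by (auto simp: I_def)
  qed
qed

definition invs :: "memory \<Rightarrow> bool" where
  "invs s \<longleftrightarrow> inv (s aF) (s vQ 0) (s aSide) (s vRem 0) (s aLen) (s aPath) (s aCnt) (s vCur 0)"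

definition carve_cost :: nat where
  "carve_cost = 20 * n + 4 * r + 20"

lemma wp_carve:
  assumes st: "static s0" and inv: "invs s0" and rem: "5 * s0 vRem 0 < n"
    and cf: "cut_found src dst s0" and dst: "dst < n" "s0 aSide dst = 0"
  shows "wp B carve s0 (\<lambda>t s. t \<le> carve_cost \<and> invs s \<and> s0 vRem 0 < s vRem 0 \<and>
     unrouted (s aLen) \<le> unrouted (s0 aLen) + 18 * (s vRem 0 - s0 vRem 0))"
proof -
  note BB = B_bounds m_bounds d_le
  define i where "i = s0 vLvl 0"
  define b where "b = s0 vB 0"
  define u where "u = n - s0 vRem 0 - b"
  define x where "x = (if b \<le> u then 1 else 0 :: nat)"
  define y where "y = (if b \<le> u then 0 else 2 :: nat)"
  define rem' where "rem' = s0 vRem 0 + (if b \<le> u then b else u)"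
  obtain lev par where bfs: "bfs (s0 aSide) (s0 aCnt) src i lev par b" and lev0: "lev dst = 0"
    and sp: "200 * card (frontier (s0 aSide) (s0 aCnt) i lev) \<le> b"
      "200 * card (frontier (s0 aSide) (s0 aCnt) i lev) \<le> u"
    and lev: "\<And>v. v < n \<Longrightarrow> lev v \<noteq> 0 \<longleftrightarrow> s0 aLev v \<noteq> 0 \<and> s0 aLev v \<le> i"
    and i: "i \<le> d" "\<And>v. v < n \<Longrightarrow> s0 aLev v \<le> Suc i"
    using cf unfolding cut_found_def i_def b_def u_def by blast
  have inv': "inv (s0 aF) (s0 vQ 0) (s0 aSide) (s0 vRem 0) (s0 aLen) (s0 aPath) (s0 aCnt) (s0 vCur 0)"
    using inv by (simp add: invs_def)
  then have so: "split_ok (s0 aSide) (s0 vRem 0) (s0 aCnt)" by (simp add: inv_def)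
  have bn: "s0 vRem 0 + b \<le> n"
    using card_mono[OF _ reached_subset[OF bfs]] bfs card_left_eq[OF so] by (auto simp: bfs_def)
  have side2: "s0 aSide v \<le> 2" if "v < n" for v using so that by (auto simp: split_ok_def)
  define side' where "side' v = (if s0 aSide v \<noteq> 0 then s0 aSide v else if lev v \<noteq> 0 then x else y)" for v
  have xy: "b \<le> n - s0 vRem 0 - b \<and> x = 1 \<and> y = 0 \<and> rem' = s0 vRem 0 + b \<or>
       n - s0 vRem 0 - b < b \<and> x = 0 \<and> y = 2 \<and> rem' = s0 vRem 0 + (n - s0 vRem 0 - b)"
    by (auto simp: x_def y_def rem'_def u_def)
  note cut = inv_cut[OF inv' rem bfs dst lev0 sp[unfolded u_def] xy]
  have xy2: "x \<le> 2" "y \<le> 2" by (auto simp: x_def y_def)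
  have f: "s0 aF h < n" if "h < m" for h
    using inv' that by (auto simp: inv_def hosted_def intro: less_le_trans)
  have fB: "s0 aF h < B" if "h < m" for h using f[OF that] BB by simp
  have q: "s0 vQ 0 \<le> n" using inv' by (auto simp: inv_def hosted_def)
  define s1 where "s1 = s0(vX := (s0 vX)(0 := x), vY := (s0 vY)(0 := y), vRem := (s0 vRem)(0 := rem'))"
  have N: "s0 vN 0 = n" using st by (simp add: static_def)
  have start: "wp B (If (Sub (Add (Sub (V vN) (V vRem)) (Const 1)) (Mul (Const 2) (V vB)))
       (Seq (Assign vX (Const 1)) (Seq (Assign vY (Const 0)) (Assign vRem (Add (V vRem) (V vB)))))
       (Seq (Assign vX (Const 0)) (Seq (Assign vY (Const 2)) (Assign vRem (Sub (V vN) (V vB)))))) s0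
     (\<lambda>t s. t = 4 \<and> s = s1)"
  proof -
    have "n - b = s0 vRem 0 + u" using bn by (simp add: u_def)
    moreover have "Suc (n - s0 vRem 0) - 2 * b \<noteq> 0 \<longleftrightarrow> b \<le> u" using bn by (auto simp: u_def)
    moreover have "Suc (n - z) < B" "n - z < B" "Suc n - z < B" for z using BB by auto
    moreover have "b < B" "s0 vRem 0 < B" "2 * b < B" "s0 vRem 0 + b < B" "n < B" "Suc (n - s0 vRem 0) - 2 * b < B"
      using BB bn by auto
    ultimately show ?thesis
      using N BB by (auto simp: s1_def x_def y_def rem'_def b_def[symmetric])
  qed
  have st1: "static s1" by (rule static_cong[OF st]) (simp_all add: s1_def)
  show ?thesis
    unfolding carve_def
    apply (subst wp_Seq)
    apply (rule wp_mono[OF start])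
    apply (erule conjE, hypsubst)
    apply (subst wp_Seq)
    apply (rule wp_use[OF wp_For[where m = n and c = 4 and
        I = "\<lambda>k s. \<forall>v<n. s aSide v = (if v < k then side' v else s0 aSide v)"]])
    subgoal by (simp add: s1_def)
    subgoal using st1 BB by (simp add: static_def)
    subgoal premises pre for t s k s'
    proof -
      have fr: "s' a = s1 a" if "a \<notin> {vA, aSide}" for a using pre(4)[of a] that by simp
      have "s' aSide k = s0 aSide k" using pre by simp
      moreover have "s' aLev k = s0 aLev k" "s' vLvl 0 = i" "s' vX 0 = x" "s' vY 0 = y"
        by (simp_all add: fr s1_def i_def)
      moreover have "s0 aSide k < B" "s0 aLev k < B" "k < B" "Suc i < B" "x < B" "y < B" "Suc i - s0 aLev k < B" "i < B"
        using side2[OF pre(1)] i(1) pre(1) BB i(2)[OF pre(1)] xy2 by auto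
      ultimately show ?thesis
        using pre(1-3) BB lev[OF pre(1)] by (auto simp: side'_def less_Suc_eq)
    qed
    subgoal using BB by simp
    subgoal using BB by simp
    apply (subst wp_Seq)
    subgoal premises pre for t s t1 s2
    proof -
      have fr2: "s2 a = s1 a" if "a \<notin> {vA, aSide}" for a using pre(2)[of a] that by simp
      have side2': "s2 aSide v = side' v" if "v < n" for v using pre(1) that by simp
      note cut = cut[of "s2 aSide"]
      have e2: "s2 aSide v = (if s0 aSide v \<noteq> 0 then s0 aSide v else if lev v \<noteq> 0 then x else y)" if "v < n" for v
        using side2'[OF that] by (simp add: side'_def)
      note cut = cut[OF e2]
      have st2: "static s2" by (rule static_cong[OF st1]) (simp_all add: fr2)
      have s2le: "s2 aSide v \<le> 2" if "v < n" for v using cut(1) that by (auto simp: split_ok_def)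
      have F2: "s2 aF = s0 aF" by (simp add: fr2 s1_def)
      let ?J = "\<lambda>k s. \<forall>e<r. s aLen e =
        (if e < k \<and> s2 aSide (s0 aF (ht e)) + s2 aSide (s0 aF (hh e)) \<noteq> 0 then 0 else s0 aLen e)"
      show ?thesis
        apply (rule wp_use[OF wp_For[where m = r and c = 2 and I = ?J]])
        subgoal by (simp add: fr2 s1_def)
        subgoal using st2 BB by (simp add: static_def)
        subgoal premises pre3 for k s'
        proof -
          have fr: "s' a = s2 a" if "a \<notin> {vA, aLen}" for a using pre3(4)[of a] that by simp
          have v: "s' aF = s0 aF" "s' aSide = s2 aSide" "s' aHT k = ht k" "s' aHH k = hh k"
            using st2 pre3(1) by (simp_all add: fr F2 static_def)
          have "ht k < B" "hh k < B" "k < B" "s2 aSide (s0 aF (ht k)) + s2 aSide (s0 aF (hh k)) < B"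
            "s2 aSide (s0 aF (ht k)) < B" "s2 aSide (s0 aF (hh k)) < B" "s0 aF (ht k) < B" "s0 aF (hh k) < B"
            using ends[OF pre3(1)] pre3(1) BB f[of "ht k"] f[of "hh k"] s2le[of "s0 aF (ht k)"] s2le[of "s0 aF (hh k)"]
            by auto
          then show ?thesis using pre3(1-3) BB v by (auto simp: less_Suc_eq)
        qed
        subgoal using BB by simp
        subgoal using BB by simp
        subgoal premises pre3 for t3 s3
        proof -
          have fr3: "s3 a = s2 a" if "a \<notin> {vA, aLen}" for a using pre3(2)[of a] that by simp
          define s4 where "s4 = s3(vJ := (s3 vJ)(0 := 0))"
          have st4: "static s4" by (rule static_cong[OF st2]) (simp_all add: fr3 s4_def)
          have h4: "hosted (s4 aF) (s4 vQ 0) (s2 aSide)"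
            using cut(3) by (simp add: s4_def fr3 fr2 s1_def)
          have loop: "wp B rehost_loop s4 (\<lambda>t s. t \<le> 8 * n + 1 \<and> hosted (s aF) (s vQ 0) (s2 aSide) \<and>
             (\<forall>h<m. s2 aSide (s aF h) = 0) \<and> (\<forall>h<m. s2 aSide (s4 aF h) = 0 \<longrightarrow> s aF h = s4 aF h))"
            by (rule wp_rehost[OF st4 h4 _ cut(1)]) (simp_all add: s4_def fr3)
          have "wp B (Seq rehost_loop (Assign vCur (Const 0))) s4
             (\<lambda>t s. t \<le> 8 * n + 2 \<and> invs s \<and> s0 vRem 0 < s vRem 0 \<and>
               unrouted (s aLen) \<le> unrouted (s0 aLen) + 18 * (s vRem 0 - s0 vRem 0))"
            apply (subst wp_Seq)
            apply (rule wp_use[OF loop])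
            subgoal premises pre5 for t5 s5
            proof -
              have fr5: "s5 a = s4 a" if "a \<notin> {aF, vQ, vJ}" for a
                using pre5(2)[of a] that by (simp add: writes_programs)
              have "s4 aF = s0 aF" by (simp add: s4_def fr3 F2)
              then have I: "inv (s5 aF) (s5 vQ 0) (s2 aSide) rem' (s5 aLen) (s0 aPath) (s0 aCnt) 0 \<and>
                  unrouted (s5 aLen) \<le> unrouted (s0 aLen) + 18 * (rem' - s0 vRem 0)"
                by (intro cut(4)) (use pre5(1) pre3(1) in \<open>simp_all add: fr5 s4_def\<close>)
              have "s5 aSide = s2 aSide" "s5 aPath = s0 aPath" "s5 aCnt = s0 aCnt" "s5 vRem 0 = rem'"
                by (simp_all add: fr5 s4_def fr3 fr2 s1_def)
              then show ?thesis
                using I cut(2) pre5(1) BB by (simp add: invs_def)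
            qed
            done
          then show ?thesis
            using BB pre pre3(1)
            apply (simp only: wp_Seq[of B "Assign vJ (Const 0)"] wp_Write s4_def)
            apply (simp del: wp_Seq)
            apply (erule wp_mono)
            apply (simp add: carve_cost_def)
            done
        qed
        done
    qed
    done
qed

definition iter_cost :: nat where
  "iter_cost = search_cost + carve_cost + 5 * d + 20"

text \<open>The first part pays 3 steps for each skipped arc that already has a path; a cut resets
  \<open>vCur\<close> to 0, so each removed vertex brings along \<open>r\<close> such skips. The
  second part pays for searches: routing lowers \<open>unrouted\<close> by one, while removing
  \<open>k\<close> vertices raises it by at most \<open>18 * k\<close> and releases
  \<open>19 * k\<close>, which leaves at least one unit.\<close>

definition potential :: "memory \<Rightarrow> nat" where
  "potential s = 3 * ((r - s vCur 0) + r * (n - s vRem 0)) +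
     iter_cost * (unrouted (s aLen) + 19 * (n - s vRem 0))"

lemma wp_main_body:
  assumes st: "static s0" and inv: "invs s0" and rem: "5 * s0 vRem 0 < n" and cur: "s0 vCur 0 < r"
  shows "wp B main_body s0 (\<lambda>t s. invs s \<and> Suc t + potential s \<le> potential s0)"
proof -
  note BB = B_bounds m_bounds d_le
  define e where "e = s0 vCur 0"
  have inv': "inv (s0 aF) (s0 vQ 0) (s0 aSide) (s0 vRem 0) (s0 aLen) (s0 aPath) (s0 aCnt) e"
    using inv by (simp add: invs_def e_def)
  then have so: "split_ok (s0 aSide) (s0 vRem 0) (s0 aCnt)" and po: "paths_ok (s0 aF) (s0 aLen) (s0 aPath) (s0 aCnt)"
    and h: "hosted (s0 aF) (s0 vQ 0) (s0 aSide)" and f0: "\<And>h. h < m \<Longrightarrow> s0 aSide (s0 aF h) = 0"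
    by (auto simp: inv_def)
  have er: "e < r" using cur by (simp add: e_def)
  have rB: "r < B" using BB by simp
  have len: "s0 aLen e < n" by (rule paths_short[OF po er])
  have f: "s0 aF h < n" if "h < m" for h
    using h that by (auto simp: hosted_def intro: less_le_trans)
  have cnt: "s0 aCnt a \<le> \<eta>" if "a < E" for a using po that by (auto simp: paths_ok_def)
  show ?thesis
  proof (cases "s0 aLen e = 0")
    case False
    have "inv (s0 aF) (s0 vQ 0) (s0 aSide) (s0 vRem 0) (s0 aLen) (s0 aPath) (s0 aCnt) (Suc e)"
      using inv' er False by (auto simp: inv_def less_Suc_eq)
    moreover have "Suc (r - Suc e) = r - e" using er by simp
    ultimately show ?thesis
      using False er rB len BB by (simp add: main_body_def e_def[symmetric] invs_def potential_def)
  next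
    case True
    define src where "src = s0 aF (ht e)"
    define dst where "dst = s0 aF (hh e)"
    define s1 where "s1 = s0(vSrc := (s0 vSrc)(0 := src), vDst := (s0 vDst)(0 := dst))"
    have fr1: "s1 a = s0 a" if "a \<notin> {vSrc, vDst}" for a using that by (simp add: s1_def)
    have sd: "src < n" "dst < n" "s0 aSide src = 0" "s0 aSide dst = 0" "dst \<noteq> src"
      using f f0 ends[OF er] h by (auto simp: src_def dst_def hosted_def inj_on_def)
    have st1: "static s1" by (rule static_cong[OF st]) (simp_all add: fr1)
    have srch: "wp B search s1 (\<lambda>t s. t \<le> search_cost \<and>
       (s vFl 0 = 1 \<and> cut_found src dst s \<or> s vFl 0 = 2 \<and> path_found src dst s))"
      by (rule wp_search[OF st1]) (use so cnt sd in \<open>simp_all add: fr1\<close>, simp_all add: s1_def)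
    have rest: "wp B (Seq search (If (Sub (Const 2) (V vFl)) carve route)) s1
       (\<lambda>t s. invs s \<and> t + 4 + potential s \<le> potential s0)"
      apply (subst wp_Seq)
      apply (rule wp_use[OF srch])
      subgoal premises pre for t2 s2
      proof -
        have fr2: "s2 a = s1 a" if "a \<notin> {vA, aLev, vLvl, vB, vFl, vCut, vNew, aPar}" for a
          using pre(2)[of a] that by (simp add: writes_programs)
        have st2: "static s2" by (rule static_cong[OF st1]) (simp_all add: fr2)
        have same: "s2 aF = s0 aF" "s2 vQ = s0 vQ" "s2 aSide = s0 aSide" "s2 vRem = s0 vRem" "s2 aLen = s0 aLen"
          "s2 aPath = s0 aPath" "s2 aCnt = s0 aCnt" "s2 vCur = s0 vCur" "s2 vDst 0 = dst"
          by (simp_all add: fr2 fr1) (simp add: s1_def)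
        have inv2: "invs s2" using inv by (simp add: invs_def same)
        from pre(1) have t2: "t2 \<le> search_cost" and
          or: "s2 vFl 0 = 1 \<and> cut_found src dst s2 \<or> s2 vFl 0 = 2 \<and> path_found src dst s2" by auto
        from or show ?thesis
        proof (elim disjE conjE)
          assume Fl: "s2 vFl 0 = 1" and cf: "cut_found src dst s2"
          have "wp B carve s2 (\<lambda>t s. t \<le> carve_cost \<and> invs s \<and> s2 vRem 0 < s vRem 0 \<and>
             unrouted (s aLen) \<le> unrouted (s2 aLen) + 18 * (s vRem 0 - s2 vRem 0))"
            by (rule wp_carve[OF st2 inv2 _ cf]) (use rem sd same in auto)
          then have "wp B carve s2 (\<lambda>t s. invs s \<and> t2 + Suc t + 4 + potential s \<le> potential s0)"
          proof (rule wp_mono, elim conjE, intro conjI)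
            fix t s assume t: "t \<le> carve_cost" and inv_s: "invs s" and less: "s2 vRem 0 < s vRem 0"
              and un: "unrouted (s aLen) \<le> unrouted (s2 aLen) + 18 * (s vRem 0 - s2 vRem 0)"
            have le: "s vRem 0 \<le> n"
              using inv_s card_left_eq(2) by (auto simp: invs_def inv_def)
            obtain k where k: "s vRem 0 = s0 vRem 0 + Suc k"
              using less_imp_Suc_add[OF less] same by auto
            have le_unr: "unrouted (s aLen) + 19 * (n - s vRem 0) + 1 \<le> unrouted (s0 aLen) + 19 * (n - s0 vRem 0)"
              using un k le same by simp
            have sum_le: "c + (3 * x' + p') \<le> 3 * x + p" if "i + p' \<le> p" "x' \<le> x" "c \<le> i"
              for c x x' p p' i :: nat using that by linarith
            from le_unr have "iter_cost * (unrouted (s aLen) + 19 * (n - s vRem 0) + 1) \<le>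
                iter_cost * (unrouted (s0 aLen) + 19 * (n - s0 vRem 0))"
              by (rule mult_le_mono2)
            then have "iter_cost + iter_cost * (unrouted (s aLen) + 19 * (n - s vRem 0)) \<le>
                iter_cost * (unrouted (s0 aLen) + 19 * (n - s0 vRem 0))" by simp
            moreover have "(r - s vCur 0) + r * (n - s vRem 0) \<le> (r - e) + r * (n - s0 vRem 0)"
            proof -
              have "r * Suc (n - s vRem 0) \<le> r * (n - s0 vRem 0)"
                using k le by (intro mult_le_mono2) simp
              then show ?thesis by simp
            qed
            moreover have "t2 + Suc t + 4 \<le> iter_cost" using t t2 by (simp add: iter_cost_def)
            ultimately show "t2 + Suc t + 4 + potential s \<le> potential s0"
              unfolding potential_def e_def[symmetric] by (rule sum_le)
          qed
          then show ?thesis using Fl BB by (simp add: ac_simps)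
        next
          assume Fl: "s2 vFl 0 = 2" and pf: "path_found src dst s2"
          define k where "k = s2 vLvl 0 - 1"
          have bfs: "bfs (s2 aSide) (s2 aCnt) src (Suc k) (s2 aLev) (s2 aPar) (s2 vB 0)"
            and lev: "s2 aLev dst = Suc k" and kd: "k \<le> d"
            using pf by (auto simp: path_found_def k_def)
          let ?p = "trace (s2 aPar) k dst"
          note tp = trace_apath[OF bfs sd(2) lev]
          have "wp B route s2 (\<lambda>t s. t \<le> 5 * d + 10 \<and> s aLen = (s2 aLen)(e := length ?p) \<and>
             (\<forall>j<length ?p. s aPath (e * n + j) = ?p ! j) \<and>
             (\<forall>x. x \<notin> {e * n..<e * n + length ?p} \<longrightarrow> s aPath x = s2 aPath x) \<and>
             (\<forall>a<E. s aCnt a = s2 aCnt a + (if a \<in> set ?p then 1 else 0)) \<and> s vCur 0 = Suc e)"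
            by (rule wp_route[OF st2 pf sd(2)]) (use same er cnt in \<open>simp_all add: e_def k_def\<close>)
          then have "wp B route s2 (\<lambda>t s. invs s \<and> t2 + Suc t + 4 + potential s \<le> potential s0)"
          proof (rule wp_use, goal_cases)
            case (1 t s)
            have fr3: "s a = s2 a" if "a \<notin> {aLen, vX, vJ, aPath, aCnt, vCur}" for a
              using 1(2)[of a] that by (simp add: writes_programs)
            have s: "s aF = s0 aF" "s vQ = s0 vQ" "s aSide = s0 aSide" "s vRem = s0 vRem"
              by (simp_all add: fr3 same)
            have other: "s aPath (e' * n + j) = s0 aPath (e' * n + j)" if "e' \<noteq> e" "j < n" for e' j
            proof -
              have "e' * n + j \<notin> {e * n..<e * n + k}"
              proof (cases "e' < e")
                case True
                then have "Suc e' * n \<le> e * n" by (intro mult_le_mono1) simp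
                then show ?thesis using that by simp
              next
                case False
                then have "Suc e * n \<le> e' * n" using that by (intro mult_le_mono1) simp
                then show ?thesis using tp(4) by simp
              qed
              then show ?thesis using 1(1) same by simp
            qed
            have R: "inv (s0 aF) (s0 vQ 0) (s0 aSide) (s0 vRem 0) (s aLen) (s aPath) (s aCnt) (Suc e)"
              "unrouted (s0 aLen) = Suc (unrouted (s aLen))"
              using inv_route[OF inv' er True, of ?p "s aLen" "s aPath" "s aCnt"] tp kd other 1(1)
              by (simp_all add: same src_def dst_def)
            have "r - Suc e \<le> r - e" by simp
            then show ?case
              using R 1(1) t2 s by (simp add: invs_def potential_def e_def[symmetric] iter_cost_def)
          qed
          then show ?thesis using Fl BB by (simp add: ac_simps)
        qed
      qed
      done
    show ?thesis
      unfolding main_body_def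
      using rest True er st BB rB ends[OF er] f[of "ht e"] f[of "hh e"]
      apply (simp only: wp_If wp_Seq[of B "Assign x y" for x y] wp_Write s1_def)
      apply (simp add: static_def src_def dst_def e_def[symmetric] del: wp_Seq)
      apply (erule wp_mono)
      apply simp
      done
  qed
qed

lemma wp_main_loop:
  assumes st: "static s0" and inv: "invs s0"
  shows "wp B main_loop s0 (\<lambda>t s. t \<le> Suc (potential s0) \<and> invs s \<and> (s vCur 0 = r \<or> n \<le> 5 * s vRem 0))"
proof -
  note BB = B_bounds m_bounds d_le
  have w: "static s" if "\<And>a. a \<notin> writes main_body \<Longrightarrow> s a = s0 a" for s
    by (rule static_cong[OF st]; rule that) (simp_all add: main_body_def writes_programs)
  have bounds: "s vRem 0 \<le> n \<and> s vCur 0 \<le> r" if "invs s" for s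
    using that card_left_eq(2) by (auto simp: invs_def inv_def)
  have "wp B main_loop s0 (\<lambda>t s. invs s \<and>
      val s (Mul (Sub (V vR) (V vCur)) (Sub (V vN) (Mul (Const 5) (V vRem)))) = 0 \<and> t \<le> Suc (potential s0))"
    unfolding main_loop_def
  proof (rule wp_While, goal_cases)
    case 1
    show ?case by (rule inv)
  next
    case (2 s)
    have "(r - s vCur 0) * (n - 5 * s vRem 0) \<le> r * n" by (intro mult_le_mono) auto
    moreover have "r * n \<le> 20 * (n + 10) * (r + 10)" by (simp add: algebra_simps)
    ultimately have "(r - s vCur 0) * (n - 5 * s vRem 0) < B" using B by linarith
    then show ?case
      using w[OF 2(2)] bounds[OF 2(1)] BB by (auto simp: static_def intro: less_imp_diff_less)
  next
    case (3 s)
    then show ?case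
      using w[OF 3(2)] by (intro wp_main_body) (auto simp: static_def)
  qed
  then show ?thesis
  proof (rule wp_use, goal_cases)
    case (1 t s)
    have "static s" by (rule w) (use 1(2) in \<open>simp add: main_loop_def\<close>)
    then show ?case using 1(1) bounds[of s] by (auto simp: static_def)
  qed
qed

end

section \<open>Output\<close>

definition Emit :: "expr \<Rightarrow> program" where
  "Emit e = Seq (Write 1 (V vPos) e) (Assign vPos (Add (V vPos) (Const 1)))"

definition printed :: "memory \<Rightarrow> nat list \<Rightarrow> bool" where
  "printed s xs \<longleftrightarrow> s vPos 0 = length xs \<and> (\<forall>i<length xs. s 1 i = xs ! i)"

lemma writes_Emit [simp]: "writes (Emit e) = {1, vPos}"
  by (auto simp: Emit_def)

lemma wp_Emit:
  assumes "printed s xs" "fits B s e" "Suc (length xs) < B"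
  shows "wp B (Emit e) s (\<lambda>t s'. t = 2 \<and> printed s' (xs @ [val s e]))"
  using assms by (auto simp: Emit_def printed_def nth_append less_Suc_eq)

lemma printed_other [simp]: "a \<noteq> 1 \<Longrightarrow> a \<noteq> vPos \<Longrightarrow> printed (s(a := f)) xs = printed s xs"
  by (simp add: printed_def)

text \<open>Membership in the printed side of the cut is first stored in \<open>aLev\<close>.\<close>

definition mark_side :: program where
  "mark_side =
     Seq (Assign vX (Const 0))
     (Seq (For vA (V vN) (Assign vX (Add (V vX) (Eq (Read aSide (V vA)) (Const 1)))))
     (Seq (For vA (V vN)
       (If (Sub (Add (Mul (Const 2) (V vX)) (Const 1)) (V vRem))
         (Write aLev (V vA) (Eq (Read aSide (V vA)) (Const 1)))
         (Write aLev (V vA) (Sub (Const 1) (Eq (Read aSide (V vA)) (Const 2))))))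
     (Seq (Assign vY (Const 0))
          (For vA (V vN) (Assign vY (Add (V vY) (Read aLev (V vA))))))))"

definition print_cut :: program where
  "print_cut =
     Seq mark_side (Seq (Emit (Const 1)) (Seq (Emit (V vY))
     (Seq (For vA (V vN) (If (Read aLev (V vA)) (Emit (V vA)) Skip))
     (Seq (Emit (Sub (V vN) (V vY)))
          (For vA (V vN) (If (Read aLev (V vA)) Skip (Emit (V vA))))))))"

text \<open>\<open>Emit (Const 0)\<close> prints the list of failed arcs, which is empty.\<close>

definition print_expander :: program where
  "print_expander =
     Seq (Emit (Const 2)) (Seq (Emit (V vM))
     (Seq (For vA (V vM) (Emit (Read aF (V vA))))
     (Seq (Emit (V vR))
     (Seq (For vA (V vR) (Seq (Emit (Read aF (Read aHT (V vA)))) (Emit (Read aF (Read aHH (V vA))))))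
     (Seq (Emit (Const 0))
     (For vA (V vR) (Seq (Emit (Read aLen (V vA)))
       (For vJ (Read aLen (V vA)) (Emit (Read aPath (Add (Mul (V vA) (V vN)) (V vJ))))))))))))"

section \<open>Rules for printing programs\<close>

lemma length_filter_upt: "length (filter P [0..<n]) = card {v. v < n \<and> P v}"
  by (subst distinct_card[symmetric]) (auto intro!: arg_cong[where f = card])

lemma filter_conv_concat: "filter P xs = concat (map (\<lambda>x. if P x then [x] else []) xs)"
  by (induction xs) auto

text \<open>A specification of output only. All arrays outside \<open>X\<close> agree with a
  reference memory \<open>s0\<close>, so emitted values can be computed from \<open>s0\<close>
  however the fragment is reached, and fragments compose by appending their outputs.\<close>

definition prints :: "nat \<Rightarrow> nat set \<Rightarrow> memory \<Rightarrow> program \<Rightarrow> nat \<Rightarrow> nat list \<Rightarrow> nat list \<Rightarrow> bool" where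
  "prints B X s0 p c xs ys \<longleftrightarrow> (\<forall>s. (\<forall>a. a \<notin> X \<longrightarrow> s a = s0 a) \<longrightarrow> printed s xs \<longrightarrow>
     wp B p s (\<lambda>t s'. t \<le> c \<and> printed s' (xs @ ys)))"

lemma prints_mono: "prints B X s0 p c xs ys \<Longrightarrow> c \<le> c' \<Longrightarrow> prints B X s0 p c' xs ys"
  unfolding prints_def by (blast intro: wp_mono le_trans)

lemma prints_run:
  "prints B X s0 p c xs ys \<Longrightarrow> printed s0 xs \<Longrightarrow> wp B p s0 (\<lambda>t s. t \<le> c \<and> printed s (xs @ ys))"
  unfolding prints_def by blast

lemma prints_Emit:
  assumes "\<And>s. (\<And>a. a \<notin> X \<Longrightarrow> s a = s0 a) \<Longrightarrow> fits B s e \<and> val s e = v" "Suc (length xs) < B"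
  shows "prints B X s0 (Emit e) 2 xs [v]"
  unfolding prints_def
proof (intro allI impI)
  fix s assume fr: "\<forall>a. a \<notin> X \<longrightarrow> s a = s0 a" and P: "printed s xs"
  have *: "fits B s e \<and> val s e = v" by (rule assms(1)) (use fr in blast)
  then show "wp B (Emit e) s (\<lambda>t s'. t \<le> 2 \<and> printed s' (xs @ [v]))"
    by (intro wp_mono[OF wp_Emit[OF P conjunct1[OF *] assms(2)]]) auto
qed

lemma prints_Skip: "prints B X s0 Skip 1 xs []"
  by (simp add: prints_def)

lemma prints_Seq:
  assumes p: "prints B X s0 p c xs ys" "writes p \<subseteq> X" and q: "prints B X s0 q c' xs' zs" "xs' = xs @ ys"
  shows "prints B X s0 (Seq p q) (c + c') xs (ys @ zs)"
  unfolding prints_def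
proof (intro allI impI)
  fix s assume fr: "\<forall>a. a \<notin> X \<longrightarrow> s a = s0 a" and P: "printed s xs"
  have "wp B p s (\<lambda>t s'. t \<le> c \<and> printed s' (xs @ ys))" using p(1) fr P by (simp add: prints_def)
  then show "wp B (Seq p q) s (\<lambda>t s'. t \<le> c + c' \<and> printed s' (xs @ ys @ zs))"
    unfolding wp_Seq
  proof (rule wp_use)
    fix t s' assume s': "t \<le> c \<and> printed s' (xs @ ys)" "\<And>a. a \<notin> writes p \<Longrightarrow> s' a = s a"
    then have "\<forall>a. a \<notin> X \<longrightarrow> s' a = s0 a" using fr p(2) by (metis subsetD)
    then have "wp B q s' (\<lambda>u s''. u \<le> c' \<and> printed s'' (xs' @ zs))"
      using q s' by (simp add: prints_def)
    then show "wp B q s' (\<lambda>u s''. t + u \<le> c + c' \<and> printed s'' (xs @ ys @ zs))"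
      by (rule wp_mono) (use s' q in auto)
  qed
qed

lemma prints_If:
  assumes b: "\<And>s. (\<And>a. a \<notin> X \<Longrightarrow> s a = s0 a) \<Longrightarrow> fits B s b \<and> (val s b \<noteq> 0 \<longleftrightarrow> P)"
    and "P \<Longrightarrow> prints B X s0 p c xs ys" "\<not> P \<Longrightarrow> prints B X s0 q c xs ys"
  shows "prints B X s0 (If b p q) (Suc c) xs ys"
  unfolding prints_def
proof (intro allI impI)
  fix s assume fr: "\<forall>a. a \<notin> X \<longrightarrow> s a = s0 a" and "printed s xs"
  moreover have "fits B s b \<and> (val s b \<noteq> 0 \<longleftrightarrow> P)" by (rule b) (use fr in blast)
  ultimately show "wp B (If b p q) s (\<lambda>t s'. t \<le> Suc c \<and> printed s' (xs @ ys))"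
    using assms(2,3) by (cases P) (simp_all add: prints_def)
qed

text \<open>Within the body the counter is constant. The reference memory is therefore replaced by
  the current one and \<open>x\<close> taken out of \<open>X\<close>, so that the body may read its
  value.\<close>

lemma prints_For:
  assumes N: "\<And>s. (\<And>a. a \<notin> X \<Longrightarrow> s a = s0 a) \<Longrightarrow> fits B s N \<and> val s N = m"
    and step: "\<And>k s. k < m \<Longrightarrow> (\<And>a. a \<notin> X \<Longrightarrow> s a = s0 a) \<Longrightarrow> s x 0 = k \<Longrightarrow>
      prints B (X - {x}) s p c (xs @ concat (map g [0..<k])) (g k)"
    and X: "writes p \<subseteq> X - {x}" "x \<in> X" "x \<noteq> 1" "x \<noteq> vPos" and m: "m < B" "1 < B"
  shows "prints B X s0 (For x N p) (2 + m * (c + 2)) xs (concat (map g [0..<m]))"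
  unfolding prints_def
proof (intro allI impI)
  fix s0' assume fr0: "\<forall>a. a \<notin> X \<longrightarrow> s0' a = s0 a" and P: "printed s0' xs"
  have "wp B (For x N p) s0' (\<lambda>t s. t \<le> 2 + m * (c + 2) \<and> printed s (xs @ concat (map g [0..<m])) \<and> s x 0 = m)"
  proof (rule wp_For)
    show "printed (s0'(x := (s0' x)(0 := 0))) (xs @ concat (map g [0..<0]))" using P X by simp
  next
    fix k s assume fr: "\<And>a. a \<notin> insert x (writes p) \<Longrightarrow> s a = s0' a"
    have "s a = s0 a" if "a \<notin> X" for a using fr[of a] fr0 X that by auto
    then show "fits B s N \<and> val s N = m" by (rule N)
  next
    fix k s assume k: "k < m" "printed s (xs @ concat (map g [0..<k]))" "s x 0 = k"
      and fr: "\<And>a. a \<notin> insert x (writes p) \<Longrightarrow> s a = s0' a"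
    have "s a = s0 a" if "a \<notin> X" for a using fr[of a] fr0 X that by auto
    then have "prints B (X - {x}) s p c (xs @ concat (map g [0..<k])) (g k)"
      using k by (intro step)
    then have "wp B p s (\<lambda>t s'. t \<le> c \<and> printed s' ((xs @ concat (map g [0..<k])) @ g k))"
      using k unfolding prints_def by blast
    then show "wp B p s (\<lambda>t s'. t \<le> c \<and> s' x 0 = k \<and>
        printed (s'(x := (s' x)(0 := Suc k))) (xs @ concat (map g [0..<Suc k])))"
    proof (rule wp_use, goal_cases)
      case (1 t s')
      have "x \<notin> writes p" using X(1) by blast
      then have "s' x = s x" by (rule 1(2))
      then show ?case using 1(1) X k by simp
    qed
  qed (use m in auto)
  then show "wp B (For x N p) s0' (\<lambda>t s. t \<le> 2 + m * (c + 2) \<and> printed s (xs @ concat (map g [0..<m])))"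
    by (rule wp_mono) auto
qed

context router_machine
begin

definition cut_side :: "memory \<Rightarrow> nat set" where
  "cut_side s = (if s vRem 0 \<le> 2 * card {v. v < n \<and> s aSide v = 1} then {v. v < n \<and> s aSide v = 1}
     else {v. v < n \<and> s aSide v \<noteq> 2})"

lemma wp_mark_side:
  assumes st: "static s0" and so: "split_ok (s0 aSide) (s0 vRem 0) cnt"
  shows "wp B mark_side s0 (\<lambda>t s. t \<le> 14 * n + 10 \<and>
     (\<forall>v<n. s aLev v = (if v \<in> cut_side s0 then 1 else 0)) \<and> s vY 0 = card (cut_side s0))"
proof -
  note BB = B_bounds m_bounds d_le
  have side2: "s0 aSide v \<le> 2" if "v < n" for v using so that by (auto simp: split_ok_def)
  have rem: "s0 vRem 0 \<le> n" using card_left_eq[OF so] by simp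
  let ?o = "card {v. v < n \<and> s0 aSide v = 1}"
  have on: "length (filter P [0..<k]) \<le> k" for P k using length_filter_le[of P "[0..<k]"] by simp
  have on': "?o \<le> n" unfolding length_filter_upt[symmetric] by (rule on)
  show ?thesis
    unfolding mark_side_def
    apply (simp only: wp_Seq[of B "Assign x y" for x y] wp_Write)
    apply (intro conjI)
    subgoal using BB by simp
    subgoal using BB by simp
    apply (subst wp_Seq)
    apply (rule wp_use[OF wp_For[where m = n and c = 1 and
        I = "\<lambda>k s. s vX 0 = length (filter (\<lambda>v. s0 aSide v = 1) [0..<k])"]])
    subgoal by simp
    subgoal using st BB by (simp add: static_def)
    subgoal premises pre for k s
    proof -
      have "s aSide = s0 aSide" using pre(4)[of aSide] by simp
      then show ?thesis
        using pre(1-3) BB side2[OF pre(1)] on[of "\<lambda>v. s0 aSide v = 1" k] by (simp del: One_nat_def)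
    qed
    subgoal using BB by simp
    subgoal using BB by simp
    apply (subst wp_Seq)
    subgoal premises pre for t1 s1
    proof -
      have fr1: "s1 a = s0 a" if "a \<notin> {vA, vX}" for a using pre(2)[of a] that by simp
      have X: "s1 vX 0 = ?o" using pre(1) by (simp add: length_filter_upt)
      show ?thesis
        apply (rule wp_use[OF wp_For[where m = n and c = 2 and
            I = "\<lambda>k s. \<forall>v<k. s aLev v = (if v \<in> cut_side s0 then 1 else 0)"]])
        subgoal by simp
        subgoal using st BB by (simp add: static_def fr1)
        subgoal premises pre2 for k s
        proof -
          have "s vX 0 = ?o" "s aSide = s0 aSide" "s vRem 0 = s0 vRem 0"
            using pre2(4)[of vX] pre2(4)[of aSide] pre2(4)[of vRem] X by (simp_all add: fr1)
          moreover have "Suc (2 * ?o) < B" "?o < B" "2 * ?o < B" "Suc (2 * ?o) - z < B" "s0 vRem 0 < B" for z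
            using on' rem BB by auto
          ultimately show ?thesis
            using pre2(1-3) BB side2[OF pre2(1)] by (auto simp: cut_side_def less_Suc_eq)
        qed
        subgoal using BB by simp
        subgoal using BB by simp
        apply (simp only: wp_Seq[of B "Assign x y" for x y] wp_Write)
        apply (intro conjI)
        subgoal using BB by simp
        subgoal using BB by simp
        subgoal premises pre2 for t2 s2
        proof -
          have fr2: "s2 a = s0 a" if "a \<notin> {vA, vX, aLev}" for a using pre2(2)[of a] fr1[of a] that by simp
          show ?thesis
            apply (rule wp_use[OF wp_For[where m = n and c = 1 and
                I = "\<lambda>k s. s vY 0 = length (filter (\<lambda>v. v \<in> cut_side s0) [0..<k])"]])
            subgoal by simp
            subgoal using st BB by (simp add: static_def fr2)
            subgoal premises pre3 for k s
            proof -
              have "s aLev = s2 aLev" using pre3(4)[of aLev] by simp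
              then have "s aLev k = (if k \<in> cut_side s0 then 1 else 0)" using pre2(1) pre3(1) by auto
              then show ?thesis using pre3(1-3) BB on[of "\<lambda>v. v \<in> cut_side s0" k] by auto
            qed
            subgoal using BB by simp
            subgoal using BB by simp
            subgoal premises pre3 for t3 s3
            proof -
              have "s3 aLev = s2 aLev" using pre3(2)[of aLev] by simp
              moreover have "{v. v < n \<and> v \<in> cut_side s0} = cut_side s0" by (auto simp: cut_side_def)
              ultimately show ?thesis
                using pre(1) pre2(1) pre3(1) by (simp add: length_filter_upt)
            qed
            done
        qed
        done
    qed
    done
qed

lemma wp_print_cut:
  assumes st: "static s0" and so: "split_ok (s0 aSide) (s0 vRem 0) cnt" and pos: "s0 vPos 0 = 0"
  shows "wp B print_cut s0 (\<lambda>t s. t \<le> 24 * n + 30 \<and>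
     printed s (enc_cut (filter (\<lambda>v. v \<in> cut_side s0) [0..<n]) (filter (\<lambda>v. v \<notin> cut_side s0) [0..<n])))"
proof -
  note BB = B_bounds m_bounds d_le
  let ?A = "cut_side s0" and ?X = "{1, vPos, vA}"
  let ?g = "\<lambda>v. if v \<in> ?A then [v] else []" and ?h = "\<lambda>v. if v \<notin> ?A then [v] else []"
  have on: "length (filter P [0..<k]) \<le> k" for P k using length_filter_le[of P "[0..<k]"] by simp
  have lg: "length (concat (map ?g [0..<k])) \<le> k" "length (concat (map ?h [0..<k])) \<le> k" for k
    unfolding filter_conv_concat[symmetric] by (rule on)+
  have A: "{v. v < n \<and> v \<in> ?A} = ?A" by (auto simp: cut_side_def)
  have cA: "length (filter (\<lambda>v. v \<in> ?A) [0..<n]) = card ?A" by (simp add: length_filter_upt A)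
  have cA': "card ?A \<le> n" using on[of "\<lambda>v. v \<in> ?A" n] cA by simp
  have cB: "length (filter (\<lambda>v. v \<notin> ?A) [0..<n]) = n - card ?A"
    using sum_length_filter_compl[of "\<lambda>v. v \<in> ?A" "[0..<n]"] cA by simp
  have tail: "prints B ?X s1 (Seq (Emit (Const 1)) (Seq (Emit (V vY))
     (Seq (For vA (V vN) (If (Read aLev (V vA)) (Emit (V vA)) Skip))
     (Seq (Emit (Sub (V vN) (V vY)))
          (For vA (V vN) (If (Read aLev (V vA)) Skip (Emit (V vA))))))))
     (2 + (2 + ((2 + n * (Suc 2 + 2)) + (2 + (2 + n * (Suc 2 + 2)))))) []
     ([1] @ [card ?A] @ concat (map ?g [0..<n]) @ [n - card ?A] @ concat (map ?h [0..<n]))"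
    if N: "s1 vN 0 = n" and Y: "s1 vY 0 = card ?A"
      and L: "\<And>v. v < n \<Longrightarrow> s1 aLev v = (if v \<in> ?A then 1 else 0)" for s1
  proof -
    have 1: "prints B ?X s1 (Emit (Const 1)) 2 [] [1]" using BB by (intro prints_Emit) auto
    have 2: "prints B ?X s1 (Emit (V vY)) 2 [1] [card ?A]" using BB Y cA' by (intro prints_Emit) auto
    have 3: "prints B ?X s1 (For vA (V vN) (If (Read aLev (V vA)) (Emit (V vA)) Skip))
        (2 + n * (Suc 2 + 2)) [1, card ?A] (concat (map ?g [0..<n]))"
    proof (rule prints_For)
      fix k s assume k: "k < n" and fr: "\<And>a. a \<notin> ?X \<Longrightarrow> s a = s1 a" and A: "s vA 0 = k"
      have "s aLev k = (if k \<in> ?A then 1 else 0)" using fr[of aLev] L[OF k] by simp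
      then show "prints B (?X - {vA}) s (If (Read aLev (V vA)) (Emit (V vA)) Skip) (Suc 2)
          ([1, card ?A] @ concat (map ?g [0..<k])) (?g k)"
        using A k BB lg(1)[of k]
        by (intro prints_If[where P = "k \<in> ?A"]) (auto intro!: prints_Emit prints_mono[OF prints_Skip])
    qed (use N BB in auto)
    have 4: "prints B ?X s1 (Emit (Sub (V vN) (V vY))) 2 ([1, card ?A] @ concat (map ?g [0..<n])) [n - card ?A]"
      using BB Y N cA' lg(1)[of n] by (intro prints_Emit) auto
    have 5: "prints B ?X s1 (For vA (V vN) (If (Read aLev (V vA)) Skip (Emit (V vA))))
        (2 + n * (Suc 2 + 2)) ([1, card ?A] @ concat (map ?g [0..<n]) @ [n - card ?A]) (concat (map ?h [0..<n]))"
    proof (rule prints_For)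
      fix k s assume k: "k < n" and fr: "\<And>a. a \<notin> ?X \<Longrightarrow> s a = s1 a" and A: "s vA 0 = k"
      have "s aLev k = (if k \<in> ?A then 1 else 0)" using fr[of aLev] L[OF k] by simp
      then show "prints B (?X - {vA}) s (If (Read aLev (V vA)) Skip (Emit (V vA))) (Suc 2)
          (([1, card ?A] @ concat (map ?g [0..<n]) @ [n - card ?A]) @ concat (map ?h [0..<k])) (?h k)"
        using A k BB lg(1)[of n] lg(2)[of k]
        by (intro prints_If[where P = "k \<in> ?A"]) (auto intro!: prints_Emit prints_mono[OF prints_Skip])
    qed (use N BB in auto)
    show ?thesis
      by (intro prints_Seq[OF 1 _ prints_Seq[OF 2 _ prints_Seq[OF 3 _ prints_Seq[OF 4 _ 5]]]]) auto
  qed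
  show ?thesis
    unfolding print_cut_def
    apply (subst wp_Seq)
    apply (rule wp_use[OF wp_mark_side[OF st so]])
    subgoal premises pre for t1 s1
    proof -
      have fr1: "s1 a = s0 a" if "a \<notin> {vA, vX, vY, aLev}" for a
        using pre(2)[of a] that by (simp add: mark_side_def)
      have "s1 vN 0 = n" "printed s1 []" using st pos by (simp_all add: static_def printed_def fr1)
      then show ?thesis
        using pre(1)
        by (intro wp_mono[OF prints_run[OF tail]])
          (auto simp: enc_cut_def enc_list_def cA cB filter_conv_concat[symmetric])
    qed
    done
qed

lemma wp_print_expander:
  assumes st: "static s0" and inv: "invs s0" and pos: "s0 vPos 0 = 0"
  shows "wp B print_expander s0 (\<lambda>t s. t \<le> 20 * n + 20 * r + 30 + r * (4 * n + 4) \<and>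
     printed s (2 # enc_list (map (s0 aF) [0..<m]) @
       r # concat (map (\<lambda>e. [s0 aF (ht e), s0 aF (hh e)]) [0..<r]) @ [0] @
       concat (map (\<lambda>e. enc_list (path_of (s0 aPath) (s0 aLen) e)) [0..<r])))"
proof -
  note BB = B_bounds m_bounds d_le
  have inv': "inv (s0 aF) (s0 vQ 0) (s0 aSide) (s0 vRem 0) (s0 aLen) (s0 aPath) (s0 aCnt) (s0 vCur 0)"
    using inv by (simp add: invs_def)
  then have po: "paths_ok (s0 aF) (s0 aLen) (s0 aPath) (s0 aCnt)" and h: "hosted (s0 aF) (s0 vQ 0) (s0 aSide)"
    by (auto simp: inv_def)
  have len: "s0 aLen e < n" if "e < r" for e by (rule paths_short[OF po that])
  have f: "s0 aF h < n" if "h < m" for h using h that by (auto simp: hosted_def intro: less_le_trans)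
  have pathE: "s0 aPath (e * n + j) < E" if e: "e < r" "j < s0 aLen e" for e j
  proof -
    have "set (path_of (s0 aPath) (s0 aLen) e) \<subseteq> arcs W"
      using po e by (auto simp: paths_ok_def apath_def awalk_def)
    moreover have "s0 aPath (e * n + j) \<in> set (path_of (s0 aPath) (s0 aLen) e)"
      using e by (auto simp: path_of_def)
    ultimately show ?thesis using W by auto
  qed
  let ?X = "{1, vPos, vA, vJ}"
  let ?x1 = "[2, m] @ map (s0 aF) [0..<m] @ [r]"
  let ?g = "\<lambda>e. [s0 aF (ht e), s0 aF (hh e)]"
  let ?x2 = "?x1 @ concat (map ?g [0..<r]) @ [0]"
  let ?h = "\<lambda>e. enc_list (path_of (s0 aPath) (s0 aLen) e)"
  have single: "concat (map (\<lambda>j. [u j]) xs) = map u xs" for u :: "nat \<Rightarrow> nat" and xs by (induction xs) auto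
  have lg: "length (concat (map ?g [0..<k])) = 2 * k" for k by (induction k) auto
  have lh: "length (concat (map ?h [0..<k])) \<le> k * n" if "k \<le> r" for k
    using that
  proof (induction k)
    case (Suc k)
    then show ?case using len[of k] by (simp add: enc_list_def)
  qed simp
  have lx2: "length ?x2 = m + 2 * r + 4" by (simp add: lg)
  have total: "m + 2 * r + 10 + k * n + n < B" if "k \<le> r" for k
  proof -
    have "k * n \<le> r * n" using that by simp
    also have "\<dots> \<le> 20 * (n + 10) * (r + 10)" by (simp add: algebra_simps)
    finally show ?thesis using B m_bounds by (simp del: mult_Suc)
  qed
  have s0: "s0 vN 0 = n" "s0 vM 0 = m" "s0 vR 0 = r" using st by (simp_all add: static_def)
  have 1: "prints B ?X s0 (Emit (Const 2)) 2 [] [2]" using BB by (intro prints_Emit) auto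
  have 2: "prints B ?X s0 (Emit (V vM)) 2 [2] [m]" using BB s0 by (intro prints_Emit) auto
  have 3: "prints B ?X s0 (For vA (V vM) (Emit (Read aF (V vA)))) (2 + m * (2 + 2)) [2, m]
      (concat (map (\<lambda>h. [s0 aF h]) [0..<m]))"
  proof (rule prints_For)
    fix k s assume k: "k < m" and fr: "\<And>a. a \<notin> ?X \<Longrightarrow> s a = s0 a" and A: "s vA 0 = k"
    show "prints B (?X - {vA}) s (Emit (Read aF (V vA))) 2 ([2, m] @ concat (map (\<lambda>h. [s0 aF h]) [0..<k])) [s0 aF k]"
      using k A fr[of aF] f[OF k] BB by (intro prints_Emit) (auto simp: single)
  qed (use s0 BB in auto)
  have 4: "prints B ?X s0 (Emit (V vR)) 2 ([2, m] @ map (s0 aF) [0..<m]) [r]"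
    using BB s0 by (intro prints_Emit) auto
  have 5: "prints B ?X s0 (For vA (V vR) (Seq (Emit (Read aF (Read aHT (V vA)))) (Emit (Read aF (Read aHH (V vA))))))
      (2 + r * ((2 + 2) + 2)) ?x1 (concat (map ?g [0..<r]))"
  proof (rule prints_For)
    fix k s assume k: "k < r" and fr: "\<And>a. a \<notin> ?X \<Longrightarrow> s a = s0 a" and A: "s vA 0 = k"
    have v: "s aF = s0 aF" "s aHT k = ht k" "s aHH k = hh k"
      using fr[of aF] fr[of aHT] fr[of aHH] st k by (simp_all add: static_def)
    have fB: "s0 aF (ht k) < B" "s0 aF (hh k) < B" "ht k < B" "hh k < B" "k < B"
      using f[of "ht k"] f[of "hh k"] ends[OF k] BB k by auto
    let ?y = "?x1 @ concat (map ?g [0..<k])"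
    have ly: "Suc (Suc (length ?y)) < B" using total[of 0] k by (simp add: lg)
    have a: "prints B (?X - {vA}) s (Emit (Read aF (Read aHT (V vA)))) 2 ?y [s0 aF (ht k)]"
      using fB v A ly BB by (intro prints_Emit) auto
    have b: "prints B (?X - {vA}) s (Emit (Read aF (Read aHH (V vA)))) 2 (?y @ [s0 aF (ht k)]) [s0 aF (hh k)]"
      using fB v A ly BB by (intro prints_Emit) auto
    from prints_Seq[OF a _ b] show "prints B (?X - {vA}) s (Seq (Emit (Read aF (Read aHT (V vA)))) (Emit (Read aF (Read aHH (V vA)))))
        (2 + 2) ?y (?g k)" by simp
  qed (use s0 BB in auto)
  have 6: "prints B ?X s0 (Emit (Const 0)) 2 (?x1 @ concat (map ?g [0..<r])) [0]"
    using total[of 0] lg[of r] by (intro prints_Emit) auto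
  let ?path = "Read aPath (Add (Mul (V vA) (V vN)) (V vJ))"
  let ?row = "Seq (Emit (Read aLen (V vA))) (For vJ (Read aLen (V vA)) (Emit ?path))"
  have 7: "prints B ?X s0 (For vA (V vR) ?row) (2 + r * (2 + (2 + n * (2 + 2)) + 2)) ?x2 (concat (map ?h [0..<r]))"
  proof (rule prints_For)
    fix k s assume k: "k < r" and fr: "\<And>a. a \<notin> ?X \<Longrightarrow> s a = s0 a" and A: "s vA 0 = k"
    have v: "s aLen = s0 aLen" "s aPath = s0 aPath" "s vN 0 = n"
      using fr[of aLen] fr[of aPath] fr[of vN] s0 by simp_all
    let ?y = "?x2 @ concat (map ?h [0..<k])"
    let ?u = "\<lambda>j. [s0 aPath (k * n + j)]"
    have ly: "length ?y + n + 2 < B" using lx2 lh[of k] total[of k] k by simp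
    have kB: "k < B" using BB k by simp
    have a: "prints B (?X - {vA}) s (Emit (Read aLen (V vA))) 2 ?y [s0 aLen k]"
      using len[OF k] A v BB kB ly by (intro prints_Emit) auto
    have b: "prints B (?X - {vA}) s (For vJ (Read aLen (V vA)) (Emit ?path)) (2 + s0 aLen k * (2 + 2))
        (?y @ [s0 aLen k]) (concat (map ?u [0..<s0 aLen k]))"
    proof (rule prints_For)
      fix j s' assume j: "j < s0 aLen k" and fr': "\<And>a. a \<notin> ?X - {vA} \<Longrightarrow> s' a = s a" and J: "s' vJ 0 = j"
      have v': "s' vA 0 = k" "s' aPath = s0 aPath" "s' vN 0 = n"
        using fr'[of vA] fr'[of aPath] fr'[of vN] A v by simp_all
      have jn: "j < n" using j len[OF k] by simp
      then have "k * n + j < B" "k * n < B" "s0 aPath (k * n + j) < B" "j < B" "n < B"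
        using address_bound(1)[OF k, of j] address_bound(2)[OF k] pathE[OF k j] BB by auto
      moreover have "Suc (length ((?y @ [s0 aLen k]) @ concat (map ?u [0..<j]))) < B"
        using ly jn by (simp add: single)
      ultimately show "prints B (?X - {vA} - {vJ}) s' (Emit ?path) 2
          ((?y @ [s0 aLen k]) @ concat (map ?u [0..<j])) (?u j)"
        using v' J kB BB by (intro prints_Emit) auto
    qed (use A v len[OF k] kB BB in auto)
    have "prints B (?X - {vA}) s ?row (2 + (2 + s0 aLen k * (2 + 2))) ?y ([s0 aLen k] @ concat (map ?u [0..<s0 aLen k]))"
      by (rule prints_Seq[OF a _ b]) auto
    then show "prints B (?X - {vA}) s ?row (2 + (2 + n * (2 + 2))) ?y (?h k)"
      using len[OF k] by (auto simp: enc_list_def path_of_def single elim!: prints_mono)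
  qed (use s0 BB in auto)
  have "prints B ?X s0 print_expander
      (2 + (2 + ((2 + m * (2 + 2)) + (2 + ((2 + r * ((2 + 2) + 2)) + (2 + (2 + r * (2 + (2 + n * (2 + 2)) + 2))))))))
      [] ([2] @ [m] @ concat (map (\<lambda>h. [s0 aF h]) [0..<m]) @ [r] @ concat (map ?g [0..<r]) @ [0] @ concat (map ?h [0..<r]))"
    unfolding print_expander_def
    by (intro prints_Seq[OF 1 _ prints_Seq[OF 2 _ prints_Seq[OF 3 _ prints_Seq[OF 4 _ prints_Seq[OF 5 _
          prints_Seq[OF 6 _ 7]]]]]]) (auto simp: single)
  moreover have "printed s0 []" using pos by (simp add: printed_def)
  ultimately show ?thesis
    by (rule wp_mono[OF prints_run]) (use BB in \<open>auto simp: single enc_list_def algebra_simps\<close>)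
qed

end

section \<open>The host graph and its set-up\<close>

text \<open>Loops cross no cut, so dropping them costs no expansion; without them every arc joins
  two different hosts and needs a nonempty path.\<close>

definition loopless :: "(nat, nat) pre_digraph \<Rightarrow> nat list" where
  "loopless H = filter (\<lambda>e. tail H e \<noteq> head H e) [0..<card (arcs H)]"

lemma card_nth:
  assumes "distinct xs"
  shows "card {i. i < length xs \<and> Q (xs ! i)} = card {e \<in> set xs. Q e}"
proof -
  have "inj_on ((!) xs) {i. i < length xs \<and> Q (xs ! i)}"
    using assms by (auto simp: inj_on_def nth_eq_iff_index_eq)
  moreover have "(!) xs ` {i. i < length xs \<and> Q (xs ! i)} = {e \<in> set xs. Q e}"
    by (auto simp: in_set_conv_nth)
  ultimately show ?thesis by (metis card_image)
qed

lemma sum_in_degree: "fin_digraph G \<Longrightarrow> card (arcs G) = (\<Sum>v\<in>verts G. in_degree G v)"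
proof -
  assume "fin_digraph G"
  then interpret fin_digraph G .
  have "arcs G = (\<Union>v\<in>verts G. in_arcs G v)" by (auto simp: in_arcs_def)
  then have "card (arcs G) = card (\<Union>v\<in>verts G. in_arcs G v)" by simp
  also have "\<dots> = (\<Sum>v\<in>verts G. card (in_arcs G v))"
    by (rule card_UN_disjoint) (auto simp: in_arcs_def)
  finally show ?thesis by (simp add: in_degree_def)
qed

context router
begin

definition host_graph :: "arr \<Rightarrow> (nat, nat) pre_digraph" where
  "host_graph f = \<lparr>verts = f ` {..<m}, arcs = {..<r}, tail = (\<lambda>e. f (ht e)), head = (\<lambda>e. f (hh e))\<rparr>"

lemma host_graph:
  assumes f: "inj_on f {..<m}"
  shows "fin_digraph (host_graph f)" "loopfree_digraph (host_graph f)" "arcs_numbered (host_graph f)"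
    "\<forall>v \<in> verts (host_graph f). degree (host_graph f) v \<le> 18" "card (verts (host_graph f)) = m"
proof -
  show fin: "fin_digraph (host_graph f)" by unfold_locales (auto simp: host_graph_def ends)
  interpret HG: fin_digraph "host_graph f" by (rule fin)
  show "loopfree_digraph (host_graph f)"
    by unfold_locales (use inj_onD[OF f] ends in \<open>force simp: host_graph_def\<close>)
  show "arcs_numbered (host_graph f)" by (simp add: arcs_numbered_def host_graph_def)
  show "card (verts (host_graph f)) = m" using f by (simp add: host_graph_def card_image)
  show "\<forall>v \<in> verts (host_graph f). degree (host_graph f) v \<le> 18"
  proof
    fix v assume "v \<in> verts (host_graph f)"
    then obtain h where h: "h < m" "v = f h" by (auto simp: host_graph_def)
    have eq: "f (ht e) = f h \<longleftrightarrow> ht e = h" "f (hh e) = f h \<longleftrightarrow> hh e = h" if "e < r" for e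
      using f h ends[OF that] by (auto simp: inj_on_def)
    have "in_arcs (host_graph f) v = {e. e < r \<and> hh e = h}" "out_arcs (host_graph f) v = {e. e < r \<and> ht e = h}"
      using eq h by (auto simp: in_arcs_def out_arcs_def host_graph_def)
    then have "degree (host_graph f) v = card {e. e < r \<and> hh e = h} + card {e. e < r \<and> ht e = h}"
      by (simp add: degree_def in_degree_def out_degree_def)
    also have "\<dots> = card ({e. e < r \<and> hh e = h} \<union> {e. e < r \<and> ht e = h})"
      using ends by (intro card_Un_disjoint[symmetric]) auto
    also have "\<dots> = card {e. e < r \<and> (ht e = h \<or> hh e = h)}"
      by (rule arg_cong[where f = card]) auto
    also have "\<dots> \<le> 18" by (rule deg[OF h(1)])
    finally show "degree (host_graph f) v \<le> 18" .
  qed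
qed

text \<open>Pulling back along the injection \<open>f\<close> turns a cut of the host graph into a
  cut of \<open>H\<close> with parts of the same sizes; the number of crossing arcs agrees, since
  only loops were dropped and the others renumbered.\<close>

lemma host_graph_expander:
  assumes f: "inj_on f {..<m}" and H: "fin_digraph H" "verts H = {..<m}" "arcs_numbered H" "is_expander \<alpha> H"
    and xs: "r = length (loopless H)" "\<And>i. i < r \<Longrightarrow> ht i = tail H (loopless H ! i)"
      "\<And>i. i < r \<Longrightarrow> hh i = head H (loopless H ! i)"
  shows "is_expander \<alpha> (host_graph f)"
  unfolding is_expander_def
proof (intro allI impI)
  fix A B assume cut: "is_cut (host_graph f) A B"
  let ?A = "{h. h < m \<and> f h \<in> A}" and ?B = "{h. h < m \<and> f h \<in> B}"
  have AB: "f ` ?A = A" "f ` ?B = B" "A \<inter> B = {}" "A \<noteq> {}" "B \<noteq> {}"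
    using cut by (auto simp: is_cut_def host_graph_def)
  have inj: "inj_on f ?A" "inj_on f ?B" using f by (auto simp: inj_on_def)
  have cards: "card A = card ?A" "card B = card ?B"
    using AB(1,2) card_image[OF inj(1)] card_image[OF inj(2)] by simp_all
  have "is_cut H ?A ?B"
    using cut AB by (auto simp: is_cut_def H host_graph_def)
  then have "\<alpha> \<le> sparsity H ?A ?B" using H by (simp add: is_expander_def)
  moreover have "card (arcs_between (host_graph f) A B) = card (arcs_between H ?A ?B)"
  proof -
    have "distinct (loopless H)" by (simp add: loopless_def)
    have "arcs_between (host_graph f) A B =
        {i. i < length (loopless H) \<and> (tail H (loopless H ! i) \<in> ?A \<and> head H (loopless H ! i) \<in> ?B)}"
      using xs(2,3) ends by (auto simp: arcs_between_def host_graph_def simp flip: xs(1))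
    then have "card (arcs_between (host_graph f) A B) =
        card {e \<in> set (loopless H). tail H e \<in> ?A \<and> head H e \<in> ?B}"
      using card_nth[OF \<open>distinct (loopless H)\<close>, of "\<lambda>e. tail H e \<in> ?A \<and> head H e \<in> ?B"] by simp
    also have "{e \<in> set (loopless H). tail H e \<in> ?A \<and> head H e \<in> ?B} = arcs_between H ?A ?B"
      using AB(3) H(3) by (auto simp: arcs_between_def loopless_def arcs_numbered_def)
    finally show ?thesis .
  qed
  ultimately show "\<alpha> \<le> sparsity (host_graph f) A B"
    by (simp add: sparsity_def cards)
qed

text \<open>The last argument \<open>r\<close> of the invariant says that the scan has passed all
  arcs, so each of them has a path.\<close>

lemma host_graph_embedding:
  assumes inv: "inv f q side rem plen path cnt r"
  shows "is_embedding (host_graph f) W (path_of path plen)"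
    "\<forall>e \<in> arcs (host_graph f). length (path_of path plen e) \<le> d"
    "congestion (host_graph f) W (path_of path plen) \<le> \<eta>"
proof -
  have po: "paths_ok f plen path cnt" and h: "hosted f q side" and all: "\<And>e. e < r \<Longrightarrow> plen e \<noteq> 0"
    using inv by (auto simp: inv_def)
  show "is_embedding (host_graph f) W (path_of path plen)"
    using po all h W by (auto simp: is_embedding_def host_graph_def paths_ok_def hosted_def intro: less_le_trans)
  show "\<forall>e \<in> arcs (host_graph f). length (path_of path plen e) \<le> d"
    using po all by (auto simp: host_graph_def paths_ok_def)
  have "card {e \<in> arcs (host_graph f). a \<in> set (path_of path plen e)} \<le> \<eta>" if "a < E" for a
  proof -
    have eq: "{e \<in> arcs (host_graph f). a \<in> set (path_of path plen e)} =
        {e. e < r \<and> plen e \<noteq> 0 \<and> a \<in> set (path_of path plen e)}"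
      using all by (auto simp: host_graph_def)
    have "card {e. e < r \<and> plen e \<noteq> 0 \<and> a \<in> set (path_of path plen e)} \<le> cnt a" "cnt a \<le> \<eta>"
      using po that by (auto simp: paths_ok_def)
    then show ?thesis unfolding eq by linarith
  qed
  then show "congestion (host_graph f) W (path_of path plen) \<le> \<eta>"
    unfolding congestion_def by (intro Max.boundedI) (auto simp: W)
qed

end

lemma router_loopless:
  fixes W H :: "(nat, nat) pre_digraph"
  assumes W: "fin_digraph W" "verts W = {..<n}" "arcs W = {..<E}"
    and n: "5 \<le> n" and m: "m = (n + 3) div 4"
    and D: "1 \<le> D" "\<And>v. v < n \<Longrightarrow> in_degree W v \<le> D" and l: "n < 2 ^ l"
    and H: "fin_digraph H" "verts H = {..<m}" "arcs_numbered H"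
      "\<And>v. v < m \<Longrightarrow> in_degree H v \<le> 9 \<and> out_degree H v \<le> 9"
  shows "router W n E D l m (length (loopless H)) (\<lambda>i. tail H (loopless H ! i)) (\<lambda>i. head H (loopless H ! i))"
    "card (arcs H) \<le> 9 * m"
proof -
  interpret H: fin_digraph H by (rule H)
  let ?xs = "loopless H"
  have arcs_H: "arcs H = {..<card (arcs H)}" using H(3) by (simp add: arcs_numbered_def)
  have xs: "?xs ! i \<in> arcs H" "tail H (?xs ! i) \<noteq> head H (?xs ! i)" if "i < length ?xs" for i
  proof -
    have "?xs ! i \<in> set ?xs" using that by simp
    then have "?xs ! i < card (arcs H)" "tail H (?xs ! i) \<noteq> head H (?xs ! i)" by (auto simp: loopless_def)
    then show "?xs ! i \<in> arcs H" "tail H (?xs ! i) \<noteq> head H (?xs ! i)" using arcs_H by auto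
  qed
  have sub: "set ?xs \<subseteq> arcs H" using arcs_H by (auto simp: loopless_def)
  show r: "card (arcs H) \<le> 9 * m"
    unfolding sum_in_degree[OF H(1)] H(2)
    by (rule order_trans[OF sum_mono[where g = "\<lambda>_. 9"]]) (use H(4) in auto)
  show "router W n E D l m (length ?xs) (\<lambda>i. tail H (?xs ! i)) (\<lambda>i. head H (?xs ! i))"
  proof (rule router.intro; (rule W n m l D)?)
    fix v assume "v < n"
    have "{a. a < E \<and> head W a = v} = in_arcs W v" using W by (auto simp: in_arcs_def)
    then show "card {a. a < E \<and> head W a = v} \<le> D" using D(2)[OF \<open>v < n\<close>] by (simp add: in_degree_def)
  next
    fix e assume "e < length ?xs"
    then show "tail H (?xs ! e) < m" "head H (?xs ! e) < m" "tail H (?xs ! e) \<noteq> head H (?xs ! e)"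
      using xs[of e] H.tail_in_verts H.head_in_verts H(2) by auto
  next
    fix h assume h: "h < m"
    have "card {e. e < length ?xs \<and> (tail H (?xs ! e) = h \<or> head H (?xs ! e) = h)} =
        card {e \<in> set ?xs. tail H e = h \<or> head H e = h}"
      by (rule card_nth) (simp add: loopless_def)
    also have "\<dots> \<le> card (in_arcs H h \<union> out_arcs H h)"
      using sub by (intro card_mono) (auto simp: in_arcs_def out_arcs_def)
    also have "\<dots> \<le> in_degree H h + out_degree H h"
      unfolding in_degree_def out_degree_def by (rule card_Un_le)
    also have "\<dots> \<le> 18" using H(4)[OF h] by simp
    finally show "card {e. e < length ?xs \<and> (tail H (?xs ! e) = h \<or> head H (?xs ! e) = h)} \<le> 18" .
  next
    have "length ?xs \<le> card (arcs H)"
      unfolding loopless_def by (rule order_trans[OF length_filter_le]) simp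
    then show "length ?xs \<le> 9 * m" using r by simp
  qed
qed

text \<open>Offsets follow \<open>enc_digraph\<close>: the number \<open>n\<close>, the
  \<open>n\<close> vertices, the number of arcs at \<open>n + 1\<close>, and the ends of arc
  \<open>a\<close> at \<open>n + 2 + 2 * a\<close> and \<open>n + 3 + 2 * a\<close>. Arrays 40 and
  41 are the input and the output array of the shifted construction of the expander.\<close>

definition read_graph :: program where
  "read_graph =
     Seq (For vA (V vE)
       (Seq (Write aTl (V vA) (Read 0 (Add (Add (V vN) (Const 2)) (Mul (Const 2) (V vA)))))
            (Write aHd (V vA) (Read 0 (Add (Add (V vN) (Const 3)) (Mul (Const 2) (V vA)))))))
     (Seq (Assign vM (Div (Add (V vN) (Const 3)) (Const 4))) (Assign 40 (V vM)))"

definition read_expander :: program where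
  "read_expander =
     For vA (Read 41 (Add (V vM) (Const 1)))
       (If (Eq (Read 41 (Add (Add (V vM) (Const 2)) (Mul (Const 2) (V vA))))
               (Read 41 (Add (Add (V vM) (Const 3)) (Mul (Const 2) (V vA))))) Skip
         (Seq (Write aHT (V vR) (Read 41 (Add (Add (V vM) (Const 2)) (Mul (Const 2) (V vA)))))
         (Seq (Write aHH (V vR) (Read 41 (Add (Add (V vM) (Const 3)) (Mul (Const 2) (V vA)))))
              (Assign vR (Add (V vR) (Const 1))))))"

text \<open>Repeated halving counts the binary digits \<open>l\<close> of \<open>n\<close>. With
  \<open>D = C * l\<close> one has \<open>\<eta> = 5400 * (400 * D * l) = c * (l * l)\<close> for
  the program constant \<open>c = 2160000 * C\<close>, so neither \<open>D\<close> nor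
  \<open>d\<close> has to be computed.\<close>

definition init_hosts :: "nat \<Rightarrow> program" where
  "init_hosts c =
     Seq (Assign vX (V vN))
     (Seq (While (V vX) (Seq (Assign vX (Div (V vX) (Const 2))) (Assign vJ (Add (V vJ) (Const 1)))))
     (Seq (Assign vEta (Mul (Const c) (Mul (V vJ) (V vJ))))
     (Seq (For vA (V vM) (Write aF (V vA) (V vA)))
          (Assign vQ (V vM)))))"

text \<open>The construction \<open>p\<close> of the expander needs a memory that is zero apart from its input, so it
  runs on arrays beyond those of the main program.\<close>

definition prepare :: "nat \<Rightarrow> program \<Rightarrow> program" where
  "prepare c p =
     Seq (Assign vN (V 0)) (Seq (Assign vE (Read 0 (Add (V vN) (Const 1))))
     (Seq read_graph (Seq (shift 40 p) (Seq read_expander (init_hosts c)))))"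

lemma nth_pairs:
  "j < k \<Longrightarrow> concat (map (\<lambda>e. [f e, g e]) [0..<k]) ! (2 * j) = f j \<and>
     concat (map (\<lambda>e. [f e, g e]) [0..<k]) ! Suc (2 * j) = g j"
proof (induction k)
  case (Suc k)
  have len: "length (concat (map (\<lambda>e. [f e, g e]) [0..<k])) = 2 * k" by (induction k) auto
  show ?case using Suc by (cases "j = k") (auto simp: nth_append len)
qed simp

lemma length_pairs: "length (concat (map (\<lambda>e. [f e, g e]) [0..<k])) = 2 * k"
  by (induction k) auto

lemma nth_enc_digraph:
  assumes "k = card (arcs G)"
  shows "enc_digraph [0..<n] G ! 0 = n" "enc_digraph [0..<n] G ! Suc n = k"
    "j < k \<Longrightarrow> enc_digraph [0..<n] G ! (n + 2 + 2 * j) = tail G j"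
    "j < k \<Longrightarrow> enc_digraph [0..<n] G ! (n + 3 + 2 * j) = head G j"
    "length (enc_digraph [0..<n] G) = n + 2 + 2 * k"
proof -
  let ?P = "concat (map (\<lambda>e. [tail G e, head G e]) [0..<k])"
  let ?xs = "n # [0..<n] @ [k]"
  have eq: "enc_digraph [0..<n] G = ?xs @ ?P"
    using assms by (simp add: enc_digraph_def enc_list_def)
  have len: "length ?xs = n + 2" by simp
  show "enc_digraph [0..<n] G ! 0 = n" "enc_digraph [0..<n] G ! Suc n = k"
    "length (enc_digraph [0..<n] G) = n + 2 + 2 * k"
    unfolding eq by (simp_all add: nth_append length_pairs)
  assume j: "j < k"
  have "(?xs @ ?P) ! (length ?xs + i) = ?P ! i" for i by (rule nth_append_length_plus)
  from this[of "2 * j"] this[of "Suc (2 * j)"] nth_pairs[OF j, of "tail G" "head G"]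
  show "enc_digraph [0..<n] G ! (n + 2 + 2 * j) = tail G j" "enc_digraph [0..<n] G ! (n + 3 + 2 * j) = head G j"
    unfolding eq len by (simp_all add: numeral_3_eq_3 numeral_2_eq_2)
qed

lemma floorlog_bounds2:
  assumes "1 \<le> n"
  shows "n < 2 ^ floorlog 2 n" "2 ^ (floorlog 2 n - 1) \<le> n" "1 \<le> floorlog 2 n" "floorlog 2 n \<le> n"
proof -
  show *: "n < 2 ^ floorlog 2 n" "2 ^ (floorlog 2 n - 1) \<le> n"
    using floorlog_bounds[of n 2] assms by auto
  show "1 \<le> floorlog 2 n" using *(1) assms by (cases "floorlog 2 n") auto
  have "floorlog 2 n - 1 < n" using *(2) less_exp[of "floorlog 2 n - 1"] by linarith
  then show "floorlog 2 n \<le> n" by simp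
qed

lemma floorlog_half: "n \<noteq> 0 \<Longrightarrow> floorlog 2 n = Suc (floorlog 2 (n div 2))"
  using compute_floorlog[of 2 n] by simp

lemma wp_shift:
  assumes "wp B p s Q" "(\<lambda>a. S (a + k)) = s"
  shows "wp B (shift k p) S (\<lambda>t S'. Q t (\<lambda>a. S' (a + k)) \<and> (\<forall>a<k. S' a = S a))"
proof -
  obtain t s' where "run B p s t s'" "Q t s'" using assms(1) by (auto simp: wp_def)
  with run_shift[OF _ assms(2)] obtain S' where S': "run B (shift k p) S t S'" "(\<lambda>a. S' (a + k)) = s'" by blast
  moreover have "S' a = S a" if "a < k" for a
    using run_frame[OF S'(1), of a] writes_shift[of a k p] that by auto
  ultimately show ?thesis using \<open>Q t s'\<close> unfolding wp_def by blast
qed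

lemma wp_prepare:
  fixes W H :: "(nat, nat) pre_digraph"
  assumes W: "fin_digraph W" "verts W = {..<n}" "arcs W = {..<E}" and m: "m = (n + 3) div 4"
    and H: "fin_digraph H" "verts H = {..<m}" "arcs_numbered H" "card (arcs H) \<le> 9 * m"
    and l: "l = floorlog 2 n" "l \<le> n" and n: "1 \<le> n"
    and p: "wp B p (input_memory [m]) (\<lambda>t s. t \<le> tH \<and>
      (\<forall>i<length (enc_digraph [0..<m] H). s 1 i = enc_digraph [0..<m] H ! i))"
    and B: "1000 * (n + E + 10) + c * (l * l) < B" "l * l < B" "c < B"
  shows "wp B (prepare c p) (input_memory (enc_digraph [0..<n] W)) (\<lambda>t s. t \<le> tH + 100 * n + 4 * E + 100 \<and>
    s vN 0 = n \<and> s vE 0 = E \<and> s vM 0 = m \<and> s vR 0 = length (loopless H) \<and> s vEta 0 = c * (l * l) \<and>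
    (\<forall>a<E. s aTl a = tail W a \<and> s aHd a = head W a) \<and>
    (\<forall>e<length (loopless H). s aHT e = tail H (loopless H ! e) \<and> s aHH e = head H (loopless H ! e)) \<and>
    (\<forall>h<m. s aF h = h) \<and> s vQ 0 = m \<and>
    (\<forall>a\<in>{aSide, vRem, aLen, aCnt, vCur, vPos}. s a = (\<lambda>_. 0)))"
proof -
  let ?ys = "enc_digraph [0..<n] W" and ?zs = "enc_digraph [0..<m] H"
  let ?r = "card (arcs H)"
  let ?P = "\<lambda>e. tail H e \<noteq> head H e"
  interpret W: fin_digraph W by (rule W)
  interpret H: fin_digraph H by (rule H)
  have E: "E = card (arcs W)" using W by simp
  have tW: "tail W a < n" "head W a < n" if "a < E" for a
    using W.tail_in_verts[of a] W.head_in_verts[of a] W that by auto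
  have mn: "m \<le> n" "4 * m \<le> n + 3" using n m by auto
  have arcs_H: "arcs H = {..<?r}" using H(3) by (simp add: arcs_numbered_def)
  have tH: "tail H e < m" "head H e < m" if "e < ?r" for e
    using H.tail_in_verts[of e] H.head_in_verts[of e] H(2) arcs_H that by auto
  have Y: "?ys ! 0 = n" "?ys ! Suc n = E" "length ?ys = n + 2 + 2 * E"
    by (simp_all add: nth_enc_digraph(1,2,5)[OF E])
  have YE: "?ys ! (n + 2 + 2 * a) = tail W a" "?ys ! (n + 3 + 2 * a) = head W a" if "a < E" for a
    by (intro nth_enc_digraph(3,4)[OF E] that)+
  have Z: "?zs ! Suc m = ?r" "length ?zs = m + 2 + 2 * ?r"
    by (simp_all add: nth_enc_digraph(1,2,5)[OF refl])
  have ZE: "?zs ! (m + 2 + 2 * e) = tail H e" "?zs ! (m + 3 + 2 * e) = head H e" if "e < ?r" for e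
    by (intro nth_enc_digraph(3,4)[OF refl] that)+
  define s0 where "s0 = input_memory ?ys"
  have in0: "s0 0 i = ?ys ! i" if "i < n + 2 + 2 * E" for i
    using that Y(3) by (simp add: s0_def input_memory_def)
  have zero: "s0 a = (\<lambda>_. 0)" if "a \<noteq> 0" for a
    using that by (auto simp: s0_def input_memory_def)
  define s1 where "s1 = s0(vN := (s0 vN)(0 := n), vE := (s0 vE)(0 := E))"
  have s1z: "s1 a = (\<lambda>_. 0)" if "a \<notin> {0, vN, vE}" for a using that zero by (simp add: s1_def)
  have s1i: "s1 0 i = ?ys ! i" if "i < n + 2 + 2 * E" for i using in0 that by (simp add: s1_def)
  have nB: "n < B" "E < B" "Suc n < B" "Suc 0 < B" "0 < B" using B by auto
  have fl: "length (filter ?P [0..<k]) \<le> k" for k using length_filter_le[of ?P "[0..<k]"] by simp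
  have rest1: "wp B read_graph s1
     (\<lambda>t s. t \<le> 4 * E + 4 \<and> s vN 0 = n \<and> s vE 0 = E \<and> s vM 0 = m \<and>
       (\<forall>a<E. s aTl a = tail W a \<and> s aHd a = head W a) \<and>
       (\<forall>a. a \<notin> {0, vN, vE, vA, aTl, aHd, vM, 40} \<longrightarrow> s a = (\<lambda>_. 0)) \<and> s 40 = (\<lambda>_. 0)(0 := m))"
    unfolding read_graph_def
    apply (subst wp_Seq)
    apply (rule wp_use[OF wp_For[where m = E and c = 2 and
        I = "\<lambda>k s. \<forall>a<k. s aTl a = tail W a \<and> s aHd a = head W a"]])
    subgoal by simp
    subgoal using nB by (simp add: s1_def)
    subgoal premises pre for k s
    proof -
      have "s 0 = s1 0" "s vN 0 = n" using pre(4)[of 0] pre(4)[of vN] by (simp_all add: s1_def)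
      then have v: "s 0 (n + 2 + 2 * k) = tail W k" "s 0 (n + 3 + 2 * k) = head W k" "s vN 0 = n"
        using s1i YE[OF pre(1)] pre(1) by simp_all
      have "n + 3 + 2 * k < B" "n + 2 + 2 * k < B" "2 * k < B" "n + 3 < B" "n + 2 < B" "3 < B" "2 < B" "k < B"
        "tail W k < B" "head W k < B"
        using pre(1) B tW[OF pre(1)] by auto
      then show ?thesis using v pre(1-3) nB by (auto simp: less_Suc_eq add.assoc)
    qed
    subgoal using nB by simp
    subgoal using nB by simp
    subgoal premises pre for t s
    proof -
      have fr: "s a = s1 a" if "a \<notin> {vA, aTl, aHd}" for a using pre(2)[of a] that by simp
      have N: "s vN 0 = n" "s vE 0 = E" by (simp_all add: fr s1_def)
      have z: "s a = (\<lambda>_. 0)" if "a \<notin> {0, vN, vE, vA, aTl, aHd}" for a using that s1z fr by simp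
      have "n + 3 < B" "4 < B" "m < B" "3 < B" using B mn by auto
      then show ?thesis using N m pre(1) nB by (auto simp: z)
    qed
    done
  have rest2: "wp B (shift 40 p) s (\<lambda>t s'. t \<le> tH \<and>
      (\<forall>i<m + 2 + 2 * ?r. s' 41 i = ?zs ! i) \<and> (\<forall>a<40. s' a = s a))"
    if "\<forall>a. a \<notin> {0, vN, vE, vA, aTl, aHd, vM, 40} \<longrightarrow> s a = (\<lambda>_. 0)" "s 40 = (\<lambda>_. 0)(0 := m)" for s
  proof -
    \<comment> \<open>Nothing beyond array 40 has been written so far, and array 40 holds just
      \<open>m\<close>; the construction thus sees exactly its initial memory.\<close>
    have "(\<lambda>a. s (a + 40)) = input_memory [m]"
    proof (intro ext)
      fix a i
      show "s (a + 40) i = input_memory [m] a i"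
        using that by (cases "a = 0") (auto simp: input_memory_def)
    qed
    from wp_shift[OF p this] show ?thesis
      by (rule wp_mono) (use Z(2) in auto)
  qed
  have rest3: "wp B read_expander s
     (\<lambda>t s'. t \<le> 2 + ?r * 6 \<and> s' vR 0 = length (loopless H) \<and>
       (\<forall>e<length (loopless H). s' aHT e = tail H (loopless H ! e) \<and> s' aHH e = head H (loopless H ! e)))"
    if M: "s vM 0 = m" and z: "\<forall>i<m + 2 + 2 * ?r. s 41 i = ?zs ! i" and R: "s vR 0 = 0" for s
    unfolding read_expander_def
  proof (rule wp_use[OF wp_For[where m = ?r and c = 4 and
      I = "\<lambda>k s. s vR 0 = length (filter ?P [0..<k]) \<and> (\<forall>e<length (filter ?P [0..<k]).
        s aHT e = tail H (filter ?P [0..<k] ! e) \<and> s aHH e = head H (filter ?P [0..<k] ! e))"]], goal_cases)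
    case 1
    show ?case using R by simp
  next
    case (2 k s')
    have "s' vM 0 = m" "s' 41 = s 41" using 2(4)[of vM] 2(4)[of 41] M by simp_all
    then show ?case using z Z(1) mn nB H(4) B by auto
  next
    case (3 k s')
    have "s' vM 0 = m" "s' 41 = s 41" using 3(4)[of vM] 3(4)[of 41] M by simp_all
    then have v: "s' vM 0 = m" "s' 41 (m + 2 + 2 * k) = tail H k" "s' 41 (m + 3 + 2 * k) = head H k"
      using z ZE[OF 3(1)] 3(1) by simp_all
    have b: "m + 3 + 2 * k < B" "m + 2 + 2 * k < B" "2 * k < B" "m + 3 < B" "m + 2 < B" "3 < B" "2 < B" "k < B"
      "tail H k < B" "head H k < B" "m < B"
      using 3(1) B tH[OF 3(1)] mn H(4) by auto
    have "Suc (s' vR 0) < B" using 3(2) fl[of k] 3(1) H(4) B mn by auto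
    then show ?case
      using v b 3(1-3) nB by (cases "?P k") (auto simp: nth_append less_Suc_eq add.assoc)
  next
    case 4
    show ?case using H(4) mn B by simp
  next
    case 5
    show ?case using nB by simp
  next
    case (6 t s')
    then show ?case by (simp add: loopless_def)
  qed
  have rest4: "wp B (init_hosts c) s
     (\<lambda>t s'. t \<le> 6 * n + 10 \<and> s' vEta 0 = c * (l * l) \<and> (\<forall>h<m. s' aF h = h) \<and> s' vQ 0 = m)"
    if N: "s vN 0 = n" "s vM 0 = m" "s vJ 0 = 0" for s
  proof -
    define s2 where "s2 = s(vX := (s vX)(0 := n))"
    have "wp B (While (V vX) (Seq (Assign vX (Div (V vX) (Const 2))) (Assign vJ (Add (V vJ) (Const 1))))) s2
       (\<lambda>t s'. (s' vJ 0 + floorlog 2 (s' vX 0) = l \<and> s' vX 0 \<le> n) \<and> val s' (V vX) = 0 \<and>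
         t \<le> Suc (3 * floorlog 2 (s2 vX 0)))"
    proof (rule wp_While[where \<Phi> = "\<lambda>s. 3 * floorlog 2 (s vX 0)"], goal_cases)
      case 1
      show ?case using N l by (simp add: s2_def)
    next
      case (2 s')
      then show ?case using nB by auto
    next
      case (3 s')
      have ne: "s' vX 0 \<noteq> 0" using 3 by simp
      have "s' vX 0 div 2 \<le> s' vX 0" by simp
      then have b: "s' vX 0 div 2 \<le> n" "s' vX 0 div 2 < B" "s' vX 0 < B" using 3(1) nB by linarith+
      have "Suc (s' vJ 0) \<le> l" using 3(1) floorlog_half[OF ne] by linarith
      then have "Suc (s' vJ 0) < B" "s' vJ 0 < B" using l nB by linarith+
      then show ?case using 3(1) b nB floorlog_half[OF ne] B by (simp add: numeral_2_eq_2[symmetric])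
    qed
    then have loop: "wp B (While (V vX) (Seq (Assign vX (Div (V vX) (Const 2))) (Assign vJ (Add (V vJ) (Const 1))))) s2
       (\<lambda>t s'. s' vJ 0 = l \<and> t \<le> Suc (3 * n))"
      by (rule wp_mono) (use l in \<open>auto simp: s2_def floorlog_def\<close>)
    have lB: "l < B" using l nB by simp
    show ?thesis
      unfolding init_hosts_def
      apply (subst wp_Seq, subst wp_Write)
      apply (intro conjI)
      subgoal using nB by simp
      subgoal using N nB by simp
      apply (subst wp_Seq)
      subgoal premises pre
      proof -
        have eq: "s(vX := (s vX)(val s (Const 0) := val s (V vN))) = s2" using N by (simp add: s2_def)
        show ?thesis
          unfolding eq
          apply (rule wp_use[OF loop])
          subgoal premises pre2 for t3 s3
          proof -
            have N3: "s3 vN 0 = n" "s3 vM 0 = m" using pre2(2)[of vN] pre2(2)[of vM] N by (simp_all add: s2_def)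
            define s4 where "s4 = s3(vEta := (s3 vEta)(0 := c * (l * l)))"
            have mB: "m < B" using mn nB by simp
            have "wp B (For vA (V vM) (Write aF (V vA) (V vA))) s4
               (\<lambda>t s. t \<le> 2 + m * (1 + 2) \<and> (\<forall>h<m. s aF h = h) \<and> s vA 0 = m)"
              by (rule wp_For) (use N3 nB mB in \<open>auto simp: s4_def less_Suc_eq\<close>)
            then have "wp B (For vA (V vM) (Write aF (V vA) (V vA))) s4
               (\<lambda>t s. fits B s (V vM) \<and> t3 + t + 3 \<le> 6 * n + 10 \<and> (s(vQ := (s vQ)(0 := s vM 0))) vEta 0 = c * (l * l) \<and>
                 (\<forall>h<m. s aF h = h) \<and> s vM 0 = m)"
            proof (rule wp_use, goal_cases)
              case (1 t s)
              have "s vM 0 = m" "s vEta 0 = c * (l * l)" using 1(2)[of vM] 1(2)[of vEta] N3 by (simp_all add: s4_def)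
              then show ?case using 1(1) pre2(1) mn nB by simp
            qed
            then show ?thesis
              using pre2(1) N3 nB lB B
              by (simp add: s4_def[symmetric])
          qed
          done
      qed
      done
  qed
  show ?thesis
    unfolding prepare_def s0_def[symmetric]
    apply (subst wp_Seq, subst wp_Write)
    apply (intro conjI)
    subgoal using nB by simp
    subgoal using nB in0[of 0] Y(1) by simp
    apply (subst wp_Seq, subst wp_Write)
    apply (intro conjI)
    subgoal using nB by simp
    subgoal using nB in0[of 0] Y(1,2) in0[of "Suc n"] by simp
    subgoal premises pre
    proof -
      define s' where "s' = s0(vN := (s0 vN)(val s0 (Const 0) := val s0 (V 0)))"
      have eq: "s'(vE := (s' vE)(val s' (Const 0) := val s' (Read 0 (Add (V vN) (Const 1))))) = s1"
        using in0[of 0] Y(1,2) in0[of "Suc n"] by (simp add: s1_def s'_def)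
      show ?thesis
        unfolding eq[unfolded s'_def]
        apply (subst wp_Seq)
        apply (rule wp_use[OF rest1])
        apply (subst wp_Seq)
        subgoal premises pre1 for t1 s1
          apply (rule wp_use[OF rest2])
          subgoal using pre1(1) by blast
          subgoal using pre1(1) by blast
          apply (subst wp_Seq)
          subgoal premises pre2 for t2 s2
          proof -
            have fr2: "s2 a = s1 a" if "a < 40" for a using pre2(1) that by blast
            have z2: "s2 a = (\<lambda>_. 0)" if "a < 40" "a \<notin> {0, vN, vE, vA, aTl, aHd, vM}" for a
              using pre1(1) fr2[OF that(1)] that by simp
            have v2: "s2 vN 0 = n" "s2 vE 0 = E" "s2 vM 0 = m" "s2 aTl = s1 aTl" "s2 aHd = s1 aHd"
              using pre1(1) by (simp_all add: fr2)
            show ?thesis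
              apply (rule wp_use[OF rest3])
              subgoal by (rule v2)
              subgoal using pre2(1) by blast
              subgoal by (simp add: z2)
              subgoal premises pre3 for t3 s3
              proof -
                have fr3: "s3 a = s2 a" if "a \<notin> {vA, aHT, aHH, vR}" for a
                  using pre3(2)[of a] that by (simp add: read_expander_def)
                have v3: "s3 vN 0 = n" "s3 vM 0 = m" "s3 vJ 0 = 0" using v2 by (simp_all add: fr3 z2)
                show ?thesis
                  apply (rule wp_use[OF rest4[of s3, OF v3]])
                  subgoal premises pre4 for t4 s4
                  proof -
                    have fr4: "s4 a = s3 a" if "a \<notin> {vX, vJ, vEta, vA, aF, vQ}" for a
                      using pre4(2)[of a] that by (simp add: init_hosts_def)
                    have "1 + (1 + (t1 + (t2 + (t3 + t4)))) \<le> tH + 100 * n + 4 * E + 100"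
                      using pre1(1) pre2(1) pre3(1) pre4(1) H(4) mn by linarith
                    moreover have "s4 a = (\<lambda>_. 0)" if "a \<in> {aSide, vRem, aLen, aCnt, vCur, vPos}" for a
                      using that by (auto simp: fr4 fr3 z2)
                    ultimately show ?thesis
                      using pre1(1) pre3(1) pre4(1) v2 by (simp add: fr4 fr3)
                  qed
                  done
              qed
              done
          qed
          done
        done
    qed
    done
qed

section \<open>The algorithm\<close>

definition finish :: program where
  "finish = If (Sub (V vN) (Mul (Const 5) (V vRem))) print_expander print_cut"

text \<open>For \<open>n < 5\<close> a single vertex is a valid expander; its encoding is \<open>[2, 1, 0, 0, 0]\<close>.\<close>

definition algorithm :: "nat \<Rightarrow> program \<Rightarrow> program" where
  "algorithm c p =
     If (Sub (Const 5) (V 0))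
       (Seq (Write 1 (Const 0) (Const 2)) (Write 1 (Const 1) (Const 1)))
       (Seq (prepare c p) (Seq main_loop finish))"

context router_machine
begin

definition core_cost :: nat where
  "core_cost = 3 * (r + r * n) + iter_cost * (r + 19 * n) + 44 * n + 20 * r + 50 + r * (4 * n + 4)"

definition correct_output :: "nat list \<Rightarrow> bool" where
  "correct_output ys \<longleftrightarrow>
     (\<exists>A. is_cut W A ({..<n} - A) \<and> 100 * card (arcs_between W A ({..<n} - A)) \<le> n \<and>
        n \<le> 10 * card A \<and> n \<le> 10 * card ({..<n} - A) \<and>
        ys = enc_cut (filter (\<lambda>v. v \<in> A) [0..<n]) (filter (\<lambda>v. v \<notin> A) [0..<n])) \<or>
     (\<exists>f P. inj_on f {..<m} \<and> f ` {..<m} \<subseteq> {..<n} \<and> is_embedding (host_graph f) W P \<and>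
        (\<forall>e\<in>arcs (host_graph f). length (P e) \<le> d) \<and> congestion (host_graph f) W P \<le> \<eta> \<and>
        ys = enc_expander (map f [0..<m]) (host_graph f) [] P)"

lemma wp_finish:
  assumes st: "static s0" and inv: "invs s0" and pos: "s0 vPos 0 = 0"
    and stop: "s0 vCur 0 = r \<or> n \<le> 5 * s0 vRem 0"
  shows "wp B finish s0 (\<lambda>t s. t \<le> 44 * n + 20 * r + 31 + r * (4 * n + 4) \<and>
    (\<exists>ys. printed s ys \<and> correct_output ys))"
proof -
  note BB = B_bounds m_bounds d_le
  have inv': "inv (s0 aF) (s0 vQ 0) (s0 aSide) (s0 vRem 0) (s0 aLen) (s0 aPath) (s0 aCnt) (s0 vCur 0)"
    using inv by (simp add: invs_def)
  then have so: "split_ok (s0 aSide) (s0 vRem 0) (s0 aCnt)" and h: "hosted (s0 aF) (s0 vQ 0) (s0 aSide)"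
    by (auto simp: inv_def)
  have rem: "s0 vRem 0 \<le> n" using card_left_eq[OF so] by simp
  have v: "s0 vN 0 = n" using st by (simp add: static_def)
  have fits: "fits B s0 (Sub (V vN) (Mul (Const 5) (V vRem)))"
    using v rem BB by (auto intro: less_imp_diff_less)
  show ?thesis
  proof (cases "n \<le> 5 * s0 vRem 0")
    case True
    note F = final_cut[OF inv' True cut_side_def]
    have "correct_output (enc_cut (filter (\<lambda>v. v \<in> cut_side s0) [0..<n]) (filter (\<lambda>v. v \<notin> cut_side s0) [0..<n]))"
      unfolding correct_output_def using F by blast
    moreover have "wp B print_cut s0 (\<lambda>t s. t \<le> 24 * n + 30 \<and>
       printed s (enc_cut (filter (\<lambda>v. v \<in> cut_side s0) [0..<n]) (filter (\<lambda>v. v \<notin> cut_side s0) [0..<n])))"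
      by (rule wp_print_cut[OF st so pos])
    ultimately have "wp B print_cut s0 (\<lambda>t s. 1 + t \<le> 44 * n + 20 * r + 31 + r * (4 * n + 4) \<and>
      (\<exists>ys. printed s ys \<and> correct_output ys))"
      by (elim wp_mono) auto
    then show ?thesis unfolding finish_def using fits v True by simp
  next
    case False
    then have cur: "s0 vCur 0 = r" using stop by simp
    let ?P = "path_of (s0 aPath) (s0 aLen)"
    let ?G = "host_graph (s0 aF)"
    let ?ys = "2 # enc_list (map (s0 aF) [0..<m]) @
       r # concat (map (\<lambda>e. [s0 aF (ht e), s0 aF (hh e)]) [0..<r]) @ [0] @
       concat (map (\<lambda>e. enc_list (?P e)) [0..<r])"
    have "?ys = enc_expander (map (s0 aF) [0..<m]) ?G [] ?P"
      by (simp add: enc_expander_def enc_digraph_def enc_list_def host_graph_def)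
    moreover have "is_embedding ?G W ?P" "\<forall>e\<in>arcs ?G. length (?P e) \<le> d" "congestion ?G W ?P \<le> \<eta>"
      by (rule host_graph_embedding[OF inv'[unfolded cur]])+
    moreover have "inj_on (s0 aF) {..<m}" "s0 aF ` {..<m} \<subseteq> {..<n}"
      using h by (auto simp: hosted_def intro: less_le_trans)
    ultimately have "correct_output ?ys" unfolding correct_output_def by blast
    with wp_print_expander[OF st inv pos]
    have "wp B print_expander s0 (\<lambda>t s. 1 + t \<le> 44 * n + 20 * r + 31 + r * (4 * n + 4) \<and>
      (\<exists>ys. printed s ys \<and> correct_output ys))"
      by (elim wp_mono) auto
    then show ?thesis unfolding finish_def using fits v False by simp
  qed
qed

lemma wp_core:
  assumes st: "static s0" and f: "\<forall>h<m. s0 aF h = h" "s0 vQ 0 = m"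
    and zero: "\<forall>a\<in>{aSide, vRem, aLen, aCnt, vCur, vPos}. s0 a = (\<lambda>_. 0)"
  shows "wp B (Seq main_loop finish) s0 (\<lambda>t s. t \<le> core_cost \<and> (\<exists>ys. printed s ys \<and> correct_output ys))"
proof -
  have inv: "invs s0" using inv_init[of "s0 aF" "s0 aPath"] f zero by (simp add: invs_def)
  have pot: "potential s0 = 3 * (r + r * n) + iter_cost * (r + 19 * n)"
    using zero by (simp add: potential_def unrouted_def)
  show ?thesis
    apply (subst wp_Seq)
    apply (rule wp_use[OF wp_main_loop[OF st inv]])
    subgoal premises pre for t1 s1
    proof -
      have fr: "s1 a = s0 a" if "a \<in> {vN, vE, vM, vR, vEta, aHT, aHH, aTl, aHd, vPos}" for a
        using pre(2)[of a] that by (auto simp: main_loop_def main_body_def writes_programs)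
      have st1: "static s1" by (rule static_cong[OF st]) (simp_all add: fr)
      show ?thesis
        by (rule wp_mono[OF wp_finish[OF st1]])
          (use pre(1) zero pot in \<open>auto simp: fr core_cost_def\<close>)
    qed
    done
qed

end

section \<open>Running time, asymptotics and word length\<close>

lemma cost_bound:
  fixes n L C E r d t :: nat
  assumes n: "1 \<le> n" and L: "1 \<le> L" and C: "1 \<le> C" and E: "E \<le> C * L * n" and r: "r \<le> 9 * n"
    and d: "d = 400 * (C * L) * L" and t: "t \<le> c * n"
  defines "i \<equiv> 3 * n + 10 + d * (14 * E + 20) + (20 * n + 4 * r + 20) + 5 * d + 20"
  shows "1 + (t + 100 * n + 4 * E + 100) +
      (3 * (r + r * n) + i * (r + 19 * n) + 44 * n + 20 * r + 50 + r * (4 * n + 4))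
    \<le> (10000 + c + 800000 * C * C) * n\<^sup>2 * L ^ 3"
proof -
  \<comment> \<open>\<open>Z\<close> is the order of \<open>d * E\<close>: two factors
    \<open>L\<close> and one \<open>C\<close> come from \<open>d\<close>, another \<open>L\<close>
    and \<open>C\<close> from \<open>E\<close>. One iteration costs O(Z), and
    \<open>r + 19 * n <= 28 * n\<close> iterations dominate the total.\<close>
  define Y where "Y = n * L ^ 3"
  define Z where "Z = C * C * Y"
  have pow: "L \<le> L ^ 3" "L ^ 2 \<le> L ^ 3" "1 \<le> L ^ 3"
    using L self_le_power[of L 3] power_increasing[of 2 3 L] by auto
  have Y: "n \<le> Y" "1 \<le> Y" "L ^ 2 \<le> Y" "L * n \<le> Y"
    using mult_le_mono[of n n 1 "L ^ 3"] mult_le_mono[of 1 n 1 "L ^ 3"] mult_le_mono[of 1 n "L ^ 2" "L ^ 3"]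
      mult_le_mono[of n n L "L ^ 3"] pow n by (simp_all add: Y_def mult.commute)
  have CC: "1 \<le> C * C" "C \<le> C * C" using C by simp_all
  have YZ: "Y \<le> Z" "C * Y \<le> Z"
    using mult_le_mono1[OF CC(1), of Y] mult_le_mono1[OF CC(2), of Y] by (simp_all add: Z_def)
  have dY: "d \<le> 400 * Z"
  proof -
    have "d = 400 * (C * L ^ 2)" by (simp add: d power2_eq_square)
    also have "\<dots> \<le> 400 * (C * Y)" using Y(3) by simp
    finally show ?thesis using YZ by simp
  qed
  have "d * E \<le> 400 * (C * L) * L * (C * L * n)" unfolding d by (rule mult_le_mono2[OF E])
  also have "\<dots> = 400 * Z" by (simp add: Z_def Y_def power3_eq_cube)
  finally have dE: "d * E \<le> 400 * Z" .
  have EZ: "E \<le> Z"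
  proof -
    have "E \<le> C * (L * n)" using E by simp
    also have "\<dots> \<le> C * Y" using Y(4) by simp
    finally show ?thesis using YZ by simp
  qed
  have "i = 23 * n + 50 + 14 * (d * E) + 25 * d + 4 * r" by (simp add: i_def algebra_simps)
  also have "\<dots> \<le> 23 * Y + 50 * Y + 14 * (400 * Z) + 25 * (400 * Z) + 36 * Y"
    using Y dY dE r by linarith
  also have "\<dots> \<le> 109 * Z + 15600 * Z" using YZ by simp
  finally have i: "i \<le> 16000 * Z" by simp
  have X: "n * Y = n\<^sup>2 * L ^ 3" by (simp add: Y_def power2_eq_square)
  have nY: "Y \<le> n * Y" "n * n \<le> n * Y" using n Y by simp_all
  have nZ: "Z \<le> n * Z" using n by simp
  have "i * (r + 19 * n) \<le> (16000 * Z) * (28 * n)" using i r by (intro mult_le_mono) simp_all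
  then have 1: "i * (r + 19 * n) \<le> 448000 * (n * Z)" by (simp add: ac_simps)
  have "r * n \<le> 9 * n * n" using r by (rule mult_le_mono1)
  then have rn: "r * n \<le> 9 * (n * Y)" using nY(2) by linarith
  have cn: "c * n \<le> c * (n * Y)" using Y nY by (meson le_trans mult_le_mono2)
  have r4: "r * (4 * n + 4) = 4 * (r * n) + 4 * r" by (simp add: algebra_simps)
  \<comment> \<open>Products are abstracted to variables here and in the next step, so that only
    linear inequalities remain.\<close>
  have sum: "1 + (t + 100 * n + 4 * E + 100) + (3 * (r + u) + q + 44 * n + 20 * r + 50 + v)
      \<le> 151 + k + 144 * n + 4 * E + 27 * r + 7 * u + 448000 * z"
    if "v = 4 * u + 4 * r" "q \<le> 448000 * z" "t \<le> k" for u v q z k :: nat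
    using that(2,3) unfolding that(1) by simp
  have sum': "151 + k + 144 * n + 4 * E + 27 * r + 7 * u + 448000 * z
      \<le> 151 * y + k' + 144 * y + 4 * z + 243 * y + 63 * y + 448000 * z"
    if "k \<le> k'" "n \<le> y" "1 \<le> y" "E \<le> z" "r \<le> 9 * n" "u \<le> 9 * y" for u z y k k' :: nat
    using that by simp
  have "1 + (t + 100 * n + 4 * E + 100) +
      (3 * (r + r * n) + i * (r + 19 * n) + 44 * n + 20 * r + 50 + r * (4 * n + 4))
    \<le> 151 + c * n + 144 * n + 4 * E + 27 * r + 7 * (r * n) + 448000 * (n * Z)"
    by (rule sum[OF r4 1 t])
  also have "\<dots> \<le> 151 * (n * Y) + c * (n * Y) + 144 * (n * Y) + 4 * (n * Z) + 243 * (n * Y) + 63 * (n * Y) + 448000 * (n * Z)"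
    by (rule sum'[OF cn le_trans[OF Y(1) nY(1)] le_trans[OF Y(2) nY(1)] le_trans[OF EZ nZ] r rn])
  also have "\<dots> \<le> 10000 * (n * Y) + c * (n * Y) + 800000 * (n * Z)" by simp
  also have "\<dots> = (10000 + c + 800000 * C * C) * (n * Y)" by (simp add: Z_def algebra_simps)
  also have "\<dots> = (10000 + c + 800000 * C * C) * n\<^sup>2 * L ^ 3" by (simp add: X mult.assoc)
  finally show ?thesis .
qed

text \<open>The program and its time bound need constants valid for every \<open>n >= 1\<close>, not
  only eventually. Since \<open>h >= 1\<close>, the finitely many exceptional values are absorbed
  into \<open>C\<close>. The logarithm itself would not do as \<open>h\<close>, because
  \<open>ln 1 = 0\<close>; the number of binary digits does.\<close>

lemma bigo_uniform:
  fixes f g h :: "nat \<Rightarrow> real"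
  assumes "f \<in> O(g)" and gh: "\<And>n. 1 \<le> n \<Longrightarrow> \<bar>g n\<bar> \<le> h n" "\<And>n. 1 \<le> n \<Longrightarrow> 1 \<le> h n"
  shows "\<exists>C::nat. 1 \<le> C \<and> (\<forall>n\<ge>1. f n \<le> real C * h n)"
proof -
  obtain c where c: "c > 0" "\<forall>\<^sub>F n in sequentially. norm (f n) \<le> c * norm (g n)"
    using assms(1) landau_o.bigE by blast
  then obtain N where N: "\<And>n. n \<ge> N \<Longrightarrow> \<bar>f n\<bar> \<le> c * \<bar>g n\<bar>"
    by (auto simp: eventually_sequentially)
  obtain C :: nat where C: "c + (\<Sum>i<N. \<bar>f i\<bar>) + 1 \<le> real C" using real_arch_simple by blast
  have s: "0 \<le> (\<Sum>i<N. \<bar>f i\<bar>)" by (rule sum_nonneg) simp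
  have "f n \<le> real C * h n" if n: "1 \<le> n" for n
  proof (cases "n < N")
    case True
    then have "\<bar>f n\<bar> \<le> (\<Sum>i<N. \<bar>f i\<bar>)" by (intro member_le_sum) auto
    then have "f n \<le> real C * 1" using C c by linarith
    also have "\<dots> \<le> real C * h n" using gh(2)[OF n] by (intro mult_left_mono) auto
    finally show ?thesis .
  next
    case False
    then have "f n \<le> c * \<bar>g n\<bar>" using N[of n] by simp
    also have "c \<le> real C" using C s by linarith
    then have "c * \<bar>g n\<bar> \<le> real C * h n" using gh(1)[OF n] by (intro mult_mono) auto
    finally show ?thesis .
  qed
  moreover have "1 \<le> C" using C s c by linarith
  ultimately show ?thesis by blast
qed

lemma ln_le_floorlog: "1 \<le> n \<Longrightarrow> ln (real n) \<le> real (floorlog 2 n)"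
proof -
  assume n: "1 \<le> n"
  have "ln (real n) \<le> ln (2 ^ floorlog 2 n)"
    using floorlog_bounds2(1)[OF n] n by (subst ln_le_cancel_iff) (auto simp flip: of_nat_less_iff)
  also have "\<dots> = real (floorlog 2 n) * ln 2" by (simp add: ln_realpow)
  also have "\<dots> \<le> real (floorlog 2 n) * 1" by (intro mult_left_mono) (use ln_le_minus_one[of 2] in auto)
  finally show ?thesis by simp
qed

text \<open>The number of digits is at most one more than the binary logarithm, hence at most twice
  the binary logarithm once \<open>n >= 2\<close>; this is the constant 2 / ln 2.\<close>

lemma floorlog_bigo: "(\<lambda>n. real (floorlog 2 n)) \<in> O(\<lambda>n. ln (real n))"
proof (rule bigoI[where c = "2 / ln 2"])
  have "real (floorlog 2 n) \<le> 2 / ln 2 * ln (real n)" if n: "2 \<le> n" for n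
  proof -
    have "2 ^ (floorlog 2 n - 1) \<le> n" using floorlog_bounds2(2)[of n] n by simp
    then have "(2::real) ^ (floorlog 2 n - 1) \<le> real n" by (metis of_nat_le_iff of_nat_numeral of_nat_power)
    then have "ln ((2::real) ^ (floorlog 2 n - 1)) \<le> ln (real n)" by (subst ln_le_cancel_iff) (use n in auto)
    then have "real (floorlog 2 n - 1) * ln 2 \<le> ln (real n)" by (simp add: ln_realpow)
    moreover have "ln 2 \<le> ln (real n)" using n by simp
    moreover have "real (floorlog 2 n) * ln 2 = real (floorlog 2 n - 1) * ln 2 + ln 2"
      using floorlog_bounds2(3)[of n] n by (cases "floorlog 2 n") (simp_all add: distrib_right)
    ultimately have "real (floorlog 2 n) * ln 2 \<le> 2 * ln (real n)" by linarith
    then show ?thesis by (simp add: field_simps)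
  qed
  then show "\<forall>\<^sub>F n in sequentially. norm (real (floorlog 2 n)) \<le> 2 / ln 2 * norm (ln (real n))"
    unfolding eventually_sequentially by (intro exI[of _ 2]) auto
qed

text \<open>Everything is at most \<open>K\<close> times the square of \<open>n\<close>, where 21000
  covers 660 + 20000 and 3000000 covers 1000 + 2160000. The constant \<open>K\<close> is absorbed
  into the exponent, because \<open>K\<close> is less than \<open>2 ^ K\<close> and hence than
  \<open>n ^ K\<close>.\<close>

lemma word_bound_large:
  fixes n :: nat
  assumes n: "5 \<le> n" and r: "r \<le> 9 * n" and E: "E \<le> C * L * n" and L: "L \<le> n"
    and K: "21000 + 3000000 * C \<le> K" and k: "2 + K \<le> k"
  shows "20 * (n + 10) * (r + 10) + 1000 * (n + E + r + 10) + 2160000 * C * (L * L) < word_bound k n"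
proof -
  have sq: "n \<le> n\<^sup>2" "1 \<le> n\<^sup>2" using n self_le_power[of n 2] by simp_all
  have "20 * (n + 10) * (r + 10) \<le> 20 * (3 * n) * (11 * n)" using n r by (intro mult_le_mono) simp_all
  then have 1: "20 * (n + 10) * (r + 10) \<le> 660 * n\<^sup>2" by (simp add: power2_eq_square)
  have "C * L * n \<le> C * n * n" using L by (intro mult_le_mono) simp_all
  from le_trans[OF E this] have 2: "E \<le> C * n\<^sup>2" by (simp add: power2_eq_square mult.assoc)
  have 3: "C * (L * L) \<le> C * n\<^sup>2" unfolding power2_eq_square by (intro mult_le_mono2 mult_le_mono L)
  have "20 * (n + 10) * (r + 10) + 1000 * (n + E + r + 10) + 2160000 * C * (L * L)
      \<le> 660 * n\<^sup>2 + 1000 * (n\<^sup>2 + C * n\<^sup>2 + 9 * n\<^sup>2 + 10 * n\<^sup>2) + 2160000 * (C * n\<^sup>2)"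
  proof -
    have "a + 1000 * (n + E + r + 10) + 2160000 * b
        \<le> 660 * q + 1000 * (q + e + 9 * q + 10 * q) + 2160000 * e"
      if "a \<le> 660 * q" "E \<le> e" "b \<le> e" "n \<le> q" "1 \<le> q" for a b q e :: nat
      using that r by simp
    from this[OF 1 2 3 sq] show ?thesis by (simp only: mult.assoc)
  qed
  also have "\<dots> \<le> (21000 + 3000000 * C) * n\<^sup>2" by (simp add: algebra_simps)
  also have "\<dots> \<le> K * n\<^sup>2" by (rule mult_le_mono1[OF K])
  also have "\<dots> \<le> 2 ^ K * n\<^sup>2" by (intro mult_le_mono1 less_imp_le less_exp)
  also have "\<dots> \<le> n ^ K * n\<^sup>2" using n by (intro mult_le_mono1 power_mono) simp_all
  also have "\<dots> = n ^ (2 + K)" by (simp only: power_add mult.commute)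
  also have "\<dots> \<le> n ^ k" using n k by (intro power_increasing) simp_all
  also have "\<dots> < word_bound k n" using k by (simp add: word_bound_def)
  finally show ?thesis .
qed

lemma wp_algorithm_small:
  assumes "n < 5" "5 < B" "s 0 0 = n" "\<And>i. s 1 i = 0"
  shows "wp B (algorithm c p) s (\<lambda>t s. t \<le> 3 \<and> (\<forall>i<5. s 1 i = [2, 1, 0, 0, 0] ! i))"
  unfolding algorithm_def using assms by (auto simp: less_Suc_eq numeral_eq_Suc)

lemma singleton_expander: "verts G = {v} \<Longrightarrow> is_expander \<phi> G"
  unfolding is_expander_def is_cut_def by (auto simp: Un_singleton_iff)

lemma printed_outputs_within:
  assumes "wp B p (input_memory xs) (\<lambda>t s. t \<le> T \<and> printed s ys)" "real T \<le> T'"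
  shows "outputs_within p B xs T' ys"
proof -
  obtain t s where "run B p (input_memory xs) t s" "t \<le> T" "printed s ys"
    using assms(1) unfolding wp_def by blast
  moreover have "real t \<le> T'" using \<open>t \<le> T\<close> assms(2) by simp
  ultimately show ?thesis unfolding outputs_within_def printed_def by blast
qed

theorem theorem8p5:
  fixes \<alpha> :: real and \<Delta> :: "nat \<Rightarrow> real"
  assumes "\<alpha> > 0"
    and "explicit_expanders \<alpha>"
    and "\<Delta> \<in> O(\<lambda>n. ln (real n))"
  shows "\<exists>(p :: program) (k :: nat) (T :: nat \<Rightarrow> real) (d :: nat \<Rightarrow> nat) (\<eta> :: nat \<Rightarrow> nat).
    T \<in> soft_O (\<lambda>n. real n ^ 2) \<and>
    (\<lambda>n. real (d n)) \<in> O(\<lambda>n. ln (real n) ^ 2) \<and>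
    (\<lambda>n. real (\<eta> n)) \<in> O(\<lambda>n. ln (real n) ^ 2) \<and>
    (\<forall>n \<ge> 1. \<forall>W :: (nat, nat) pre_digraph.
       fin_digraph W \<longrightarrow> verts W = {..<n} \<longrightarrow> arcs_numbered W \<longrightarrow>
       (\<forall>v \<in> verts W. real (degree W v) \<le> \<Delta> n) \<longrightarrow>
       (\<exists>as bs.
          distinct as \<and> distinct bs \<and>
          is_cut W (set as) (set bs) \<and>
          real (card (arcs_between W (set as) (set bs))) \<le> real n / 100 \<and>
          real (card (set as)) \<ge> real n / 10 \<and> real (card (set bs)) \<ge> real n / 10 \<and>
          outputs_within p (word_bound k n) (enc_digraph [0..<n] W) (T n) (enc_cut as bs)) \<or>
       (\<exists>(W' :: (nat, nat) pre_digraph) vs fs P.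
          fin_digraph W' \<and> loopfree_digraph W' \<and> arcs_numbered W' \<and>
          distinct vs \<and> set vs = verts W' \<and>
          verts W' \<subseteq> verts W \<and> real (card (verts W')) \<ge> real n / 4 \<and>
          (\<forall>v \<in> verts W'. degree W' v \<le> 18) \<and>
          is_expander \<alpha> W' \<and>
          distinct fs \<and> set fs \<subseteq> arcs W' \<and> real (card (set fs)) \<le> \<alpha> * real n / 1000 \<and>
          is_embedding (remove_arcs W' (set fs)) W P \<and>
          (\<forall>e \<in> arcs W' - set fs. length (P e) \<le> d n) \<and>
          congestion (remove_arcs W' (set fs)) W P \<le> \<eta> n \<and>
          outputs_within p (word_bound k n) (enc_digraph [0..<n] W) (T n)
            (enc_expander vs W' fs P)))"
proof -
  obtain H pH kH TH where TH: "TH \<in> O(\<lambda>n. real n)"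
    and H: "\<forall>n>1. fin_digraph (H n) \<and> verts (H n) = {..<n} \<and> arcs_numbered (H n) \<and>
           is_expander \<alpha> (H n) \<and>
           (\<forall>v \<in> verts (H n). in_degree (H n) v \<le> 9 \<and> out_degree (H n) v \<le> 9) \<and>
           outputs_within pH (word_bound kH n) [n] (TH n) (enc_digraph [0..<n] (H n))"
    using assms(2) unfolding explicit_expanders_def by blast
  let ?L = "\<lambda>n. floorlog 2 n"
  have "\<exists>C::nat. 1 \<le> C \<and> (\<forall>n\<ge>1. \<Delta> n \<le> real C * real (?L n))"
  proof (rule bigo_uniform[OF assms(3)])
    fix n :: nat assume n: "1 \<le> n"
    show "\<bar>ln (real n)\<bar> \<le> real (?L n)" using ln_le_floorlog[OF n] n by simp
    show "1 \<le> real (?L n)" using floorlog_bounds2(3)[OF n] by simp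
  qed
  then obtain C where C: "1 \<le> C" "\<And>n. 1 \<le> n \<Longrightarrow> \<Delta> n \<le> real C * real (?L n)" by blast
  obtain c where c: "1 \<le> c" "\<And>n. 1 \<le> n \<Longrightarrow> TH n \<le> real c * real n"
    using bigo_uniform[OF TH, of real] by auto
  \<comment> \<open>The program depends only on \<open>pH\<close> and on the constant
    \<open>C\<close> obtained from the degree bound, so it is one fixed program for all
    \<open>n\<close>.\<close>
  define p where "p = algorithm (2160000 * C) pH"
  obtain k where k: "2 + (21000 + 3000000 * C) \<le> k" "kH \<le> k"
    by (metis le_add1 le_add2)
  then have k5: "5 < k" by simp
  define K where "K = 10000 + c + 800000 * C * C"
  define T where "T n = real (K * n\<^sup>2 * ?L n ^ 3)" for n
  define d where "d n = 400 * (C * ?L n) * ?L n" for n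
  define \<eta> where "\<eta> n = 5400 * d n" for n
  have L2: "(\<lambda>n. real (?L n) * real (?L n)) \<in> O(\<lambda>n. ln (real n) ^ 2)"
    unfolding power2_eq_square by (intro landau_o.big_mult floorlog_bigo)
  have T: "T \<in> soft_O (\<lambda>n. real n ^ 2)"
  proof -
    have "(\<lambda>n. real n ^ 2 * real (?L n) ^ 3) \<in> O(\<lambda>n. real n ^ 2 * ln (real n) ^ 3)"
      by (intro landau_o.big_mult landau_o.big_power floorlog_bigo) simp
    then have "(\<lambda>n. real K * (real n ^ 2 * real (?L n) ^ 3)) \<in> O(\<lambda>n. real n ^ 2 * ln (real n) ^ 3)"
      by simp
    moreover have "T = (\<lambda>n. real K * (real n ^ 2 * real (?L n) ^ 3))"
      by (simp add: T_def fun_eq_iff)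
    ultimately show ?thesis unfolding soft_O_def by blast
  qed
  have d: "(\<lambda>n. real (d n)) \<in> O(\<lambda>n. ln (real n) ^ 2)"
  proof -
    have "(\<lambda>n. real (d n)) = (\<lambda>n. real (400 * C) * (real (?L n) * real (?L n)))"
      by (simp add: d_def fun_eq_iff)
    then show ?thesis using L2 by simp
  qed
  have \<eta>: "(\<lambda>n. real (\<eta> n)) \<in> O(\<lambda>n. ln (real n) ^ 2)"
  proof -
    have "(\<lambda>n. real (\<eta> n)) = (\<lambda>n. real (5400 * 400 * C) * (real (?L n) * real (?L n)))"
      by (simp add: \<eta>_def d_def fun_eq_iff)
    then show ?thesis using L2 by simp
  qed
  show ?thesis
  proof (rule exI[of _ p], rule exI[of _ k], rule exI[of _ T], rule exI[of _ d], rule exI[of _ \<eta>],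
      intro conjI allI impI, goal_cases)
    case 1 show ?case by (rule T)
  next
    case 2 show ?case by (rule d)
  next
    case 3 show ?case by (rule \<eta>)
  next
    case (4 n W)
    note n = 4(1) and W = 4(2-4) and deg = 4(5)
    show ?case
    \<comment> \<open>For \<open>n < 5\<close> the number \<open>(n + 3) div 4\<close> is 1, while
      the family of expanders only starts at two vertices.\<close>
    proof (cases "5 \<le> n")
      case False
      let ?s = "input_memory (enc_digraph [0..<n] W)"
      let ?G = "\<lparr>verts = {0}, arcs = {}, tail = (\<lambda>_. 0), head = (\<lambda>_. 0)\<rparr> :: (nat, nat) pre_digraph"
      have s0: "?s 0 0 = n" "?s 1 i = 0" for i
        by (simp_all add: input_memory_def enc_digraph_def enc_list_def)
      have "5 < word_bound k n" using k5 by (simp add: word_bound_def)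
      then have small: "wp (word_bound k n) p ?s (\<lambda>t s. t \<le> 3 \<and> (\<forall>i<5. s 1 i = [2, 1, 0, 0, 0] ! i))"
        unfolding p_def using False s0 by (intro wp_algorithm_small) auto
      have enc: "enc_expander [0] ?G [] (\<lambda>_. []) = [2, 1, 0, 0, 0]"
        by (simp add: enc_expander_def enc_digraph_def enc_list_def)
      have T3: "3 \<le> T n"
      proof -
        have "1 * 1 \<le> n\<^sup>2 * ?L n ^ 3"
          using n floorlog_bounds2(3)[OF n] by (intro mult_le_mono) simp_all
        then have "K * 1 \<le> K * (n\<^sup>2 * ?L n ^ 3)" by (intro mult_le_mono2) simp
        moreover have "3 \<le> K" by (simp add: K_def)
        ultimately have "3 \<le> K * (n\<^sup>2 * ?L n ^ 3)" by linarith
        then have "3 \<le> K * n\<^sup>2 * ?L n ^ 3" by (simp only: mult.assoc)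
        then show ?thesis unfolding T_def by linarith
      qed
      obtain t s where "run (word_bound k n) p ?s t s" "t \<le> 3" "\<forall>i<5. s 1 i = [2, 1, 0, 0, 0] ! i"
        using small unfolding wp_def by blast
      then have out: "outputs_within p (word_bound k n) (enc_digraph [0..<n] W) (T n) (enc_expander [0] ?G [] (\<lambda>_. []))"
        unfolding outputs_within_def enc using T3 by (intro exI[of _ t] exI[of _ s]) simp
      have G: "fin_digraph ?G" "loopfree_digraph ?G" by unfold_locales simp_all
      have exp: "is_expander \<alpha> ?G" by (rule singleton_expander[of _ 0]) simp
      have rem: "remove_arcs ?G (set []) = ?G" by (simp add: remove_arcs_def)
      have emb: "is_embedding ?G W (\<lambda>_. [])" using W(2) n by (simp add: is_embedding_def)
      have "finite (arcs W)" using W(1) by (rule fin_digraph.finite_arcs)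
      then have cong: "congestion ?G W (\<lambda>_. []) \<le> \<eta> n"
        unfolding congestion_def by (intro Max.boundedI) auto
      have deg: "degree ?G v \<le> 18" for v
        by (simp add: degree_def in_degree_def out_degree_def in_arcs_def out_arcs_def)
      have num: "arcs_numbered ?G" by (simp add: arcs_numbered_def)
      show ?thesis
      proof (rule disjI2, rule exI[of _ ?G], rule exI[of _ "[0]"], rule exI[of _ "[]"], rule exI[of _ "\<lambda>_. []"],
          unfold rem, intro conjI)
        show "real n / 4 \<le> real (card (verts ?G))" using False by simp
        show "verts ?G \<subseteq> verts W" using W(2) n by simp
        show "real (card (set [])) \<le> \<alpha> * real n / 1000" using assms(1) by simp
      qed (use G exp emb cong deg num out in simp_all)
    next
      case True
      define E where "E = card (arcs W)"
      define m where "m = (n + 3) div 4"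
      define L where "L = ?L n"
      define D where "D = C * L"
      define B where "B = word_bound k n"
      have L: "n < 2 ^ L" "1 \<le> L" "L \<le> n" using floorlog_bounds2[OF n] by (auto simp: L_def)
      have m1: "1 < m" and mn: "m \<le> n" using True by (auto simp: m_def)
      note Hm = H[rule_format, OF m1]
      have arcs_W: "arcs W = {..<E}" using W(3) by (simp add: arcs_numbered_def E_def)
      have degD: "in_degree W v \<le> D" if "v < n" for v
      proof -
        have "v \<in> verts W" using that W(2) by simp
        with deg have "real (degree W v) \<le> \<Delta> n" by blast
        also have "\<dots> \<le> real C * real L" unfolding L_def by (rule C(2)[OF n])
        finally have "degree W v \<le> C * L" by (simp flip: of_nat_mult)
        then show ?thesis by (simp add: degree_def D_def)
      qed
      have E: "E \<le> C * L * n"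
        unfolding E_def sum_in_degree[OF W(1)] W(2)
        by (rule order_trans[OF sum_mono[where g = "\<lambda>_. D"]]) (use degD in \<open>auto simp: D_def\<close>)
      have D1: "1 \<le> D" using C(1) L by (simp add: D_def)
      let ?xs = "loopless (H m)"
      let ?r = "length ?xs"
      have degH: "in_degree (H m) v \<le> 9 \<and> out_degree (H m) v \<le> 9" if "v < m" for v using Hm that by auto
      note RL = router_loopless[OF W(1,2) arcs_W True m_def D1 degD L(1) _ _ _ degH]
      have rH: "card (arcs (H m)) \<le> 9 * m" using RL(2) Hm by blast
      interpret R: router W n E D L m ?r "\<lambda>i. tail (H m) (?xs ! i)" "\<lambda>i. head (H m) (?xs ! i)"
        using RL(1) Hm by blast
      have dR: "R.d = d n" unfolding R.d_def by (simp add: d_def D_def L_def)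
      have \<eta>R: "R.\<eta> = \<eta> n" unfolding R.\<eta>_def dR by (simp add: \<eta>_def)
      have \<eta>c: "\<eta> n = 2160000 * C * (L * L)" by (simp add: \<eta>_def d_def L_def)
      have r9: "?r \<le> 9 * n" using R.r mn by simp
      have big: "20 * (n + 10) * (?r + 10) + 1000 * (n + E + ?r + 10) + 2160000 * C * (L * L) < B"
        unfolding B_def by (rule word_bound_large[OF True r9 E L(3) order_refl k(1)])
      interpret M: router_machine W n E D L m ?r "\<lambda>i. tail (H m) (?xs ! i)" "\<lambda>i. head (H m) (?xs ! i)" B
        by unfold_locales (use big \<eta>R \<eta>c in simp)
      obtain tH sH where runH: "run (word_bound kH m) pH (input_memory [m]) tH sH" "real tH \<le> TH m"
        "\<forall>i<length (enc_digraph [0..<m] (H m)). sH 1 i = enc_digraph [0..<m] (H m) ! i"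
        using Hm unfolding outputs_within_def by blast
      have "m ^ kH \<le> n ^ k"
        using power_mono[of m n kH] power_increasing[of kH k n] mn n k(2) by simp
      then have "word_bound kH m \<le> B" using k(2) by (simp add: B_def word_bound_def)
      then have "run B pH (input_memory [m]) tH sH" using run_mono[OF runH(1)] by blast
      then have wpH: "wp B pH (input_memory [m]) (\<lambda>t s. t \<le> tH \<and>
        (\<forall>i<length (enc_digraph [0..<m] (H m)). s 1 i = enc_digraph [0..<m] (H m) ! i))"
        using runH(3) unfolding wp_def by blast
      have "real tH \<le> real (c * m)" using runH(2) c(2)[of m] m1 by simp
      then have "tH \<le> c * m" by linarith
      then have tH: "tH \<le> c * n" using mn by (meson le_trans mult_le_mono2)
      have B3: "1000 * (n + E + 10) + 2160000 * C * (L * L) < B" "L * L < B" "2160000 * C < B"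
      proof -
        show 1: "1000 * (n + E + 10) + 2160000 * C * (L * L) < B" using big by simp
        have "1 * (L * L) \<le> 2160000 * C * (L * L)" using C(1) by (intro mult_le_mono1) simp
        then show "L * L < B" using 1 by linarith
        have "2160000 * C * (1 * 1) \<le> 2160000 * C * (L * L)" using L(2) by (intro mult_le_mono2 mult_le_mono)
        then show "2160000 * C < B" using 1 by linarith
      qed
      have HmB: "fin_digraph (H m)" "verts (H m) = {..<m}" "arcs_numbered (H m)" "is_expander \<alpha> (H m)"
        using Hm by auto
      let ?s = "input_memory (enc_digraph [0..<n] W)"
      have input: "fits B ?s (Sub (Const 5) (V 0))" "val ?s (Sub (Const 5) (V 0)) = 0"
        using B3(1) True by (simp_all add: input_memory_def enc_digraph_def enc_list_def)
      have wp_p: "wp B p ?s (\<lambda>t s. t \<le> 1 + (tH + 100 * n + 4 * E + 100) + M.core_cost \<and>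
         (\<exists>ys. printed s ys \<and> M.correct_output ys))"
      proof -
        have "wp B (Seq (prepare (2160000 * C) pH) (Seq main_loop finish)) ?s
           (\<lambda>t s. 1 + t \<le> 1 + (tH + 100 * n + 4 * E + 100) + M.core_cost \<and>
             (\<exists>ys. printed s ys \<and> M.correct_output ys))"
          apply (subst wp_Seq)
          apply (rule wp_use[OF wp_prepare[OF W(1,2) arcs_W m_def HmB(1-3) rH L_def L(3) n wpH B3]])
          subgoal premises pre for t1 s1
            apply (rule wp_mono[OF M.wp_core])
            subgoal using pre(1) \<eta>R \<eta>c by (simp add: R.static_def)
            subgoal using pre(1) by simp
            subgoal using pre(1) by simp
            subgoal using pre(1) by blast
            subgoal using pre(1) by auto
            done
          done
        then show ?thesis unfolding p_def algorithm_def using input by simp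
      qed
      have cost: "real (1 + (tH + 100 * n + 4 * E + 100) + M.core_cost) \<le> T n"
      proof -
        have "1 + (tH + 100 * n + 4 * E + 100) + M.core_cost \<le> K * n\<^sup>2 * L ^ 3"
          unfolding M.core_cost_def M.iter_cost_def M.search_cost_def M.carve_cost_def K_def
          by (rule cost_bound[OF n L(2) C(1) E r9 R.d_def[unfolded D_def] tH, folded D_def])
        then show ?thesis unfolding T_def L_def by (rule of_nat_mono)
      qed
      obtain ys where ys: "M.correct_output ys"
        and out: "outputs_within p (word_bound k n) (enc_digraph [0..<n] W) (T n) ys"
      proof -
        from wp_p obtain t s ys where "run B p ?s t s" "t \<le> 1 + (tH + 100 * n + 4 * E + 100) + M.core_cost"
          "printed s ys" "M.correct_output ys" unfolding wp_def by blast
        then have "wp B p ?s (\<lambda>t s. t \<le> 1 + (tH + 100 * n + 4 * E + 100) + M.core_cost \<and> printed s ys)"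
          unfolding wp_def by blast
        from printed_outputs_within[OF this cost] \<open>M.correct_output ys\<close> show ?thesis
          using that unfolding B_def by blast
      qed
      from ys[unfolded M.correct_output_def] show ?thesis
      proof (elim disjE exE conjE)
        fix A
        assume A: "is_cut W A ({..<n} - A)" "100 * card (arcs_between W A ({..<n} - A)) \<le> n"
          "n \<le> 10 * card A" "n \<le> 10 * card ({..<n} - A)"
          and eq: "ys = enc_cut (filter (\<lambda>v. v \<in> A) [0..<n]) (filter (\<lambda>v. v \<notin> A) [0..<n])"
        let ?as = "filter (\<lambda>v. v \<in> A) [0..<n]" and ?bs = "filter (\<lambda>v. v \<notin> A) [0..<n]"
        have sets: "set ?as = A" "set ?bs = {..<n} - A"
          using A(1) W(2) by (auto simp: is_cut_def)
        show ?thesis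
          by (rule disjI1, rule exI[of _ ?as], rule exI[of _ ?bs], unfold sets) (use A out eq in auto)
      next
        fix f P
        assume f: "inj_on f {..<m}" "f ` {..<m} \<subseteq> {..<n}"
          and P: "is_embedding (R.host_graph f) W P" "\<forall>e\<in>arcs (R.host_graph f). length (P e) \<le> R.d"
            "congestion (R.host_graph f) W P \<le> R.\<eta>"
          and eq: "ys = enc_expander (map f [0..<m]) (R.host_graph f) [] P"
        have G: "remove_arcs (R.host_graph f) (set []) = R.host_graph f" by (simp add: remove_arcs_def)
        have exp: "is_expander \<alpha> (R.host_graph f)"
          by (rule R.host_graph_expander[OF f(1) HmB]) auto
        have V: "verts (R.host_graph f) = f ` {..<m}" by (simp add: R.host_graph_def)
        have "real n / 4 \<le> real m" using R.m_bounds(4) by linarith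
        then show ?thesis
          using R.host_graph[OF f(1)] exp f P W(2) out eq assms(1) dR \<eta>R
          by (intro disjI2 exI[of _ "R.host_graph f"] exI[of _ "map f [0..<m]"] exI[of _ "[]"] exI[of _ P])
            (auto simp: G[simplified] V distinct_map lessThan_atLeast0)
      qed
    qed
  qed
qed

end
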